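(* Let $G$ be an undirected weighted graph on $n$ vertices whose edges are arbitrarily allocated among $s$ sites, and whose edge weights are polynomially upper bounded in $n$. Then for any constant $\varepsilon\in(0,1)$, a $(1+\varepsilon)$-spectral sparsifier of $G$ can be constructed (with high probability) using $\tilde O(n+s)$ bits of communication in the blackboard model.
   Context: The Laplacian of $G$ is $L_G=D_G-A_G$ with $A_G$ the weighted adjacency matrix and $D_G$ the diagonal degree matrix. A $(1+\varepsilon)$-spectral sparsifier of $G$ is a subgraph $H$ of $G$ with reweighted edges such that $(1-\varepsilon)L_G\preceq L_H\preceq(1+\varepsilon)L_G$ in the Loewner order. Blackboard model: $s$ sites share a blackboard; any message written by a site is seen by all other sites without further communication, and the order in which sites speak is determined by the blackboard's contents; the communication cost is the total number of bits written. $\tilde O$ suppresses polylogarithmic factors.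
   Formalization: Edge weights are assumed to be at least 1/n^c as well as at most n^c for a constant c, since with arbitrarily small positive real weights no bounded number of bits suffices even for a single edge; positive integer weights are covered. *)

theory Defs
  imports "HOL-Probability.Product_PMF" "Jordan_Normal_Form.Matrix"
begin

section \<open>Weighted graphs and spectral sparsifiers\<close>

text \<open>The vertex set is always \<open>{..<n}\<close>, with \<open>n\<close> passed explicitly; an edge is a two-element set
  of vertices. Only the values of \<open>weight\<close> on \<open>edges\<close> are meaningful.\<close>

record wgraph =
  edges :: "nat set set"
  weight :: "nat set \<Rightarrow> real"

definition weighted_graph :: "nat \<Rightarrow> wgraph \<Rightarrow> bool" where
  "weighted_graph n G \<longleftrightarrow>
     edges G \<subseteq> {e. e \<subseteq> {..<n} \<and> card e = 2} \<and> (\<forall>e\<in>edges G. weight G e > 0)"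

definition adjacency_mat :: "nat \<Rightarrow> wgraph \<Rightarrow> real mat" where
  "adjacency_mat n G = mat n n (\<lambda>(i, j). if {i, j} \<in> edges G then weight G {i, j} else 0)"

definition degree_mat :: "nat \<Rightarrow> wgraph \<Rightarrow> real mat" where
  "degree_mat n G = mat n n (\<lambda>(i, j). if i = j then \<Sum>e | e \<in> edges G \<and> i \<in> e. weight G e else 0)"

definition laplacian :: "nat \<Rightarrow> wgraph \<Rightarrow> real mat" where
  "laplacian n G = degree_mat n G - adjacency_mat n G"

definition positive_semidefinite :: "nat \<Rightarrow> real mat \<Rightarrow> bool" where
  "positive_semidefinite n A \<longleftrightarrow>
     A \<in> carrier_mat n n \<and> A\<^sup>T = A \<and> (\<forall>v\<in>carrier_vec n. 0 \<le> v \<bullet> (A *\<^sub>v v))"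

definition loewner_le :: "nat \<Rightarrow> real mat \<Rightarrow> real mat \<Rightarrow> bool" where
  "loewner_le n A B \<longleftrightarrow> positive_semidefinite n (B - A)"

definition spectral_sparsifier :: "nat \<Rightarrow> real \<Rightarrow> wgraph \<Rightarrow> wgraph \<Rightarrow> bool" where
  "spectral_sparsifier n \<epsilon> G H \<longleftrightarrow>
     weighted_graph n H \<and> edges H \<subseteq> edges G \<and>
     loewner_le n ((1 - \<epsilon>) \<cdot>\<^sub>m laplacian n G) (laplacian n H) \<and>
     loewner_le n (laplacian n H) ((1 + \<epsilon>) \<cdot>\<^sub>m laplacian n G)"

text \<open>Weights are real, so the polynomial upper bound is read as a polynomial bound on the range of
  the weights (positive integer weights up to \<open>n ^ c\<close> are a special case). Some lower bound is
  indispensable: for a single edge whose weight may be any real in \<open>(0, 1]\<close>, no bounded number of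
  bits determines the weight up to a factor \<open>1 \<plusminus> \<epsilon>\<close>.\<close>

definition poly_bounded_weights :: "nat \<Rightarrow> nat \<Rightarrow> wgraph \<Rightarrow> bool" where
  "poly_bounded_weights c n G \<longleftrightarrow>
     (\<forall>e\<in>edges G. 1 / real n ^ c \<le> weight G e \<and> weight G e \<le> real n ^ c)"

text \<open>The input of site \<open>i\<close> when edge \<open>e\<close> is allocated to site \<open>\<sigma> e\<close>. The weight function is cut
  off outside the site's own edges, so that the input carries no information on the rest of \<open>G\<close>.\<close>

definition site_graph :: "wgraph \<Rightarrow> (nat set \<Rightarrow> nat) \<Rightarrow> nat \<Rightarrow> wgraph" where
  "site_graph G \<sigma> i =
     \<lparr>edges = {e \<in> edges G. \<sigma> e = i},
      weight = (\<lambda>e. if e \<in> edges G \<and> \<sigma> e = i then weight G e else 0)\<rparr>"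


section \<open>The blackboard model\<close>

text \<open>The blackboard is the list of all bits written so far. Its contents determine who writes the
  next bit (\<open>None\<close>: the protocol stops) and, at the end, the result. The bit itself depends on the
  speaker's own input, the speaker's own private random source and the blackboard. Longer messages
  are sequences of single bits. The random sources of the sites are independent with arbitrary
  discrete distributions.\<close>

record ('x, 'y) protocol =
  speaker :: "bool list \<Rightarrow> nat option"
  next_bit :: "nat \<Rightarrow> 'x \<Rightarrow> nat \<Rightarrow> bool list \<Rightarrow> bool"
  coins :: "nat \<Rightarrow> nat pmf"
  result :: "bool list \<Rightarrow> 'y"

definition blackboard_protocol :: "nat \<Rightarrow> ('x, 'y) protocol \<Rightarrow> bool" where
  "blackboard_protocol s P \<longleftrightarrow> (\<forall>b i. speaker P b = Some i \<longrightarrow> i < s)"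

definition joint_coins :: "nat \<Rightarrow> ('x, 'y) protocol \<Rightarrow> (nat \<Rightarrow> nat) pmf" where
  "joint_coins s P = Pi_pmf {..<s} 0 (coins P)"

primrec board :: "('x, 'y) protocol \<Rightarrow> (nat \<Rightarrow> 'x) \<Rightarrow> (nat \<Rightarrow> nat) \<Rightarrow> nat \<Rightarrow> bool list" where
  "board P x r 0 = []"
| "board P x r (Suc t) =
     (case speaker P (board P x r t) of
        None \<Rightarrow> board P x r t
      | Some i \<Rightarrow> board P x r t @ [next_bit P i (x i) (r i) (board P x r t)])"

definition terminates :: "('x, 'y) protocol \<Rightarrow> (nat \<Rightarrow> 'x) \<Rightarrow> (nat \<Rightarrow> nat) \<Rightarrow> bool" where
  "terminates P x r \<longleftrightarrow> (\<exists>t. speaker P (board P x r t) = None)"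

definition final_board :: "('x, 'y) protocol \<Rightarrow> (nat \<Rightarrow> 'x) \<Rightarrow> (nat \<Rightarrow> nat) \<Rightarrow> bool list" where
  "final_board P x r = board P x r (LEAST t. speaker P (board P x r t) = None)"

definition comm_cost :: "('x, 'y) protocol \<Rightarrow> (nat \<Rightarrow> 'x) \<Rightarrow> (nat \<Rightarrow> nat) \<Rightarrow> nat" where
  "comm_cost P x r = length (final_board P x r)"

definition protocol_output :: "('x, 'y) protocol \<Rightarrow> (nat \<Rightarrow> 'x) \<Rightarrow> (nat \<Rightarrow> nat) \<Rightarrow> 'y" where
  "protocol_output P x r = result P (final_board P x r)"


section \<open>Soft-O\<close>

text \<open>The bound is uniform in both arguments, so that neither needs to tend to infinity. The shift
  by 2 only keeps the logarithm at least 1.\<close>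

definition soft_O :: "(nat \<Rightarrow> nat \<Rightarrow> real) \<Rightarrow> (nat \<Rightarrow> nat \<Rightarrow> real) set" where
  "soft_O f = {g. \<exists>C k. \<forall>n\<ge>1. \<forall>s\<ge>1. \<bar>g n s\<bar> \<le> C * \<bar>f n s\<bar> * log 2 (2 + \<bar>f n s\<bar>) ^ k}"

end

theory Submission
  imports Defs "Jordan_Normal_Form.Determinant" "HOL-Library.Log_Nat"
begin

text \<open>The protocol runs \<open>O(log n)\<close> halving rounds. In a round the sites speak one after the other, and a
  site posts its unposted surviving edges as long as one of them is heavy: its leverage with respect to
  the edges on the board, regularised by \<open>\<delta> I\<close>, exceeds \<open>\<eta> = 1 / polylog n\<close>. Every post multiplies
  \<open>det (L + \<delta> I)\<close> by at least \<open>1 + \<eta>\<close>, which bounds the number of posts by \<open>n polylog n\<close> whatever the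
  coins are; leaving a round costs one message per site. After the round every unposted edge is light,
  and each of them is privately dropped or doubled with probability 1/2. After \<open>O(log n)\<close> rounds
  no unposted edge survives, with high probability, and the board is the sparsifier.

  One halving changes the quadratic form by a Rademacher sum \<open>X = \<Sum> \<plusminus> v v\<^sup>T\<close> with \<open>|v|\<^sup>2 \<le> \<eta>\<close> and
  \<open>\<Sum> v v\<^sup>T \<le> I\<close> (in a basis in which the current form is the identity). Flipping single signs and
  the log-convexity of the moments \<open>v\<^sup>T X\<^sup>m v\<close> give
  \<open>E tr X\<^bsup>2k+2\<^esup> \<le> 2 (2k + 1) \<eta> E tr X\<^bsup>2k\<^esup>\<close>, so Markov's inequality with \<open>k \<sim> log n\<close>
  bounds \<open>|X|\<close>. Only Cauchy-Schwarz is needed, no spectral theorem and no matrix Chernoff bound.\<close>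

section \<open>Moments of self-adjoint operators and Rademacher sums\<close>

text \<open>A Laplacian is singular, with a kernel that depends on the components, so neither
  leverages nor the determinant potential make sense for L itself; \<delta> repairs both. It is
  removed at the end: forms of graphs depend only on differences along edges, so \<open>x\<close>
  may be shifted on each component until \<delta> |x|^2 is dominated by the form, if \<delta> is at
  most the smallest weight over n^5. The lower bound on the weights serves here and again when
  weights are rounded up to multiples of 1/K to fit in a message. The other obstacle is adaptivity:
  the board depends on earlier coins, so the vectors of a Rademacher sum are themselves random. But
  the board at the end of a round involves only bits of earlier rounds; fixing all bits except those
  of one round freezes the vectors and leaves independent signs. As the coins are uniform on a
  finite set, probability is counting and independence is a family of sign-flipping involutions. An
  edge light for the board is light for the sampled form, which is larger, and stays light as the
  board grows, so one turn per site and round suffices.\<close>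

definition dot :: "nat \<Rightarrow> (nat \<Rightarrow> real) \<Rightarrow> (nat \<Rightarrow> real) \<Rightarrow> real" where
  "dot n x y = (\<Sum>i<n. x i * y i)"

definition unit_fun :: "nat \<Rightarrow> nat \<Rightarrow> real" where
  "unit_fun i = (\<lambda>j. if j = i then 1 else 0)"

lemma dot_commute: "dot n x y = dot n y x"
  by (simp add: dot_def mult.commute)

lemma dot_self_nonneg: "0 \<le> dot n x x"
  by (simp add: dot_def sum_nonneg)

lemma dot_Cauchy_Schwarz: "(dot n x y)\<^sup>2 \<le> dot n x x * dot n y y"
  using Cauchy_Schwarz_ineq_sum[of x y "{..<n}"] by (simp add: dot_def power2_eq_square)

lemma dot_unit_right: "i < n \<Longrightarrow> dot n x (unit_fun i) = x i"
  by (simp add: dot_def unit_fun_def if_distrib[of "\<lambda>t. _ * t"] cong: if_cong)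

lemma dot_unit_left: "i < n \<Longrightarrow> dot n (unit_fun i) x = x i"
  by (simp add: dot_commute[of n "unit_fun i"] dot_unit_right)

lemma unit_fun_self: "unit_fun i i = 1"
  by (simp add: unit_fun_def)

lemma dot_expand: "(\<Sum>i<n. dot n x (unit_fun i) * dot n y (unit_fun i)) = dot n y x"
proof -
  have "(\<Sum>i<n. dot n x (unit_fun i) * dot n y (unit_fun i)) = (\<Sum>i<n. x i * y i)"
    by (intro sum.cong) (auto simp: dot_unit_right)
  then show ?thesis by (simp add: dot_def mult.commute)
qed

lemma dot_sum_right: "dot n x (\<lambda>j. \<Sum>a\<in>I. c a * v a j) = (\<Sum>a\<in>I. c a * dot n x (v a))"
  unfolding dot_def sum_distrib_left
  by (subst sum.swap) (simp add: ac_simps)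

lemma dot_sum_left: "dot n (\<lambda>j. \<Sum>a\<in>I. c a * v a j) x = (\<Sum>a\<in>I. c a * dot n (v a) x)"
  unfolding dot_commute[of n _ x] by (rule dot_sum_right)

section \<open>Log-convexity of the moments of a self-adjoint operator\<close>

definition selfadjoint :: "nat \<Rightarrow> ((nat \<Rightarrow> real) \<Rightarrow> nat \<Rightarrow> real) \<Rightarrow> bool" where
  "selfadjoint n A \<longleftrightarrow> (\<forall>x y. dot n (A x) y = dot n x (A y))"

lemma selfadjoint_funpow:
  assumes "selfadjoint n A" shows "dot n ((A ^^ m) x) y = dot n x ((A ^^ m) y)"
proof (induction m arbitrary: y)
  case (Suc m)
  have "dot n ((A ^^ Suc m) x) y = dot n ((A ^^ m) x) (A y)"
    using assms by (simp add: selfadjoint_def)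
  also have "\<dots> = dot n x ((A ^^ Suc m) y)"
    by (simp add: Suc funpow_swap1)
  finally show ?case .
qed simp

lemma dot_funpow_funpow:
  assumes "selfadjoint n A"
  shows "dot n ((A ^^ i) x) ((A ^^ j) y) = dot n x ((A ^^ (i + j)) y)"
  by (simp add: selfadjoint_funpow[OF assms] funpow_add)

text \<open>Discrete maximum principle: at the leftmost maximiser of \<open>t\<close> on
  \<open>{..r}\<close>, log-convexity forces the left neighbour to attain the maximum too. Working
  with \<open>t\<close> instead of its logarithm allows zero values.\<close>

lemma log_convex_le_one:
  fixes t :: "nat \<Rightarrow> real"
  assumes "t 0 \<le> 1" "t r \<le> 1" "\<And>i. 0 \<le> t i"
    and lc: "\<And>i. 0 < i \<Longrightarrow> i < r \<Longrightarrow> (t i)\<^sup>2 \<le> t (i - 1) * t (i + 1)"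
    and "i \<le> r"
  shows "t i \<le> 1"
proof (rule ccontr)
  assume c: "\<not> t i \<le> 1"
  define m where "m = Max (t ` {..r})"
  have mx: "t j \<le> m" if "j \<le> r" for j using that by (simp add: m_def)
  have "m \<in> t ` {..r}" unfolding m_def by (rule Max_in) auto
  then have ex: "\<exists>j. j \<le> r \<and> t j = m" by auto
  define j where "j = (LEAST j. j \<le> r \<and> t j = m)"
  have j: "j \<le> r" "t j = m" using LeastI_ex[OF ex] by (auto simp: j_def)
  have m1: "m > 1" using mx[OF \<open>i \<le> r\<close>] c by simp
  have "j \<noteq> 0" "j \<noteq> r" using j m1 assms(1,2) by (metis not_less)+
  then have j2: "0 < j" "j < r" using j by auto
  have "m\<^sup>2 \<le> t (j - 1) * t (j + 1)" using lc[OF j2] j by simp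
  also have "\<dots> \<le> t (j - 1) * m" using mx[of "j + 1"] j2 assms(3) by (intro mult_left_mono) auto
  finally have "m \<le> t (j - 1)" using m1 by (simp add: power2_eq_square)
  with mx[of "j - 1"] j2 have "j - 1 \<le> r \<and> t (j - 1) = m" by auto
  then have "j \<le> j - 1" unfolding j_def by (rule Least_le)
  with j2 show False by simp
qed

text \<open>The even moments are the squared norms \<open>a i\<close> of \<open>(A ^^ i) v\<close>,
  log-convex by Cauchy-Schwarz. Divided by |v|^2 \<rho>^(2i) they are at most 1 at both ends, hence
  in between. For a spectral measure this would be Lyapunov's inequality.\<close>

lemma moment_bound:
  assumes sa: "selfadjoint n A" and \<rho>: "\<rho> > 0"
    and top: "dot n v ((A ^^ (2 * r)) v) \<le> dot n v v * \<rho> ^ (2 * r)" and q: "q \<le> 2 * r"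
  shows "\<bar>dot n v ((A ^^ q) v)\<bar> \<le> dot n v v * \<rho> ^ q"
proof (cases "dot n v v = 0")
  case True
  have "(dot n v ((A ^^ q) v))\<^sup>2 \<le> 0"
    using dot_Cauchy_Schwarz[of n v "(A ^^ q) v"] True by simp
  then show ?thesis using True by simp
next
  case False
  define c where "c = dot n v v"
  have c: "c > 0" using False dot_self_nonneg[of n v] by (simp add: c_def)
  define a where "a i = dot n ((A ^^ i) v) ((A ^^ i) v)" for i
  have a_eq: "a i = dot n v ((A ^^ (2 * i)) v)" for i
    by (simp add: a_def dot_funpow_funpow[OF sa] mult_2)
  have mid: "(dot n v ((A ^^ (i + j)) v))\<^sup>2 \<le> a i * a j" for i j
    using dot_Cauchy_Schwarz[of n "(A ^^ i) v" "(A ^^ j) v"]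
    by (simp add: dot_funpow_funpow[OF sa] a_def)
  have even: "a i \<le> c * \<rho> ^ (2 * i)" if "i \<le> r" for i
  proof -
    have "a i / (c * \<rho> ^ (2 * i)) \<le> 1"
    proof (rule log_convex_le_one[where r = r and t = "\<lambda>i. a i / (c * \<rho> ^ (2 * i))"])
      show "a 0 / (c * \<rho> ^ (2 * 0)) \<le> 1" using c by (simp add: a_def c_def)
      show "a r / (c * \<rho> ^ (2 * r)) \<le> 1" using top c \<rho> by (simp add: a_eq c_def)
      show "0 \<le> a i / (c * \<rho> ^ (2 * i))" for i
        using c \<rho> by (simp add: a_def dot_self_nonneg)
      show "(a i / (c * \<rho> ^ (2 * i)))\<^sup>2
          \<le> a (i - 1) / (c * \<rho> ^ (2 * (i - 1))) * (a (i + 1) / (c * \<rho> ^ (2 * (i + 1))))"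
        if i: "0 < i" "i < r" for i
      proof -
        have eq: "(\<rho> ^ (2 * i))\<^sup>2 = \<rho> ^ (2 * (i - 1)) * \<rho> ^ (2 * (i + 1))"
          using i by (cases i) (simp_all add: power2_eq_square power_add ac_simps mult_2)
        have "(a i)\<^sup>2 \<le> a (i - 1) * a (i + 1)"
          using mid[of "i - 1" "i + 1"] i a_eq[of i] by (simp add: mult_2)
        then have "(a i)\<^sup>2 / (c\<^sup>2 * (\<rho> ^ (2 * i))\<^sup>2) \<le> a (i - 1) * a (i + 1) / (c\<^sup>2 * (\<rho> ^ (2 * i))\<^sup>2)"
          by (rule divide_right_mono) simp
        then show ?thesis
          by (subst (asm) (2) eq) (simp add: power2_eq_square ac_simps)
      qed
      show "i \<le> r" by fact
    qed
    then show ?thesis using c \<rho> by (simp add: field_simps)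
  qed
  \<comment> \<open>Splitting \<open>q\<close> into two nearly equal parts bounds an odd moment by
    two even ones; both parts are at most \<open>r\<close> because
    \<open>q \<le> 2 * r\<close>.\<close>
  define i j where "i = q div 2" and "j = q - q div 2"
  have ij: "i \<le> r" "j \<le> r" "i + j = q" using q by (auto simp: i_def j_def)
  have "(dot n v ((A ^^ q) v))\<^sup>2 \<le> a i * a j" using mid[of i j] ij by simp
  also have "\<dots> \<le> (c * \<rho> ^ (2 * i)) * (c * \<rho> ^ (2 * j))"
    using even ij c \<rho> by (intro mult_mono) (auto simp: a_def dot_self_nonneg)
  also have "\<dots> = (c * \<rho> ^ q)\<^sup>2"
    by (simp add: ij(3)[symmetric] power_mult_distrib power_add power2_eq_square power_mult[symmetric] ac_simps mult_2_right)
  finally have "\<bar>dot n v ((A ^^ q) v)\<bar> \<le> \<bar>c * \<rho> ^ q\<bar>"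
    using abs_le_square_iff by blast
  then show ?thesis using c \<rho> by (simp add: c_def)
qed

text \<open>One common rate \<rho> serves both operators: chosen so that |v|^2 \<rho>^(2r) matches
  the sum of the two top moments, it bounds the product by |v|^2 \<rho>^q times |v|^2 \<rho>^p, and
  the exponents add up to 2r.\<close>

lemma mixed_moment_bound:
  assumes A: "selfadjoint n A" and B: "selfadjoint n B" and pq: "p + q = 2 * r"
  shows "dot n v ((A ^^ q) v) * dot n v ((B ^^ p) v)
    \<le> dot n v v * (dot n v ((A ^^ (2 * r)) v) + dot n v ((B ^^ (2 * r)) v))"
proof -
  define c where "c = dot n v v"
  define D where "D = dot n v ((A ^^ (2 * r)) v) + dot n v ((B ^^ (2 * r)) v)"
  have nn: "0 \<le> dot n v ((C ^^ (2 * r)) v)" if "selfadjoint n C" for C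
    using dot_funpow_funpow[OF that, of r v r v] dot_self_nonneg[of n "(C ^^ r) v"]
    by (simp add: mult_2)
  have D: "0 \<le> D" "dot n v ((A ^^ (2 * r)) v) \<le> D" "dot n v ((B ^^ (2 * r)) v) \<le> D"
    using nn[OF A] nn[OF B] by (auto simp: D_def)
  show ?thesis
  proof (cases "r = 0 \<or> c = 0")
    case True
    then show ?thesis
    proof
      assume "r = 0" then show ?thesis using pq dot_self_nonneg[of n v] by simp
    next
      assume c0: "c = 0"
      have "(dot n v ((A ^^ q) v))\<^sup>2 \<le> 0"
        using dot_Cauchy_Schwarz[of n v "(A ^^ q) v"] c0 by (simp add: c_def)
      then show ?thesis using c0 by (simp add: c_def)
    qed
  next
    case False
    then have r: "r > 0" and c: "c > 0" using dot_self_nonneg[of n v] by (auto simp: c_def)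
    \<comment> \<open>\<open>D\<close> may vanish while \<rho> must be positive, so the bound is
      shown for every larger \<open>D'\<close> and passed to the limit by density.\<close>
    have main: "dot n v ((A ^^ q) v) * dot n v ((B ^^ p) v) \<le> c * D'" if "D < D'" for D'
    proof -
      define \<rho> where "\<rho> = root (2 * r) (D' / c)"
      have "\<rho> > 0" using that D c r by (simp add: \<rho>_def)
      have \<rho>p: "c * \<rho> ^ (2 * r) = D'"
        using that D c r by (simp add: \<rho>_def)
      have 1: "\<bar>dot n v ((A ^^ q) v)\<bar> \<le> c * \<rho> ^ q"
        unfolding c_def using pq that D \<rho>p
        by (intro moment_bound[OF A \<open>\<rho> > 0\<close>, of v r]) (auto simp: c_def)
      have 2: "\<bar>dot n v ((B ^^ p) v)\<bar> \<le> c * \<rho> ^ p"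
        unfolding c_def using pq that D \<rho>p
        by (intro moment_bound[OF B \<open>\<rho> > 0\<close>, of v r]) (auto simp: c_def)
      have "dot n v ((A ^^ q) v) * dot n v ((B ^^ p) v)
          \<le> \<bar>dot n v ((A ^^ q) v)\<bar> * \<bar>dot n v ((B ^^ p) v)\<bar>"
        by (metis abs_ge_self abs_mult)
      also have "\<dots> \<le> (c * \<rho> ^ q) * (c * \<rho> ^ p)"
        using 1 2 c \<open>\<rho> > 0\<close> by (intro mult_mono) auto
      also have "\<dots> = c * (c * \<rho> ^ (p + q))" by (simp add: power_add ac_simps)
      also have "\<dots> = c * D'" by (simp add: pq \<rho>p)
      finally show ?thesis .
    qed
    have "dot n v ((A ^^ q) v) * dot n v ((B ^^ p) v) / c \<le> D"
    proof (rule dense_ge)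
      fix D' assume "D < D'"
      from main[OF this] show "dot n v ((A ^^ q) v) * dot n v ((B ^^ p) v) / c \<le> D'"
        using c by (simp add: field_simps)
    qed
    then show ?thesis using c by (simp add: field_simps c_def D_def)
  qed
qed


text \<open>Independent fair signs without a probability space: \<open>flip a\<close> is an
  involution of a finite set that changes the sign of \<open>a\<close> and no other. \<Omega> may be
  any set closed under the flips, later a fibre of the coins. \<open>v_frame\<close> says that the
  sum of all v v^T is at most the identity.\<close>

locale sign_flips =
  fixes n :: nat and \<Omega> :: "'w set" and I :: "'a set" and sg :: "'a \<Rightarrow> 'w \<Rightarrow> real"
    and flip :: "'a \<Rightarrow> 'w \<Rightarrow> 'w" and v :: "'a \<Rightarrow> nat \<Rightarrow> real" and \<eta> :: real
  assumes finite_\<Omega>: "finite \<Omega>" and finite_I: "finite I"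
    and flip_in: "\<And>a \<omega>. a \<in> I \<Longrightarrow> \<omega> \<in> \<Omega> \<Longrightarrow> flip a \<omega> \<in> \<Omega>"
    and flip_flip: "\<And>a \<omega>. a \<in> I \<Longrightarrow> \<omega> \<in> \<Omega> \<Longrightarrow> flip a (flip a \<omega>) = \<omega>"
    and sg_abs: "\<And>a \<omega>. sg a \<omega> * sg a \<omega> = 1"
    and sg_flip: "\<And>a \<omega>. a \<in> I \<Longrightarrow> \<omega> \<in> \<Omega> \<Longrightarrow> sg a (flip a \<omega>) = - sg a \<omega>"
    and sg_flip_other: "\<And>a b \<omega>. a \<in> I \<Longrightarrow> b \<in> I \<Longrightarrow> a \<noteq> b \<Longrightarrow> \<omega> \<in> \<Omega> \<Longrightarrow> sg b (flip a \<omega>) = sg b \<omega>"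
    and v_small: "\<And>a. a \<in> I \<Longrightarrow> dot n (v a) (v a) \<le> \<eta>"
    and v_frame: "\<And>x. (\<Sum>a\<in>I. (dot n (v a) x)\<^sup>2) \<le> dot n x x"
    and \<eta>_nonneg: "0 \<le> \<eta>"
begin

section \<open>Trace moments of a signed sum of rank-one operators\<close>

definition X :: "'w \<Rightarrow> (nat \<Rightarrow> real) \<Rightarrow> nat \<Rightarrow> real" where
  "X \<omega> x = (\<lambda>j. \<Sum>a\<in>I. (sg a \<omega> * dot n (v a) x) * v a j)"

definition tr_pow :: "'w \<Rightarrow> nat \<Rightarrow> real" where
  "tr_pow \<omega> m = (\<Sum>i<n. dot n (unit_fun i) ((X \<omega> ^^ m) (unit_fun i)))"

lemma dot_X: "dot n y (X \<omega> x) = (\<Sum>a\<in>I. sg a \<omega> * dot n (v a) x * dot n (v a) y)"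
  unfolding X_def dot_sum_right by (simp add: dot_commute)

lemma selfadjoint_X: "selfadjoint n (X \<omega>)"
  unfolding selfadjoint_def
proof (intro allI)
  fix x y
  have "dot n (X \<omega> x) y = dot n y (X \<omega> x)" by (rule dot_commute)
  also have "\<dots> = dot n x (X \<omega> y)" unfolding dot_X by (simp add: ac_simps)
  finally show "dot n (X \<omega> x) y = dot n x (X \<omega> y)" .
qed

lemma X_flip:
  assumes "a \<in> I" "\<omega> \<in> \<Omega>"
  shows "dot n y (X \<omega> x) - dot n y (X (flip a \<omega>) x) = 2 * sg a \<omega> * dot n (v a) x * dot n (v a) y"
proof -
  have "dot n y (X \<omega> x) - dot n y (X (flip a \<omega>) x)
    = (\<Sum>b\<in>I. (sg b \<omega> - sg b (flip a \<omega>)) * dot n (v b) x * dot n (v b) y)"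
    unfolding dot_X by (simp add: sum_subtractf[symmetric] algebra_simps)
  also have "\<dots> = (\<Sum>b\<in>I. if b = a then 2 * sg a \<omega> * dot n (v a) x * dot n (v a) y else 0)"
    using assms by (intro sum.cong) (auto simp: sg_flip sg_flip_other)
  finally show ?thesis using assms finite_I by simp
qed

lemma dot_even_power: "dot n x ((X \<omega> ^^ (2 * r)) x) = dot n ((X \<omega> ^^ r) x) ((X \<omega> ^^ r) x)"
  by (simp add: dot_funpow_funpow[OF selfadjoint_X] mult_2)

lemma tr_pow_even: "tr_pow \<omega> (2 * r) = (\<Sum>i<n. dot n ((X \<omega> ^^ r) (unit_fun i)) ((X \<omega> ^^ r) (unit_fun i)))"
  by (simp add: tr_pow_def dot_even_power)

lemma norm_power_eq: "dot n ((X \<omega> ^^ r) x) ((X \<omega> ^^ r) x) = (\<Sum>i<n. (dot n x ((X \<omega> ^^ r) (unit_fun i)))\<^sup>2)"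
proof -
  have "dot n ((X \<omega> ^^ r) x) ((X \<omega> ^^ r) x) = (\<Sum>i<n. (dot n ((X \<omega> ^^ r) x) (unit_fun i))\<^sup>2)"
    by (subst (1) dot_def) (simp add: dot_unit_right power2_eq_square)
  then show ?thesis by (simp add: selfadjoint_funpow[OF selfadjoint_X])
qed

text \<open>Cyclicity of the trace: writing one factor of X^(m+1) as its defining sum leaves tr(v
  v^T X^m) = v^T X^m v for each term.\<close>

lemma tr_pow_Suc: "tr_pow \<omega> (Suc m) = (\<Sum>a\<in>I. sg a \<omega> * dot n (v a) ((X \<omega> ^^ m) (v a)))"
proof -
  have "tr_pow \<omega> (Suc m) = (\<Sum>i<n. \<Sum>a\<in>I. sg a \<omega> * dot n (v a) ((X \<omega> ^^ m) (unit_fun i)) * dot n (v a) (unit_fun i))"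
    by (simp add: tr_pow_def dot_X)
  also have "\<dots> = (\<Sum>a\<in>I. sg a \<omega> * (\<Sum>i<n. dot n ((X \<omega> ^^ m) (v a)) (unit_fun i) * dot n (v a) (unit_fun i)))"
    by (subst sum.swap) (simp add: sum_distrib_left ac_simps selfadjoint_funpow[OF selfadjoint_X])
  also have "\<dots> = (\<Sum>a\<in>I. sg a \<omega> * dot n (v a) ((X \<omega> ^^ m) (v a)))"
    by (simp add: dot_expand)
  finally show ?thesis .
qed

text \<open>The left side is the trace of X^r S X^r with S the sum of all v v^T, so the frame bound
  applies to each column of X^r.\<close>

lemma frame_le_tr_pow: "(\<Sum>a\<in>I. dot n (v a) ((X \<omega> ^^ (2 * r)) (v a))) \<le> tr_pow \<omega> (2 * r)"
proof -
  have "(\<Sum>a\<in>I. dot n (v a) ((X \<omega> ^^ (2 * r)) (v a)))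
      = (\<Sum>i<n. \<Sum>a\<in>I. (dot n (v a) ((X \<omega> ^^ r) (unit_fun i)))\<^sup>2)"
    by (subst sum.swap) (simp add: dot_even_power norm_power_eq)
  also have "\<dots> \<le> tr_pow \<omega> (2 * r)"
    unfolding tr_pow_even by (intro sum_mono v_frame)
  finally show ?thesis .
qed

text \<open>With A and B for \<open>X\<close> before and after the flip, A^m - B^m telescopes into
  terms A^q (A - B) B^(m-1-q). Since A - B is the rank-one operator 2 sg v v^T, each quadratic form
  splits into a moment of A times a moment of B.\<close>

lemma power_flip_diff:
  assumes "a \<in> I" "\<omega> \<in> \<Omega>"
  shows "dot n (v a) ((X \<omega> ^^ m) (v a)) - dot n (v a) ((X (flip a \<omega>) ^^ m) (v a))
    = (\<Sum>q<m. 2 * sg a \<omega> * (dot n (v a) ((X \<omega> ^^ q) (v a)) * dot n (v a) ((X (flip a \<omega>) ^^ (m - Suc q)) (v a))))"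
proof -
  let ?A = "X \<omega>" and ?B = "X (flip a \<omega>)" and ?v = "v a"
  define f where "f q = dot n ?v ((?A ^^ q) ((?B ^^ (m - q)) ?v))" for q
  have "f (Suc q) - f q = 2 * sg a \<omega> * (dot n ?v ((?A ^^ q) ?v) * dot n ?v ((?B ^^ (m - Suc q)) ?v))"
    if "q < m" for q
  proof -
    have mq: "m - q = Suc (m - Suc q)" using that by simp
    have "f (Suc q) = dot n ((?A ^^ q) ?v) (?A ((?B ^^ (m - Suc q)) ?v))"
      unfolding f_def by (simp add: selfadjoint_funpow[OF selfadjoint_X] funpow_swap1)
    moreover have "f q = dot n ((?A ^^ q) ?v) (?B ((?B ^^ (m - Suc q)) ?v))"
      unfolding f_def mq by (simp add: selfadjoint_funpow[OF selfadjoint_X])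
    ultimately show ?thesis
      using X_flip[OF assms, of "(?A ^^ q) ?v" "(?B ^^ (m - Suc q)) ?v"] by (simp add: ac_simps)
  qed
  then have "(\<Sum>q<m. 2 * sg a \<omega> * (dot n ?v ((?A ^^ q) ?v) * dot n ?v ((?B ^^ (m - Suc q)) ?v)))
      = (\<Sum>q<m. f (Suc q) - f q)"
    by (intro sum.cong) auto
  also have "\<dots> = f m - f 0" by (rule sum_lessThan_telescope)
  finally show ?thesis by (simp add: f_def)
qed

lemma sum_flip: "a \<in> I \<Longrightarrow> (\<Sum>\<omega>\<in>\<Omega>. f (flip a \<omega>)) = (\<Sum>\<omega>\<in>\<Omega>. f \<omega>)"
  by (rule sum.reindex_bij_witness[of _ "flip a" "flip a"]) (auto simp: flip_in flip_flip)

text \<open>Substituting \<open>flip a \<omega>\<close> for \<omega> shows that only the part of the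
  moment that is odd in the sign of \<open>a\<close> contributes. That part telescopes into 2r + 1
  products of moments whose exponents add up to 2r.\<close>

lemma signed_moment_le:
  assumes a: "a \<in> I"
  shows "(\<Sum>\<omega>\<in>\<Omega>. sg a \<omega> * dot n (v a) ((X \<omega> ^^ (2 * r + 1)) (v a)))
    \<le> 2 * (2 * real r + 1) * \<eta> * (\<Sum>\<omega>\<in>\<Omega>. dot n (v a) ((X \<omega> ^^ (2 * r)) (v a)))"
proof -
  let ?f = "\<lambda>\<omega>. dot n (v a) ((X \<omega> ^^ (2 * r + 1)) (v a))"
  let ?h = "\<lambda>\<omega>. dot n (v a) ((X \<omega> ^^ (2 * r)) (v a))"
  have h0: "0 \<le> ?h \<omega>" for \<omega> by (simp add: dot_even_power dot_self_nonneg)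
  have "(\<Sum>\<omega>\<in>\<Omega>. sg a \<omega> * ?f (flip a \<omega>)) = (\<Sum>\<omega>\<in>\<Omega>. - (sg a (flip a \<omega>) * ?f (flip a \<omega>)))"
    using a by (intro sum.cong) (auto simp: sg_flip)
  also have "\<dots> = (\<Sum>\<omega>\<in>\<Omega>. - (sg a \<omega> * ?f \<omega>))"
    by (rule sum_flip[OF a])
  finally have "2 * (\<Sum>\<omega>\<in>\<Omega>. sg a \<omega> * ?f \<omega>) = (\<Sum>\<omega>\<in>\<Omega>. sg a \<omega> * (?f \<omega> - ?f (flip a \<omega>)))"
    by (simp add: right_diff_distrib sum_subtractf sum_negf)
  also have "\<dots> \<le> (\<Sum>\<omega>\<in>\<Omega>. 2 * ((2 * real r + 1) * (\<eta> * (?h \<omega> + ?h (flip a \<omega>)))))"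
  proof (rule sum_mono)
    fix \<omega> assume w: "\<omega> \<in> \<Omega>"
    let ?g = "\<lambda>q. dot n (v a) ((X \<omega> ^^ q) (v a)) * dot n (v a) ((X (flip a \<omega>) ^^ (2 * r - q)) (v a))"
    \<comment> \<open>The outer sign meets the sign contained in the difference; their product is 1,
      so no cancellation has to be analysed any further.\<close>
    have "sg a \<omega> * (?f \<omega> - ?f (flip a \<omega>)) = (\<Sum>q<2 * r + 1. (sg a \<omega> * sg a \<omega>) * (2 * ?g q))"
      unfolding power_flip_diff[OF a w] sum_distrib_left by (simp add: ac_simps)
    also have "\<dots> = (\<Sum>q<2 * r + 1. 2 * ?g q)" by (simp add: sg_abs)
    also have "\<dots> \<le> (\<Sum>q<2 * r + 1. 2 * (\<eta> * (?h \<omega> + ?h (flip a \<omega>))))"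
    proof (rule sum_mono)
      fix q assume "q \<in> {..<2 * r + 1}"
      then have "?g q \<le> dot n (v a) (v a) * (?h \<omega> + ?h (flip a \<omega>))"
        by (intro mixed_moment_bound selfadjoint_X) auto
      also have "\<dots> \<le> \<eta> * (?h \<omega> + ?h (flip a \<omega>))"
        using v_small[OF a] h0 by (intro mult_right_mono) (auto intro: add_nonneg_nonneg)
      finally show "2 * ?g q \<le> 2 * (\<eta> * (?h \<omega> + ?h (flip a \<omega>)))" by simp
    qed
    also have "\<dots> = 2 * ((2 * real r + 1) * (\<eta> * (?h \<omega> + ?h (flip a \<omega>))))"
      by (simp add: algebra_simps)
    finally show "sg a \<omega> * (?f \<omega> - ?f (flip a \<omega>)) \<le> 2 * ((2 * real r + 1) * (\<eta> * (?h \<omega> + ?h (flip a \<omega>))))" .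
  qed
  also have "\<dots> = 2 * ((2 * real r + 1) * (\<eta> * ((\<Sum>\<omega>\<in>\<Omega>. ?h \<omega>) + (\<Sum>\<omega>\<in>\<Omega>. ?h (flip a \<omega>)))))"
    by (simp only: sum.distrib[symmetric] sum_distrib_left)
  also have "\<dots> = 2 * (2 * (2 * real r + 1) * \<eta> * (\<Sum>\<omega>\<in>\<Omega>. ?h \<omega>))"
    using sum_flip[OF a, of ?h] by (simp add: algebra_simps)
  finally show ?thesis by simp
qed

lemma tr_pow_step:
  "(\<Sum>\<omega>\<in>\<Omega>. tr_pow \<omega> (2 * Suc r)) \<le> 2 * (2 * real r + 1) * \<eta> * (\<Sum>\<omega>\<in>\<Omega>. tr_pow \<omega> (2 * r))"
proof -
  have "(\<Sum>\<omega>\<in>\<Omega>. tr_pow \<omega> (2 * Suc r)) = (\<Sum>\<omega>\<in>\<Omega>. tr_pow \<omega> (Suc (2 * r + 1)))" by simp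
  also have "\<dots> = (\<Sum>a\<in>I. \<Sum>\<omega>\<in>\<Omega>. sg a \<omega> * dot n (v a) ((X \<omega> ^^ (2 * r + 1)) (v a)))"
    unfolding tr_pow_Suc by (rule sum.swap)
  also have "\<dots> \<le> (\<Sum>a\<in>I. 2 * (2 * real r + 1) * \<eta> * (\<Sum>\<omega>\<in>\<Omega>. dot n (v a) ((X \<omega> ^^ (2 * r)) (v a))))"
    by (intro sum_mono signed_moment_le)
  also have "\<dots> = 2 * (2 * real r + 1) * \<eta> * (\<Sum>\<omega>\<in>\<Omega>. \<Sum>a\<in>I. dot n (v a) ((X \<omega> ^^ (2 * r)) (v a)))"
    by (simp only: sum_distrib_left[symmetric] sum.swap[of _ \<Omega> I])
  also have "\<dots> \<le> 2 * (2 * real r + 1) * \<eta> * (\<Sum>\<omega>\<in>\<Omega>. tr_pow \<omega> (2 * r))"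
    using \<eta>_nonneg by (intro mult_left_mono sum_mono frame_le_tr_pow) auto
  finally show ?thesis .
qed

lemma tr_pow_nonneg: "0 \<le> tr_pow \<omega> (2 * r)"
  unfolding tr_pow_even by (intro sum_nonneg dot_self_nonneg)

text \<open>Fixing \<open>k\<close> makes the factor of the recursion uniform: 2(2r + 1) \<le> 4k as
  long as r + 1 \<le> k. The start is the trace of the identity, \<open>n\<close> for each
  sample.\<close>

lemma tr_pow_moment:
  assumes "r \<le> k"
  shows "(\<Sum>\<omega>\<in>\<Omega>. tr_pow \<omega> (2 * r)) \<le> (4 * real k * \<eta>) ^ r * real (n * card \<Omega>)"
  using assms
proof (induction r)
  case 0
  show ?case by (simp add: tr_pow_def dot_unit_left unit_fun_self)
next
  case (Suc r)
  have "(\<Sum>\<omega>\<in>\<Omega>. tr_pow \<omega> (2 * Suc r)) \<le> 2 * (2 * real r + 1) * \<eta> * (\<Sum>\<omega>\<in>\<Omega>. tr_pow \<omega> (2 * r))"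
    by (rule tr_pow_step)
  also have "\<dots> \<le> (4 * real k * \<eta>) * ((4 * real k * \<eta>) ^ r * real (n * card \<Omega>))"
  proof (rule mult_mono)
    have "2 * (2 * real r + 1) \<le> 4 * real k" using of_nat_mono[OF Suc.prems, where 'a = real] by simp
    then show "2 * (2 * real r + 1) * \<eta> \<le> 4 * real k * \<eta>"
      using \<eta>_nonneg by (intro mult_right_mono) auto
  qed (use Suc \<eta>_nonneg in \<open>auto intro: sum_nonneg tr_pow_nonneg\<close>)
  finally show ?case by simp
qed

text \<open>The trace dominates the top moment at every \<open>x\<close>, and interpolating the
  moments from exponent 2k down to exponent 1 returns to the form itself.\<close>

lemma quadratic_form_le:
  assumes "\<beta> > 0" "tr_pow \<omega> (2 * k) \<le> \<beta> ^ (2 * k)" "k \<ge> 1"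
  shows "\<bar>dot n x (X \<omega> x)\<bar> \<le> \<beta> * dot n x x"
proof -
  have "dot n x ((X \<omega> ^^ (2 * k)) x) = (\<Sum>i<n. (dot n x ((X \<omega> ^^ k) (unit_fun i)))\<^sup>2)"
    by (simp add: dot_even_power norm_power_eq)
  also have "\<dots> \<le> (\<Sum>i<n. dot n x x * dot n ((X \<omega> ^^ k) (unit_fun i)) ((X \<omega> ^^ k) (unit_fun i)))"
    by (intro sum_mono dot_Cauchy_Schwarz)
  also have "\<dots> = dot n x x * tr_pow \<omega> (2 * k)" by (simp add: tr_pow_even sum_distrib_left)
  also have "\<dots> \<le> dot n x x * \<beta> ^ (2 * k)"
    using assms by (intro mult_left_mono dot_self_nonneg)
  finally have "\<bar>dot n x ((X \<omega> ^^ 1) x)\<bar> \<le> dot n x x * \<beta> ^ 1"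
    using assms by (intro moment_bound[OF selfadjoint_X]) auto
  then show ?thesis by (simp add: mult.commute)
qed

text \<open>Markov's inequality for the moment of order 2k: the hypothesis says 4k\<eta> \<le>
  \<beta>^2 / 2, which leaves a bad fraction of at most n / 2^k. Clearing denominators gives a
  statement in \<open>nat\<close> that can be summed over fibres.\<close>

lemma deviation_count:
  assumes "\<beta> > 0" "k \<ge> 1" "8 * k * \<eta> \<le> \<beta>\<^sup>2"
  shows "card {\<omega>\<in>\<Omega>. \<not> (\<forall>x. \<bar>\<Sum>a\<in>I. sg a \<omega> * (dot n (v a) x)\<^sup>2\<bar> \<le> \<beta> * dot n x x)} * 2 ^ k
    \<le> n * card \<Omega>"
proof -
  let ?B = "{\<omega>\<in>\<Omega>. \<not> (\<forall>x. \<bar>\<Sum>a\<in>I. sg a \<omega> * (dot n (v a) x)\<^sup>2\<bar> \<le> \<beta> * dot n x x)}"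
  have "\<beta> ^ (2 * k) \<le> tr_pow \<omega> (2 * k)" if "\<omega> \<in> ?B" for \<omega>
  proof (rule ccontr)
    assume "\<not> \<beta> ^ (2 * k) \<le> tr_pow \<omega> (2 * k)"
    then have "\<forall>x. \<bar>dot n x (X \<omega> x)\<bar> \<le> \<beta> * dot n x x"
      using quadratic_form_le[of \<beta> \<omega> k] assms by auto
    with that show False by (simp add: dot_X power2_eq_square ac_simps)
  qed
  then have "card ?B * \<beta> ^ (2 * k) \<le> (\<Sum>\<omega>\<in>?B. tr_pow \<omega> (2 * k))"
    using sum_bounded_below[of ?B "\<beta> ^ (2 * k)" "\<lambda>\<omega>. tr_pow \<omega> (2 * k)"] by simp
  also have "\<dots> \<le> (\<Sum>\<omega>\<in>\<Omega>. tr_pow \<omega> (2 * k))"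
    using finite_\<Omega> by (intro sum_mono2 tr_pow_nonneg) auto
  also have "\<dots> \<le> (4 * real k * \<eta>) ^ k * real (n * card \<Omega>)" by (rule tr_pow_moment) simp
  also have "\<dots> \<le> (\<beta>\<^sup>2 / 2) ^ k * real (n * card \<Omega>)"
    using assms \<eta>_nonneg by (intro mult_right_mono power_mono) auto
  also have "\<dots> = \<beta> ^ (2 * k) * (n * card \<Omega> / 2 ^ k)" by (simp add: power_divide power_mult)
  finally have "\<beta> ^ (2 * k) * card ?B \<le> \<beta> ^ (2 * k) * (n * card \<Omega> / 2 ^ k)"
    by (simp only: mult.commute)
  then have "real (card ?B) \<le> n * card \<Omega> / 2 ^ k"
    using assms(1) by (simp only: mult_le_cancel_left_pos zero_less_power)
  then have "real (card ?B * 2 ^ k) \<le> real (n * card \<Omega>)" by (simp add: field_simps)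
  then show ?thesis by (simp only: of_nat_le_iff)
qed

end

section \<open>Whitening and determinants\<close>

definition bil :: "nat \<Rightarrow> (nat \<Rightarrow> nat \<Rightarrow> real) \<Rightarrow> (nat \<Rightarrow> real) \<Rightarrow> (nat \<Rightarrow> real) \<Rightarrow> real" where
  "bil n M x y = (\<Sum>i<n. \<Sum>j<n. x i * M i j * y j)"

definition pos_def :: "nat \<Rightarrow> (nat \<Rightarrow> nat \<Rightarrow> real) \<Rightarrow> bool" where
  "pos_def n M \<longleftrightarrow> (\<forall>i<n. \<forall>j<n. M i j = M j i) \<and> (\<forall>x. (\<exists>i<n. x i \<noteq> 0) \<longrightarrow> 0 < bil n M x x)"

lemma bil_commute: "pos_def n M \<Longrightarrow> bil n M x y = bil n M y x"
  unfolding bil_def pos_def_def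
  by (subst sum.swap) (intro sum.cong; simp add: ac_simps)

lemma bil_sum_left: "bil n M (\<lambda>i. \<Sum>a\<in>I. c a * v a i) y = (\<Sum>a\<in>I. c a * bil n M (v a) y)"
proof -
  have "bil n M x y = dot n x (\<lambda>i. \<Sum>j<n. M i j * y j)" for x
    by (simp add: bil_def dot_def sum_distrib_left ac_simps)
  then show ?thesis by (simp add: dot_sum_left)
qed

lemma bil_diff_left: "bil n M (\<lambda>i. x i - z i) y = bil n M x y - bil n M z y"
  by (simp add: bil_def sum_subtractf[symmetric] algebra_simps)

lemma bil_scale_left: "bil n M (\<lambda>i. c * x i) y = c * bil n M x y"
  by (simp add: bil_def sum_distrib_left ac_simps)

text \<open>The triangular support is carried along because it keeps the next vector nonzero:
  subtracting a combination of the earlier vectors from \<open>unit_fun k\<close> leaves coordinate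
  \<open>k\<close> equal to 1, so the result can be normalised.\<close>

lemma gram_schmidt:
  assumes M: "pos_def n M" and "k \<le> n"
  shows "\<exists>e :: nat \<Rightarrow> nat \<Rightarrow> real.
    (\<forall>a<k. \<forall>b<k. bil n M (e a) (e b) = (if a = b then 1 else 0)) \<and> (\<forall>a<k. \<forall>i\<ge>k. e a i = 0)"
  using assms(2)
proof (induction k)
  case (Suc k)
  then obtain e :: "nat \<Rightarrow> nat \<Rightarrow> real" where
    e: "\<forall>a<k. \<forall>b<k. bil n M (e a) (e b) = (if a = b then 1 else 0)" "\<forall>a<k. \<forall>i\<ge>k. e a i = 0"
    using Suc_leD by blast
  have on: "bil n M (e a) (e b) = (if a = b then 1 else 0)" if "a < k" "b < k" for a b
    using e that by blast
  have sup: "e a i = 0" if "a < k" "i \<ge> k" for a i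
    using e that by blast
  define p where "p = (\<lambda>i. \<Sum>a<k. bil n M (unit_fun k) (e a) * e a i)"
  define u where "u = (\<lambda>i. unit_fun k i - p i)"
  define N where "N = sqrt (bil n M u u)"
  have pz: "p i = 0" if "i \<ge> k" for i using sup that by (simp add: p_def)
  have "u k = 1" using pz by (simp add: u_def unit_fun_def)
  then have "\<exists>i<n. u i \<noteq> 0" using Suc.prems by (intro exI[of _ k]) auto
  then have "bil n M u u > 0" using M by (simp add: pos_def_def)
  then have N: "N > 0" "N * N = bil n M u u" by (auto simp: N_def)
  have uo: "bil n M u (e b) = 0" if "b < k" for b
  proof -
    have "bil n M p (e b) = (\<Sum>a<k. bil n M (unit_fun k) (e a) * (if a = b then 1 else 0))"
      unfolding p_def bil_sum_left using on that by (intro sum.cong) auto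
    also have "\<dots> = bil n M (unit_fun k) (e b)" using that by (simp add: if_distrib cong: if_cong)
    finally show ?thesis unfolding u_def bil_diff_left by simp
  qed
  define w where "w = (\<lambda>i. (1 / N) * u i)"
  have ww: "bil n M w w = 1"
  proof -
    have "bil n M w w = (1 / N) * bil n M u w" unfolding w_def by (rule bil_scale_left)
    also have "bil n M u w = (1 / N) * bil n M u u"
      unfolding bil_commute[OF M, of u w] unfolding w_def by (rule bil_scale_left)
    finally show ?thesis using N \<open>bil n M u u > 0\<close> by (simp add: field_simps)
  qed
  have wo: "bil n M w (e b) = 0" if "b < k" for b
    unfolding w_def bil_scale_left using uo[OF that] by simp
  show ?case
  proof (intro exI[of _ "e(k := w)"] conjI allI impI)
    fix a b assume "a < Suc k" "b < Suc k"
    then show "bil n M ((e(k := w)) a) ((e(k := w)) b) = (if a = b then 1 else 0)"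
      using on ww wo bil_commute[OF M] by (auto simp: less_Suc_eq)
  next
    fix a i assume "a < Suc k" "Suc k \<le> i"
    then show "(e(k := w)) a i = 0" using sup pz by (auto simp: less_Suc_eq w_def u_def unit_fun_def)
  qed
qed simp

section \<open>Change of basis and determinants\<close>

definition fmat :: "nat \<Rightarrow> (nat \<Rightarrow> nat \<Rightarrow> real) \<Rightarrow> real mat" where
  "fmat n M = mat n n (\<lambda>(i, j). M i j)"

lemma fmat_carrier [simp]: "fmat n M \<in> carrier_mat n n"
  by (simp add: fmat_def)

lemma fmat_sandwich:
  "(fmat n (\<lambda>a i. e a i) * fmat n M) * fmat n (\<lambda>i b. e b i) = fmat n (\<lambda>a b. bil n M (e a) (e b))"
proof (rule eq_matI)
  fix a b assume "a < dim_row (fmat n (\<lambda>a b. bil n M (e a) (e b)))"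
    and "b < dim_col (fmat n (\<lambda>a b. bil n M (e a) (e b)))"
  then have ab: "a < n" "b < n" by (auto simp: fmat_def)
  then have "((fmat n (\<lambda>a i. e a i) * fmat n M) * fmat n (\<lambda>i b. e b i)) $$ (a, b)
    = (\<Sum>j<n. (\<Sum>i<n. e a i * M i j) * e b j)"
    by (simp add: fmat_def scalar_prod_def lessThan_atLeast0)
  also have "\<dots> = (\<Sum>i<n. \<Sum>j<n. e a i * M i j * e b j)"
    by (subst sum.swap) (simp add: sum_distrib_right)
  finally show "((fmat n (\<lambda>a i. e a i) * fmat n M) * fmat n (\<lambda>i b. e b i)) $$ (a, b)
    = fmat n (\<lambda>a b. bil n M (e a) (e b)) $$ (a, b)"
    using ab by (simp add: fmat_def bil_def)
qed (auto simp: fmat_def)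

text \<open>For the matrix E with the Gram-Schmidt vectors as columns, E^T M E is the identity. So E
  has a one-sided, hence a two-sided inverse, and its columns span. The determinant identity serves
  to compare det M before and after an update without computing det E.\<close>

lemma whitening_basis:
  assumes M: "pos_def n M"
  obtains e :: "nat \<Rightarrow> nat \<Rightarrow> real" where
    "\<forall>a<n. \<forall>b<n. bil n M (e a) (e b) = (if a = b then 1 else 0)"
    "\<forall>x. \<exists>z. \<forall>i<n. x i = (\<Sum>a<n. z a * e a i)"
    "det (fmat n (\<lambda>a i. e a i)) * det (fmat n M) * det (fmat n (\<lambda>i a. e a i)) = 1"
proof -
  obtain e :: "nat \<Rightarrow> nat \<Rightarrow> real" where
    on: "\<And>a b. a < n \<Longrightarrow> b < n \<Longrightarrow> bil n M (e a) (e b) = (if a = b then 1 else 0)"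
    using gram_schmidt[OF M, of n] by auto
  let ?E = "fmat n (\<lambda>i a. e a i)" and ?F = "fmat n (\<lambda>a i. e a i) * fmat n M"
  have F: "?F \<in> carrier_mat n n" by (rule mult_carrier_mat[OF fmat_carrier fmat_carrier])
  have "?F * ?E = 1\<^sub>m n"
    unfolding fmat_sandwich using on by (intro eq_matI) (auto simp: fmat_def)
  from mat_mult_left_right_inverse[OF F _ this] have inv: "?E * ?F = 1\<^sub>m n" by simp
  have "\<exists>z. \<forall>i<n. x i = (\<Sum>a<n. z a * e a i)" for x :: "nat \<Rightarrow> real"
  proof -
    let ?x = "vec n x" and ?z = "?F *\<^sub>v vec n x"
    have "?E *\<^sub>v ?z = (?E * ?F) *\<^sub>v ?x"
      by (rule assoc_mult_mat_vec[symmetric, OF fmat_carrier F]) simp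
    then have Ez: "?E *\<^sub>v ?z = ?x" unfolding inv by simp
    have dz: "dim_vec ?z = n" using F by (simp add: fmat_def)
    have "x i = (\<Sum>a<n. ?z $ a * e a i)" if "i < n" for i
    proof -
      have "x i = (?E *\<^sub>v ?z) $ i" unfolding Ez using that by simp
      also have "\<dots> = row ?E i \<bullet> ?z" using that by (simp add: fmat_def)
      also have "\<dots> = (\<Sum>a<n. ?z $ a * e a i)"
        using that dz unfolding scalar_prod_def by (intro sum.cong) (auto simp: fmat_def)
      finally show ?thesis .
    qed
    then show ?thesis by blast
  qed
  moreover have "det (fmat n (\<lambda>a i. e a i)) * det (fmat n M) * det ?E = 1"
  proof -
    have "det (?F * ?E) = 1" using \<open>?F * ?E = 1\<^sub>m n\<close> by simp
    then show ?thesis using det_mult[OF F, of ?E] det_mult[of "fmat n (\<lambda>a i. e a i)" n "fmat n M"] by simp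
  qed
  ultimately show ?thesis using that on by blast
qed

text \<open>Two factorisations of the bordered matrix with blocks I, y, -y^T, 1, each eliminating
  one off-diagonal block, exhibit the two sides as its two Schur complements.\<close>

lemma det_one_plus_rank_one: "det (fmat n (\<lambda>i j. (if i = j then 1 else 0) + y i * y j)) = 1 + dot n y y"
proof -
  let ?I = "1\<^sub>m n :: real mat" and ?P = "fmat n (\<lambda>i j. (if i = j then 1 else 0) + y i * y j)"
  let ?c = "mat n 1 (\<lambda>(i, j). y i)" and ?r = "mat 1 n (\<lambda>(i, j). - y j)"
  let ?s = "mat 1 1 (\<lambda>_. 1 + dot n y y) :: real mat" and ?o = "1\<^sub>m 1 :: real mat"
  let ?Z = "0\<^sub>m 1 n :: real mat" and ?Z' = "0\<^sub>m n 1 :: real mat"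
  have rc: "?r * ?c + ?s = ?o"
    by (intro eq_matI) (auto simp: scalar_prod_def dot_def sum_negf lessThan_atLeast0)
  have cr: "?P + ?c * ?r = ?I"
    by (intro eq_matI) (auto simp: scalar_prod_def fmat_def)
  have c1: "?c * ?o = ?c" by (rule right_mult_one_mat[of _ n]) simp
  have "four_block_mat ?P ?c ?Z ?o * four_block_mat ?I ?Z' ?r ?o
    = four_block_mat (?P * ?I + ?c * ?r) (?P * ?Z' + ?c * ?o) (?Z * ?I + ?o * ?r) (?Z * ?Z' + ?o * ?o)"
    by (rule mult_four_block_mat[where ?nr1.0 = n and ?n1.0 = n and ?n2.0 = 1 and ?nr2.0 = 1 and ?nc1.0 = n and ?nc2.0 = 1]) auto
  also have "\<dots> = four_block_mat ?I ?c ?r ?o"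
    using cr c1 right_mult_one_mat[of ?P n n] right_mult_zero_mat[of ?P n n 1] by simp
  finally have 1: "four_block_mat ?P ?c ?Z ?o * four_block_mat ?I ?Z' ?r ?o = four_block_mat ?I ?c ?r ?o" .
  have "four_block_mat ?I ?Z' ?r ?o * four_block_mat ?I ?c ?Z ?s
    = four_block_mat (?I * ?I + ?Z' * ?Z) (?I * ?c + ?Z' * ?s) (?r * ?I + ?o * ?Z) (?r * ?c + ?o * ?s)"
    by (rule mult_four_block_mat[where ?nr1.0 = n and ?n1.0 = n and ?n2.0 = 1 and ?nr2.0 = 1 and ?nc1.0 = n and ?nc2.0 = 1]) auto
  also have "\<dots> = four_block_mat ?I ?c ?r ?o"
    using rc right_mult_one_mat[of ?r 1 n] by simp
  finally have 2: "four_block_mat ?I ?Z' ?r ?o * four_block_mat ?I ?c ?Z ?s = four_block_mat ?I ?c ?r ?o" .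
  have cP: "four_block_mat ?P ?c ?Z ?o \<in> carrier_mat (n + 1) (n + 1)"
    and cI: "four_block_mat ?I ?Z' ?r ?o \<in> carrier_mat (n + 1) (n + 1)"
    and cS: "four_block_mat ?I ?c ?Z ?s \<in> carrier_mat (n + 1) (n + 1)"
    by (intro four_block_carrier_mat; simp)+
  have dP: "det (four_block_mat ?P ?c ?Z ?o) = det ?P * det ?o"
    by (rule det_four_block_mat_lower_left_zero) auto
  have dI: "det (four_block_mat ?I ?Z' ?r ?o) = det ?I * det ?o"
    by (rule det_four_block_mat_upper_right_zero) auto
  have dS: "det (four_block_mat ?I ?c ?Z ?s) = det ?I * det ?s"
    by (rule det_four_block_mat_lower_left_zero) auto
  have ds: "det ?s = 1 + dot n y y" by (subst det_single) auto
  have "det (four_block_mat ?P ?c ?Z ?o) * det (four_block_mat ?I ?Z' ?r ?o)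
      = det (four_block_mat ?I ?Z' ?r ?o) * det (four_block_mat ?I ?c ?Z ?s)"
    unfolding det_mult[OF cP cI, symmetric] det_mult[OF cI cS, symmetric] 1 2 ..
  then show ?thesis unfolding dP dI dS ds by simp
qed

lemma dot_combination:
  "dot n b (\<lambda>i. \<Sum>a<n. z a * e a i) = dot n (\<lambda>a. dot n b (e a)) z"
  unfolding dot_sum_right by (simp add: dot_def[of n _ z] mult.commute)

lemma bil_combination:
  assumes M: "pos_def n M"
    and on: "\<And>a b. a < n \<Longrightarrow> b < n \<Longrightarrow> bil n M (e a) (e b) = (if a = b then 1 else 0)"
  shows "bil n M (\<lambda>i. \<Sum>a<n. z a * e a i) (\<lambda>i. \<Sum>a<n. z a * e a i) = dot n z z"
proof -
  let ?x = "\<lambda>i. \<Sum>a<n. z a * e a i"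
  have "bil n M ?x ?x = (\<Sum>a<n. z a * (\<Sum>b<n. z b * bil n M (e b) (e a)))"
    unfolding bil_sum_left by (subst bil_commute[OF M]) (simp add: bil_sum_left)
  also have "\<dots> = (\<Sum>a<n. z a * (\<Sum>b<n. if b = a then z b else 0))"
    using on by (intro sum.cong arg_cong[of _ _ "(*) _"]) auto
  finally show ?thesis by (simp add: dot_def)
qed

text \<open>In a basis where \<open>M\<close> is the identity, \<open>b\<close> becomes
  \<open>y\<close> and the determinant grows by the factor 1 + |y|^2; the direction \<open>x\<close>
  certifies |y|^2 > \<eta> by Cauchy-Schwarz.\<close>

lemma det_rank_one_update:
  assumes M: "pos_def n M" and heavy: "(dot n b x)\<^sup>2 > \<eta> * bil n M x x" and "\<eta> > 0"
    and d: "det (fmat n M) > 0"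
  shows "det (fmat n (\<lambda>i j. M i j + b i * b j)) \<ge> (1 + \<eta>) * det (fmat n M)"
proof -
  obtain e :: "nat \<Rightarrow> nat \<Rightarrow> real" where
    e: "\<forall>a<n. \<forall>b<n. bil n M (e a) (e b) = (if a = b then 1 else 0)"
    and sp: "\<forall>x. \<exists>z. \<forall>i<n. x i = (\<Sum>a<n. z a * e a i)"
    and de: "det (fmat n (\<lambda>a i. e a i)) * det (fmat n M) * det (fmat n (\<lambda>i a. e a i)) = 1"
    by (rule whitening_basis[OF M])
  have on: "bil n M (e a) (e b) = (if a = b then 1 else 0)" if "a < n" "b < n" for a b
    using e that by blast
  let ?M' = "\<lambda>i j. M i j + b i * b j"
  define y where "y a = dot n b (e a)" for a
  have bil': "bil n ?M' x z = bil n M x z + dot n b x * dot n b z" for x z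
    by (simp add: bil_def dot_def sum_product sum.distrib[symmetric] algebra_simps)
  obtain z where z: "\<forall>i<n. x i = (\<Sum>a<n. z a * e a i)" using sp by blast
  let ?x = "\<lambda>i. \<Sum>a<n. z a * e a i"
  have cg: "dot n b x = dot n b ?x" "bil n M x x = bil n M ?x ?x"
    using z by (auto simp: dot_def bil_def)
  have dbx: "dot n b x = dot n y z"
    unfolding cg dot_combination y_def ..
  have bxx: "bil n M x x = dot n z z"
    unfolding cg by (rule bil_combination[OF M on])
  have "\<eta> * dot n z z < dot n y y * dot n z z"
    using heavy dot_Cauchy_Schwarz[of n y z] unfolding dbx bxx by linarith
  then have yy: "dot n y y > \<eta>" using dot_self_nonneg[of n z] by (simp add: mult_less_cancel_right)
  have "det (fmat n (\<lambda>a i. e a i)) * det (fmat n ?M') * det (fmat n (\<lambda>i a. e a i))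
      = det (fmat n (\<lambda>a b. bil n ?M' (e a) (e b)))"
    unfolding fmat_sandwich[symmetric]
      det_mult[OF mult_carrier_mat[OF fmat_carrier fmat_carrier] fmat_carrier]
      det_mult[OF fmat_carrier fmat_carrier] ..
  also have "fmat n (\<lambda>a b. bil n ?M' (e a) (e b)) = fmat n (\<lambda>i j. (if i = j then 1 else 0) + y i * y j)"
    using on by (intro eq_matI) (auto simp: fmat_def bil' y_def)
  also have "det \<dots> = 1 + dot n y y" by (rule det_one_plus_rank_one)
  finally have d': "det (fmat n (\<lambda>a i. e a i)) * det (fmat n ?M') * det (fmat n (\<lambda>i a. e a i)) = 1 + dot n y y" .
  \<comment> \<open>\<open>c\<close> is the square of the determinant of the basis. Both
    determinants carry this factor, and its sign follows from \<open>d\<close>.\<close>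
  define c where "c = det (fmat n (\<lambda>a i. e a i)) * det (fmat n (\<lambda>i a. e a i))"
  have c1: "c * det (fmat n M) = 1" "c * det (fmat n ?M') = 1 + dot n y y"
    using de d' by (auto simp: c_def ac_simps)
  then have "c > 0" using d zero_less_mult_pos2[of c "det (fmat n M)"] by simp
  have "c * det (fmat n ?M') \<ge> c * ((1 + \<eta>) * det (fmat n M))"
    using c1 yy by (simp add: algebra_simps)
  then show ?thesis using \<open>c > 0\<close> by simp
qed

text \<open>Leibniz expansion, term by term. Hadamard's inequality would be sharper, but only the
  logarithm of the bound counts, to which the factorial adds at most n log n.\<close>

lemma det_le_fact_power:
  assumes "\<And>i j. i < n \<Longrightarrow> j < n \<Longrightarrow> \<bar>M i j\<bar> \<le> B"
  shows "det (fmat n M) \<le> fact n * B ^ n"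
proof -
  have "det (fmat n M) = (\<Sum>p\<in>{p. p permutes {0..<n}}. signof p * (\<Prod>i = 0..<n. fmat n M $$ (i, p i)))"
    by (rule det_def') simp
  also have "\<dots> \<le> (\<Sum>p\<in>{p. p permutes {0..<n}}. B ^ n)"
  proof (rule sum_mono)
    fix p assume "p \<in> {p. p permutes {0..<n}}"
    then have p: "p i < n" if "i < n" for i using that permutes_in_image[of p "{0..<n}" i] by auto
    have "signof p * (\<Prod>i = 0..<n. fmat n M $$ (i, p i)) \<le> \<bar>signof p * (\<Prod>i = 0..<n. fmat n M $$ (i, p i))\<bar>"
      by simp
    also have "\<dots> = (\<Prod>i = 0..<n. \<bar>fmat n M $$ (i, p i)\<bar>)"
      by (simp add: abs_mult sign_def abs_prod)
    also have "\<dots> \<le> (\<Prod>i = 0..<n. B)"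
      using p assms by (intro prod_mono) (auto simp: fmat_def)
    finally show "signof p * (\<Prod>i = 0..<n. fmat n M $$ (i, p i)) \<le> B ^ n" by simp
  qed
  also have "\<dots> = fact n * B ^ n" by (simp add: card_permutations)
  finally show ?thesis .
qed

section \<open>Quadratic forms of weighted graphs\<close>

text \<open>Whitening turns \<open>M\<close> into the dot product and each \<open>b a\<close> into a
  vector \<open>v a\<close>, for which the deviation count is known. As the basis spans, the
  deviation event is the same set of samples in both coordinate systems.\<close>

lemma deviation_count_form:
  fixes b :: "'a \<Rightarrow> nat \<Rightarrow> real" and sg :: "'a \<Rightarrow> 'w \<Rightarrow> real"
  assumes M: "pos_def n M" and fin: "finite \<Omega>" "finite I"
    and flip_in: "\<And>a \<omega>. a \<in> I \<Longrightarrow> \<omega> \<in> \<Omega> \<Longrightarrow> flip a \<omega> \<in> \<Omega>"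
    and flip_flip: "\<And>a \<omega>. a \<in> I \<Longrightarrow> \<omega> \<in> \<Omega> \<Longrightarrow> flip a (flip a \<omega>) = \<omega>"
    and sg_abs: "\<And>a \<omega>. sg a \<omega> * sg a \<omega> = 1"
    and sg_flip: "\<And>a \<omega>. a \<in> I \<Longrightarrow> \<omega> \<in> \<Omega> \<Longrightarrow> sg a (flip a \<omega>) = - sg a \<omega>"
    and sg_flip_other: "\<And>a b \<omega>. a \<in> I \<Longrightarrow> b \<in> I \<Longrightarrow> a \<noteq> b \<Longrightarrow> \<omega> \<in> \<Omega> \<Longrightarrow> sg b (flip a \<omega>) = sg b \<omega>"
    and light: "\<And>a x. a \<in> I \<Longrightarrow> (dot n (b a) x)\<^sup>2 \<le> \<eta> * bil n M x x"
    and frame: "\<And>x. (\<Sum>a\<in>I. (dot n (b a) x)\<^sup>2) \<le> bil n M x x"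
    and \<eta>: "0 \<le> \<eta>" and \<beta>: "\<beta> > 0" and k: "k \<ge> 1" and \<eta>\<beta>: "8 * real k * \<eta> \<le> \<beta>\<^sup>2"
  shows "card {\<omega>\<in>\<Omega>. \<not> (\<forall>x. \<bar>\<Sum>a\<in>I. sg a \<omega> * (dot n (b a) x)\<^sup>2\<bar> \<le> \<beta> * bil n M x x)} * 2 ^ k
    \<le> n * card \<Omega>"
proof -
  obtain e :: "nat \<Rightarrow> nat \<Rightarrow> real" where
    e: "\<forall>a<n. \<forall>b<n. bil n M (e a) (e b) = (if a = b then 1 else 0)"
    and sp: "\<forall>x. \<exists>z. \<forall>i<n. x i = (\<Sum>a<n. z a * e a i)"
    and "det (fmat n (\<lambda>a i. e a i)) * det (fmat n M) * det (fmat n (\<lambda>i a. e a i)) = 1"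
    by (rule whitening_basis[OF M])
  have on: "bil n M (e a) (e b) = (if a = b then 1 else 0)" if "a < n" "b < n" for a b
    using e that by blast
  define v where "v a = (\<lambda>i. dot n (b a) (e i))" for a
  let ?x = "\<lambda>z i. \<Sum>a<n. z a * e a i"
  have dx: "dot n (b a) (?x z) = dot n (v a) z" for a z
    unfolding dot_combination v_def ..
  have bx: "bil n M (?x z) (?x z) = dot n z z" for z
    by (rule bil_combination[OF M on])
  interpret sign_flips n \<Omega> I sg flip v \<eta>
  proof unfold_locales
    fix a assume a: "a \<in> I"
    \<comment> \<open>Testing lightness at the vector whose coordinates are \<open>v a\<close>
      itself gives |v|^4 \<le> \<eta> |v|^2, hence the bound on the squared length.\<close>
    have "(dot n (v a) (v a))\<^sup>2 \<le> \<eta> * dot n (v a) (v a)"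
      using light[OF a, of "?x (v a)"] unfolding dx bx .
    then show "dot n (v a) (v a) \<le> \<eta>"
      using dot_self_nonneg[of n "v a"] \<eta>
      by (cases "dot n (v a) (v a) = 0") (auto simp: power2_eq_square mult_le_cancel_right)
  next
    fix x show "(\<Sum>a\<in>I. (dot n (v a) x)\<^sup>2) \<le> dot n x x"
      using frame[of "?x x"] unfolding dx bx .
  qed (use assms in auto)
  have "(\<forall>x. \<bar>\<Sum>a\<in>I. sg a \<omega> * (dot n (b a) x)\<^sup>2\<bar> \<le> \<beta> * bil n M x x)
    \<longleftrightarrow> (\<forall>z. \<bar>\<Sum>a\<in>I. sg a \<omega> * (dot n (v a) z)\<^sup>2\<bar> \<le> \<beta> * dot n z z)" (is "?L \<longleftrightarrow> ?R") for \<omega>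
  proof
    assume L: ?L
    show ?R
    proof
      fix z show "\<bar>\<Sum>a\<in>I. sg a \<omega> * (dot n (v a) z)\<^sup>2\<bar> \<le> \<beta> * dot n z z"
        using L[rule_format, of "?x z"] unfolding dx bx .
    qed
  next
    assume R: ?R
    show ?L
    proof
      fix x
      obtain z where z: "\<forall>i<n. x i = ?x z i" using sp by blast
      have "dot n (b a) x = dot n (b a) (?x z)" for a using z by (simp add: dot_def)
      moreover have "bil n M x x = bil n M (?x z) (?x z)" using z by (simp add: bil_def)
      ultimately show "\<bar>\<Sum>a\<in>I. sg a \<omega> * (dot n (b a) x)\<^sup>2\<bar> \<le> \<beta> * bil n M x x"
        using R[rule_format, of z] unfolding dx bx by simp
    qed
  qed
  then show ?thesis using deviation_count[OF \<beta> k \<eta>\<beta>] by simp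
qed

section \<open>Incidence vectors, quadratic forms and Laplacians of graphs\<close>

definition all_edges :: "nat \<Rightarrow> nat set set" where
  "all_edges n = {e. e \<subseteq> {..<n} \<and> card e = 2}"

definition inc :: "nat set \<Rightarrow> nat \<Rightarrow> real" where
  "inc e i = (if i = Min e then 1 else if i = Max e then - 1 else 0)"

text \<open>Weight functions on the fixed index set \<open>all_edges n\<close>, with 0 for a missing
  edge, stand for graphs; thus input, board and sampled graph can be compared edge by edge.\<close>

definition form :: "nat \<Rightarrow> (nat set \<Rightarrow> real) \<Rightarrow> (nat \<Rightarrow> real) \<Rightarrow> real" where
  "form n W x = (\<Sum>e\<in>all_edges n. W e * (dot n (inc e) x)\<^sup>2)"

definition gram :: "nat \<Rightarrow> real \<Rightarrow> (nat set \<Rightarrow> real) \<Rightarrow> nat \<Rightarrow> nat \<Rightarrow> real" where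
  "gram n \<delta> W i j = (if i = j then \<delta> else 0) + (\<Sum>e\<in>all_edges n. W e * inc e i * inc e j)"

lemma finite_all_edges [simp]: "finite (all_edges n)"
  by (rule finite_subset[of _ "Pow {..<n}"]) (auto simp: all_edges_def)

lemma all_edges_cases:
  assumes "e \<in> all_edges n"
  obtains u v where "e = {u, v}" "u < v" "v < n" "Min e = u" "Max e = v"
proof -
  from assms obtain u v where e: "e = {u, v}" "u \<noteq> v" and sub: "e \<subseteq> {..<n}"
    by (auto simp: all_edges_def card_2_iff)
  show ?thesis
  proof (cases "u < v")
    case True then show ?thesis using that[of u v] e sub by auto
  next
    case False then show ?thesis using that[of v u] e sub by auto
  qed
qed

lemma dot_inc:
  assumes "e \<in> all_edges n" shows "dot n (inc e) x = x (Min e) - x (Max e)"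
proof -
  obtain u v where e: "e = {u, v}" "u < v" "v < n" "Min e = u" "Max e = v"
    using all_edges_cases[OF assms] .
  have "inc e = (\<lambda>i. unit_fun u i - unit_fun v i)"
    using e by (auto simp: inc_def unit_fun_def)
  then have "dot n (inc e) x = dot n (unit_fun u) x - dot n (unit_fun v) x"
    by (simp add: dot_def algebra_simps sum_subtractf)
  then show ?thesis using e by (simp add: dot_unit_left)
qed

lemma card_all_edges_le: "card (all_edges n) \<le> n\<^sup>2"
proof -
  have "all_edges n \<subseteq> (\<lambda>(u, v). {u, v}) ` ({..<n} \<times> {..<n})"
    by (auto elim!: all_edges_cases intro!: image_eqI)
  then have "card (all_edges n) \<le> card ({..<n} \<times> {..<n})"
    by (rule surj_card_le[rotated]) simp
  then show ?thesis by (simp add: power2_eq_square)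
qed

lemma form_mono: "(\<And>e. e \<in> all_edges n \<Longrightarrow> W e \<le> V e) \<Longrightarrow> form n W x \<le> form n V x"
  unfolding form_def by (intro sum_mono mult_right_mono) auto

lemma form_nonneg: "(\<And>e. e \<in> all_edges n \<Longrightarrow> 0 \<le> W e) \<Longrightarrow> 0 \<le> form n W x"
  unfolding form_def by (intro sum_nonneg mult_nonneg_nonneg) auto

lemma bil_gram: "bil n (gram n \<delta> W) x y
  = \<delta> * dot n x y + (\<Sum>e\<in>all_edges n. W e * dot n (inc e) x * dot n (inc e) y)"
proof -
  have "bil n (gram n \<delta> W) x y = (\<Sum>i<n. \<Sum>j<n. x i * (if i = j then \<delta> else 0) * y j)
     + (\<Sum>i<n. \<Sum>j<n. \<Sum>e\<in>all_edges n. W e * (inc e i * x i) * (inc e j * y j))"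
    unfolding bil_def gram_def sum.distrib[symmetric]
    by (intro sum.cong refl) (simp add: algebra_simps sum_distrib_left)
  also have "(\<Sum>i<n. \<Sum>j<n. x i * (if i = j then \<delta> else 0) * y j) = \<delta> * dot n x y"
    by (simp add: dot_def if_distrib[of "\<lambda>t. _ * t * _"] sum_distrib_left ac_simps cong: if_cong)
       (simp add: if_distrib[of "\<lambda>t. t * _"] if_distrib[of "\<lambda>t. _ * t"] ac_simps cong: if_cong)
  also have "(\<Sum>i<n. \<Sum>j<n. \<Sum>e\<in>all_edges n. W e * (inc e i * x i) * (inc e j * y j))
     = (\<Sum>i<n. \<Sum>e\<in>all_edges n. W e * (inc e i * x i) * dot n (inc e) y)"
    by (intro sum.cong refl, subst sum.swap) (simp add: dot_def sum_distrib_left)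
  also have "\<dots> = (\<Sum>e\<in>all_edges n. W e * dot n (inc e) x * dot n (inc e) y)"
    by (subst sum.swap) (simp add: dot_def[of n _ x] sum_distrib_left sum_distrib_right)
  finally show ?thesis .
qed

lemma bil_gram_self: "bil n (gram n \<delta> W) x x = \<delta> * dot n x x + form n W x"
  unfolding bil_gram form_def by (simp add: power2_eq_square ac_simps)

lemma pos_def_gram:
  assumes "\<delta> > 0" "\<And>e. e \<in> all_edges n \<Longrightarrow> 0 \<le> W e"
  shows "pos_def n (gram n \<delta> W)"
  unfolding pos_def_def
proof (intro conjI allI impI)
  show "gram n \<delta> W i j = gram n \<delta> W j i" for i j
    by (simp add: gram_def ac_simps)
  fix x :: "nat \<Rightarrow> real" assume "\<exists>i<n. x i \<noteq> 0"
  then obtain i where "i < n" "x i \<noteq> 0" by blast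
  then have "0 < dot n x x"
    unfolding dot_def by (intro sum_pos2[of _ i]) (auto simp: zero_less_mult_iff)
  then show "0 < bil n (gram n \<delta> W) x x"
    unfolding bil_gram_self using assms form_nonneg[of n W x] by (simp add: add_pos_nonneg)
qed

lemma gram_update:
  assumes "e \<in> all_edges n" "W e = 0" "c \<ge> 0"
  shows "gram n \<delta> (W(e := c)) i j = gram n \<delta> W i j + (sqrt c * inc e i) * (sqrt c * inc e j)"
proof -
  have "(\<Sum>f\<in>all_edges n. (W(e := c)) f * inc f i * inc f j)
      = (\<Sum>f\<in>all_edges n. W f * inc f i * inc f j + (if f = e then c * inc e i * inc e j else 0))"
    using assms by (intro sum.cong) auto
  also have "\<dots> = (\<Sum>f\<in>all_edges n. W f * inc f i * inc f j) + c * inc e i * inc e j"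
    using assms by (simp add: sum.distrib)
  also have "c * inc e i * inc e j = (sqrt c * sqrt c) * inc e i * inc e j"
    using assms by simp
  finally show ?thesis by (simp add: gram_def ac_simps del: real_sqrt_mult_self)
qed

definition wt :: "wgraph \<Rightarrow> nat set \<Rightarrow> real" where
  "wt G e = (if e \<in> edges G then weight G e else 0)"

lemma laplacian_eq_gram:
  assumes "weighted_graph n G"
  shows "laplacian n G = fmat n (gram n 0 (wt G))"
proof (rule eq_matI)
  have sub: "edges G \<subseteq> all_edges n" using assms by (auto simp: weighted_graph_def all_edges_def)
  fix i j assume "i < dim_row (fmat n (gram n 0 (wt G)))" "j < dim_col (fmat n (gram n 0 (wt G)))"
  then have ij: "i < n" "j < n" by (auto simp: fmat_def)
  have mem: "i \<in> e \<longleftrightarrow> inc e i \<noteq> 0" if "e \<in> all_edges n" for e i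
    using that by (elim all_edges_cases) (auto simp: inc_def)
  have sq: "inc e i * inc e i = (if i \<in> e then 1 else 0)" if "e \<in> all_edges n" for e i
    using that by (elim all_edges_cases) (auto simp: inc_def)
  have "laplacian n G $$ (i, j) = gram n 0 (wt G) i j"
  proof (cases "i = j")
    case True
    \<comment> \<open>On the diagonal \<open>adjacency_mat\<close> looks up \<open>{i, i}\<close>, a
      singleton, which has to be excluded as an edge.\<close>
    have "{i} \<notin> edges G" using sub by (auto simp: all_edges_def)
    then have "laplacian n G $$ (i, j) = (\<Sum>e | e \<in> edges G \<and> i \<in> e. weight G e)"
      using ij True by (simp add: laplacian_def degree_mat_def adjacency_mat_def)
    also have "\<dots> = (\<Sum>e\<in>all_edges n. if e \<in> edges G \<and> i \<in> e then weight G e else 0)"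
      using sub by (subst sum.inter_filter[symmetric]) (auto intro!: sum.cong)
    also have "\<dots> = (\<Sum>e\<in>all_edges n. wt G e * (inc e i * inc e i))"
      by (intro sum.cong) (auto simp: sq wt_def)
    finally show ?thesis using True by (simp add: gram_def ac_simps)
  next
    case False
    have "laplacian n G $$ (i, j) = - wt G {i, j}"
      using ij False by (simp add: laplacian_def degree_mat_def adjacency_mat_def wt_def)
    moreover have "(\<Sum>e\<in>all_edges n. wt G e * inc e i * inc e j)
        = (\<Sum>e\<in>all_edges n. if e = {i, j} then - wt G {i, j} else 0)"
    proof (rule sum.cong[OF refl])
      fix e assume e: "e \<in> all_edges n"
      show "wt G e * inc e i * inc e j = (if e = {i, j} then - wt G {i, j} else 0)"
      proof -
        obtain u v where uv: "e = {u, v}" "u < v" "Min e = u" "Max e = v"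
          using all_edges_cases[OF e] by metis
        show ?thesis
        proof (cases "e = {i, j}")
          case True
          then have "i = u \<and> j = v \<or> i = v \<and> j = u" using uv(1) by (simp add: doubleton_eq_iff) blast
          then have "inc e i * inc e j = - 1" using uv by (auto simp: inc_def)
          then show ?thesis using True by (simp add: mult.assoc)
        next
          case neq: False
          then have "i \<notin> e \<or> j \<notin> e" using uv(1) False by blast
          then show ?thesis using neq mem[OF e, of i] mem[OF e, of j] by auto
        qed
      qed
    qed
    moreover have "{i, j} \<in> all_edges n" using ij False by (auto simp: all_edges_def)
    ultimately show ?thesis using False by (simp add: gram_def)
  qed
  then show "laplacian n G $$ (i, j) = fmat n (gram n 0 (wt G)) $$ (i, j)"
    using ij by (simp add: fmat_def)
qed (auto simp: laplacian_def degree_mat_def adjacency_mat_def fmat_def)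

lemma positive_semidefinite_fmat:
  assumes "\<And>i j. i < n \<Longrightarrow> j < n \<Longrightarrow> M i j = M j i" "\<And>x. 0 \<le> bil n M x x"
  shows "positive_semidefinite n (fmat n M)"
  unfolding positive_semidefinite_def
proof (intro conjI ballI)
  show "(fmat n M)\<^sup>T = fmat n M" using assms(1) by (intro eq_matI) (auto simp: fmat_def)
  fix v :: "real vec" assume v: "v \<in> carrier_vec n"
  have "v \<bullet> (fmat n M *\<^sub>v v) = (\<Sum>i<n. v $ i * (\<Sum>j<n. M i j * v $ j))"
    using v by (simp add: scalar_prod_def fmat_def lessThan_atLeast0)
  also have "\<dots> = bil n M (\<lambda>i. v $ i) (\<lambda>i. v $ i)"
    by (simp add: bil_def sum_distrib_left ac_simps)
  finally show "0 \<le> v \<bullet> (fmat n M *\<^sub>v v)" using assms(2) by simp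
qed simp

lemma spectral_sparsifierI:
  assumes G: "weighted_graph n G" and H: "weighted_graph n H" and "edges H \<subseteq> edges G"
    and lo: "\<And>x. (1 - \<epsilon>) * form n (wt G) x \<le> form n (wt H) x"
    and up: "\<And>x. form n (wt H) x \<le> (1 + \<epsilon>) * form n (wt G) x"
  shows "spectral_sparsifier n \<epsilon> G H"
proof -
  have lin: "bil n (\<lambda>i j. a * gram n 0 (wt G) i j + b * gram n 0 (wt H) i j) x x
      = a * form n (wt G) x + b * form n (wt H) x" for a b x
  proof -
    have "bil n (\<lambda>i j. a * gram n 0 (wt G) i j + b * gram n 0 (wt H) i j) x x
      = a * bil n (gram n 0 (wt G)) x x + b * bil n (gram n 0 (wt H)) x x"
      unfolding bil_def sum_distrib_left sum.distrib[symmetric]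
      by (intro sum.cong refl) (simp add: algebra_simps)
    then show ?thesis by (simp add: bil_gram_self)
  qed
  have sym: "gram n 0 W i j = gram n 0 W j i" for W i j by (simp add: gram_def ac_simps)
  have "loewner_le n ((1 - \<epsilon>) \<cdot>\<^sub>m laplacian n G) (laplacian n H)"
  proof -
    have "laplacian n H - (1 - \<epsilon>) \<cdot>\<^sub>m laplacian n G
      = fmat n (\<lambda>i j. (\<epsilon> - 1) * gram n 0 (wt G) i j + 1 * gram n 0 (wt H) i j)"
      unfolding laplacian_eq_gram[OF G] laplacian_eq_gram[OF H]
      by (intro eq_matI) (auto simp: fmat_def algebra_simps)
    moreover have "0 \<le> (\<epsilon> - 1) * form n (wt G) x + 1 * form n (wt H) x" for x
      using lo[of x] by (simp add: algebra_simps)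
    ultimately show ?thesis
      unfolding loewner_le_def using positive_semidefinite_fmat[of n "\<lambda>i j. (\<epsilon> - 1) * gram n 0 (wt G) i j + 1 * gram n 0 (wt H) i j"]
      unfolding lin by (simp add: sym)
  qed
  moreover have "loewner_le n (laplacian n H) ((1 + \<epsilon>) \<cdot>\<^sub>m laplacian n G)"
  proof -
    have "(1 + \<epsilon>) \<cdot>\<^sub>m laplacian n G - laplacian n H
      = fmat n (\<lambda>i j. (1 + \<epsilon>) * gram n 0 (wt G) i j + - 1 * gram n 0 (wt H) i j)"
      unfolding laplacian_eq_gram[OF G] laplacian_eq_gram[OF H]
      by (intro eq_matI) (auto simp: fmat_def algebra_simps)
    moreover have "0 \<le> (1 + \<epsilon>) * form n (wt G) x + - 1 * form n (wt H) x" for x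
      using up[of x] by (simp add: algebra_simps)
    ultimately show ?thesis
      unfolding loewner_le_def using positive_semidefinite_fmat[of n "\<lambda>i j. (1 + \<epsilon>) * gram n 0 (wt G) i j + - 1 * gram n 0 (wt H) i j"]
      unfolding lin by (simp add: sym)
  qed
  ultimately show ?thesis using assms unfolding spectral_sparsifier_def by blast
qed

text \<open>A Poincare inequality on the components of \<open>F\<close>, which later absorbs
  \<delta>. Subtracting from \<open>x\<close> its value at the root of the component preserves all
  differences along \<open>F\<close>, and each entry of the result is a sum of steps of size at most
  \<open>D\<close>.\<close>

lemma shift_on_components:
  assumes F: "F \<subseteq> all_edges n" and W: "\<And>e. e \<in> all_edges n \<Longrightarrow> 0 \<le> W e"
    and a: "a > 0" "\<And>e. e \<in> F \<Longrightarrow> a \<le> W e"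
  shows "\<exists>y. (\<forall>e\<in>F. dot n (inc e) y = dot n (inc e) x) \<and> a * dot n y y \<le> real n ^ 5 * form n W x"
proof -
  define R where "R = {(u, v). {u, v} \<in> F}"
  define D where "D = sqrt (form n W x / a)"
  have fx: "0 \<le> form n W x" using W by (rule form_nonneg)
  have D0: "0 \<le> D" and DD: "D * D = form n W x / a" using fx a by (auto simp: D_def)
  have RE: "{u, v} \<in> all_edges n" if "(u, v) \<in> R" for u v using that F by (auto simp: R_def)
  have Rsub: "R \<subseteq> {..<n} \<times> {..<n}" using RE by (fastforce simp: all_edges_def)
  then have finR: "finite R" by (rule finite_subset) simp
  have cR: "card R \<le> n * n" using card_mono[OF _ Rsub] by simp
  have symR: "sym R" by (auto simp: sym_def R_def insert_commute)
  have step: "\<bar>x u - x v\<bar> \<le> D" if "(u, v) \<in> R" for u v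
  proof -
    have e: "{u, v} \<in> F" "{u, v} \<in> all_edges n" using that RE by (auto simp: R_def)
    have "u \<noteq> v" using e(2) by (auto simp: all_edges_def)
    then have "(dot n (inc {u, v}) x)\<^sup>2 = (x u - x v)\<^sup>2"
      unfolding dot_inc[OF e(2)] by (cases "u < v") (auto simp: power2_commute)
    then have "a * (x u - x v)\<^sup>2 \<le> W {u, v} * (dot n (inc {u, v}) x)\<^sup>2"
      using a(2)[OF e(1)] by (simp add: mult_right_mono)
    also have "\<dots> \<le> form n W x"
      unfolding form_def using e W by (intro member_le_sum) auto
    finally have "(x u - x v)\<^sup>2 \<le> form n W x / a" using a by (simp add: field_simps)
    then show ?thesis unfolding D_def using real_le_rsqrt by (metis power2_abs)
  qed
  have path: "\<bar>x u - x v\<bar> \<le> real m * D" if "(u, v) \<in> R ^^ m" for u v m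
    using that
  proof (induction m arbitrary: v)
    case (Suc m)
    then obtain w where "(u, w) \<in> R ^^ m" "(w, v) \<in> R" by auto
    then have "\<bar>x u - x w\<bar> \<le> real m * D" "\<bar>x w - x v\<bar> \<le> D" using Suc step by auto
    then show ?case by (simp add: algebra_simps)
  qed simp
  \<comment> \<open>The least reachable vertex is a representative shared by the whole
    component.\<close>
  define root where "root u = (LEAST v. (u, v) \<in> R\<^sup>*)" for u
  have root: "(u, root u) \<in> R\<^sup>*" for u unfolding root_def by (rule LeastI[of _ u]) simp
  have root_eq: "root u = root v" if "(u, v) \<in> R" for u v
  proof -
    have "(v, u) \<in> R" using symR that by (simp add: sym_def)
    then have "(u, w) \<in> R\<^sup>* \<longleftrightarrow> (v, w) \<in> R\<^sup>*" for w
      using that by (meson converse_rtrancl_into_rtrancl)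
    then show ?thesis by (simp add: root_def)
  qed
  define y where "y u = x u - x (root u)" for u
  have yb: "\<bar>y u\<bar> \<le> real (n * n) * D" for u
  proof -
    \<comment> \<open>A path needs at most \<open>card R\<close>, hence n^2 steps, so the entries of
      \<open>y\<close> are at most n^2 D; squared and summed over n vertices this gives n^5.\<close>
    from root[of u] obtain m where m: "m \<le> card R" "(u, root u) \<in> R ^^ m"
      unfolding rtrancl_finite_eq_relpow[OF finR] by auto
    have "\<bar>y u\<bar> \<le> real m * D" unfolding y_def by (rule path[OF m(2)])
    also have "\<dots> \<le> real (n * n) * D" using m cR D0 by (intro mult_right_mono) linarith+
    finally show ?thesis .
  qed
  have "dot n (inc e) y = dot n (inc e) x" if "e \<in> F" for e
  proof -
    have e: "e \<in> all_edges n" using that F by auto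
    obtain u v where uv: "e = {u, v}" "u < v" "v < n" "Min e = u" "Max e = v" using all_edges_cases[OF e] .
    have "(u, v) \<in> R" using that uv by (simp add: R_def)
    then show ?thesis unfolding dot_inc[OF e] uv(4,5) by (simp add: y_def root_eq[of u v])
  qed
  moreover have "a * dot n y y \<le> real n ^ 5 * form n W x"
  proof -
    have "y i * y i \<le> (real (n * n) * D) * (real (n * n) * D)" for i
      using mult_mono[OF yb[of i] yb[of i]] D0 by simp
    then have "dot n y y \<le> (\<Sum>i<n. (real (n * n) * D) * (real (n * n) * D))"
      unfolding dot_def by (intro sum_mono)
    also have "\<dots> = real n ^ 5 * (D * D)" by (simp add: eval_nat_numeral ac_simps)
    finally have "a * dot n y y \<le> a * (real n ^ 5 * (form n W x / a))"
      unfolding DD using a by (intro mult_left_mono) auto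
    then show ?thesis using a by simp
  qed
  ultimately show ?thesis by blast
qed

section \<open>Protocols whose messages are blocks of fixed length\<close>

text \<open>The division drops an incomplete last block, so while a message is being written
  everyone still sees the state before it.\<close>

definition chunks :: "nat \<Rightarrow> bool list \<Rightarrow> bool list list" where
  "chunks L b = map (\<lambda>t. take L (drop (t * L) b)) [0..<length b div L]"

lemma chunks_append_part:
  assumes "length b = u * L" "length c < L"
  shows "chunks L (b @ c) = chunks L b"
proof -
  have "length (b @ c) div L = u" "length b div L = u" using assms by auto
  moreover have "take L (drop (t * L) (b @ c)) = take L (drop (t * L) b)" if "t < u" for t
  proof -
    have "Suc t * L \<le> u * L" using that by (intro mult_le_mono1) simp
    then show ?thesis using assms by simp
  qed
  ultimately show ?thesis unfolding chunks_def by simp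
qed

lemma chunks_append_full:
  assumes "length b = u * L" "length c = L" "L > 0"
  shows "chunks L (b @ c) = chunks L b @ [c]"
proof -
  have "length (b @ c) div L = Suc u" "length b div L = u" using assms by auto
  moreover have "take L (drop (t * L) (b @ c)) = take L (drop (t * L) b)" if "t < u" for t
  proof -
    have "Suc t * L \<le> u * L" using that by (intro mult_le_mono1) simp
    then show ?thesis using assms by simp
  qed
  ultimately show ?thesis unfolding chunks_def using assms by simp
qed

lemma board_stable:
  assumes "speaker P (board P x r t) = None"
  shows "board P x r (t + k) = board P x r t"
  by (induction k) (use assms in auto)

lemma length_board_le: "length (board P x r t) \<le> t"
  by (induction t) (auto split: option.splits)

lemma final_board_eq:
  assumes "speaker P (board P x r t) = None"
  shows "final_board P x r = board P x r t"
proof -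
  define t' where "t' = (LEAST t. speaker P (board P x r t) = None)"
  have "speaker P (board P x r t') = None" unfolding t'_def using assms by (rule LeastI)
  moreover have "t' \<le> t" unfolding t'_def using assms by (rule Least_le)
  ultimately have "board P x r t = board P x r t'"
    using board_stable[of P x r t' "t - t'"] by simp
  then show ?thesis by (simp add: final_board_def t'_def)
qed

text \<open>Protocols described by states and whole messages, to be compiled into bits. The bit
  model offers only functions of the board, so the state is recomputed from the bits, and the
  speaker rebuilds its entire message for every bit it writes.\<close>

locale block_code =
  fixes L :: nat and enc :: "'m \<Rightarrow> bool list" and dec :: "bool list \<Rightarrow> 'm"
    and upd :: "'st \<Rightarrow> 'm \<Rightarrow> 'st" and st0 :: 'st and spk :: "'st \<Rightarrow> nat option"
    and msg :: "nat \<Rightarrow> 'x \<Rightarrow> nat \<Rightarrow> 'st \<Rightarrow> 'm" and coin :: "nat \<Rightarrow> nat pmf" and out :: "'st \<Rightarrow> 'y"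
begin

definition board_state :: "bool list \<Rightarrow> 'st" where
  "board_state b = foldl upd st0 (map dec (chunks L b))"

definition prot :: "('x, 'y) protocol" where
  "prot = \<lparr>speaker = (\<lambda>b. spk (board_state b)),
    next_bit = (\<lambda>i x r b. enc (msg i x r (board_state b)) ! (length b mod L)),
    coins = coin, result = (\<lambda>b. out (board_state b))\<rparr>"

primrec run :: "(nat \<Rightarrow> 'x) \<Rightarrow> (nat \<Rightarrow> nat) \<Rightarrow> nat \<Rightarrow> 'st" where
  "run x r 0 = st0"
| "run x r (Suc t) = (case spk (run x r t) of None \<Rightarrow> run x r t
     | Some i \<Rightarrow> upd (run x r t) (msg i (x i) (r i) (run x r t)))"

text \<open>One step of \<open>run\<close> is \<open>L\<close> bits. The code has to be faithful
  only on messages that occur in the run. The length is merely some multiple of \<open>L\<close>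
  because the board stops growing when the protocol stops while \<open>t\<close> goes on.\<close>

lemma board_run:
  assumes "L > 0"
    and valid: "\<And>t i. spk (run x r t) = Some i \<Longrightarrow>
      length (enc (msg i (x i) (r i) (run x r t))) = L \<and>
      dec (enc (msg i (x i) (r i) (run x r t))) = msg i (x i) (r i) (run x r t)"
  shows "(\<exists>u. length (board prot x r (t * L)) = u * L) \<and> board_state (board prot x r (t * L)) = run x r t"
proof (induction t)
  case 0
  show ?case by (simp add: board_state_def chunks_def)
next
  case (Suc t)
  let ?b = "board prot x r (t * L)"
  obtain u where u: "length ?b = u * L" using Suc by blast
  have st: "board_state ?b = run x r t" using Suc by blast
  show ?case
  proof (cases "spk (run x r t)")
    case None
    then have "board prot x r (t * L + L) = ?b"
      using st by (intro board_stable) (simp add: prot_def)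
    then show ?thesis using u st None by (auto simp: add.commute)
  next
    case (Some i)
    define m where "m = msg i (x i) (r i) (run x r t)"
    have m: "length (enc m) = L" "dec (enc m) = m" using valid[OF Some] by (auto simp: m_def)
    have "board prot x r (t * L + k) = ?b @ take k (enc m)" if "k \<le> L" for k
      using that
    proof (induction k)
      case (Suc k)
      then have b: "board prot x r (t * L + k) = ?b @ take k (enc m)" and k: "k < L" by auto
      have bs: "board_state (?b @ take k (enc m)) = run x r t"
        unfolding board_state_def using st[unfolded board_state_def] chunks_append_part[OF u, of "take k (enc m)"] m k
        by simp
      have len: "length (?b @ take k (enc m)) mod L = k" using u m k by simp
      have "board prot x r (t * L + Suc k) = (?b @ take k (enc m)) @ [enc m ! k]"
        using b Some bs len by (simp add: prot_def m_def)
      then show ?case using k m by (simp add: take_Suc_conv_app_nth)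
    qed simp
    from this[of L] have b: "board prot x r (Suc t * L) = ?b @ enc m" using m by (simp add: add.commute)
    have "board_state (?b @ enc m) = upd (run x r t) m"
      unfolding board_state_def chunks_append_full[OF u m(1) \<open>L > 0\<close>]
      using st[unfolded board_state_def] m by simp
    moreover have "length (?b @ enc m) = Suc u * L" using u m by simp
    ultimately show ?thesis unfolding b using Some by (intro conjI exI[of _ "Suc u"]) (auto simp: m_def)
  qed
qed

lemma prot_correct:
  assumes "L > 0"
    and "\<And>t i. spk (run x r t) = Some i \<Longrightarrow>
      length (enc (msg i (x i) (r i) (run x r t))) = L \<and>
      dec (enc (msg i (x i) (r i) (run x r t))) = msg i (x i) (r i) (run x r t)"
    and stop: "spk (run x r t) = None"
  shows "terminates prot x r" "comm_cost prot x r \<le> t * L" "protocol_output prot x r = out (run x r t)"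
proof -
  have st: "board_state (board prot x r (t * L)) = run x r t" using board_run[OF assms(1,2)] by blast
  then have sp: "speaker prot (board prot x r (t * L)) = None" using stop by (simp add: prot_def)
  then show "terminates prot x r" unfolding terminates_def by blast
  show "comm_cost prot x r \<le> t * L"
    unfolding comm_cost_def final_board_eq[OF sp] by (rule length_board_le)
  show "protocol_output prot x r = out (run x r t)"
    unfolding protocol_output_def final_board_eq[OF sp] using st by (simp add: prot_def)
qed

end

section \<open>The halving protocol\<close>

lemma dot_scale_left: "dot n (\<lambda>i. c * b i) x = c * dot n b x"
  by (simp add: dot_def sum_distrib_left mult.assoc)

text \<open>The coin of a site is one natural number read as a bit string; this is the position of
  the bit that decides about \<open>e\<close> in round \<open>l\<close>.\<close>

definition idx :: "nat set \<Rightarrow> nat \<Rightarrow> nat" where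
  "idx e l = prod_encode (set_encode e, l)"

lemma idx_eq_iff: "finite e \<Longrightarrow> finite f \<Longrightarrow> idx e l = idx f m \<longleftrightarrow> e = f \<and> l = m"
  unfolding idx_def using inj_prod_encode by (auto simp: set_encode_eq)

definition alive :: "nat \<Rightarrow> nat set \<Rightarrow> nat \<Rightarrow> bool" where
  "alive r e j \<longleftrightarrow> (\<forall>l<j. bit r (idx e l))"

text \<open>In a state \<open>(p, W)\<close>, \<open>p\<close> counts the passes so far, so that site \<open>p mod s\<close> speaks in round
  \<open>p div s\<close>, and \<open>W e\<close> is the weight posted for \<open>e\<close>, with 0 meaning that \<open>e\<close> has not been posted. The
  message \<open>None\<close> is a pass; an edge is posted with the numerator of its rounded weight \<open>m / K\<close>, and the
  factor \<open>2 ^ (p div s)\<close> is read off the state.\<close>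

type_synonym post = "(nat set \<times> nat) option"
type_synonym state = "nat \<times> (nat set \<Rightarrow> real)"

definition items :: "nat \<Rightarrow> nat \<Rightarrow> post set" where
  "items n m = insert None (Some ` (all_edges n \<times> {..m}))"

text \<open>The leverage c b^T (L + \<delta> I)^(-1) b of the edge with incidence vector b is the
  maximum of c (b^T x)^2 / (x^T (L + \<delta> I) x) over nonzero x. Asking for one x that exceeds
  \<eta> avoids inverses.\<close>

definition heavy :: "nat \<Rightarrow> real \<Rightarrow> real \<Rightarrow> (nat set \<Rightarrow> real) \<Rightarrow> real \<Rightarrow> nat set \<Rightarrow> bool" where
  "heavy n \<eta> \<delta> W c e \<longleftrightarrow> (\<exists>x. c * (dot n (inc e) x)\<^sup>2 > \<eta> * (\<delta> * dot n x x + form n W x))"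

text \<open>A larger form has smaller leverages. Hence an edge that was light when its site passed
  is light at the end of the round, whatever later sites post.\<close>

lemma not_heavy_mono:
  assumes "\<not> heavy n \<eta> \<delta> W c e" "\<And>f. f \<in> all_edges n \<Longrightarrow> W f \<le> V f" "\<eta> \<ge> 0"
  shows "\<not> heavy n \<eta> \<delta> V c e"
proof -
  have "c * (dot n (inc e) x)\<^sup>2 \<le> \<eta> * (\<delta> * dot n x x + form n V x)" for x
  proof -
    have "c * (dot n (inc e) x)\<^sup>2 \<le> \<eta> * (\<delta> * dot n x x + form n W x)"
      using assms(1) by (auto simp: heavy_def not_less)
    also have "\<dots> \<le> \<eta> * (\<delta> * dot n x x + form n V x)"
      using form_mono[of n W V x] assms by (intro mult_left_mono) auto
    finally show ?thesis .
  qed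
  then show ?thesis by (auto simp: heavy_def not_less)
qed

text \<open>\<open>J\<close> is the number of rounds, \<open>K\<close> the denominator of rounded
  weights, \<open>mmax\<close> the largest numerator, \<open>L\<close> the length of a message and
  \<open>T\<close> the number of bits of a private coin.\<close>

locale halving =
  fixes n s J K T L mmax :: nat and \<eta> \<delta> :: real
    and enc :: "post \<Rightarrow> bool list" and dec :: "bool list \<Rightarrow> post"
  assumes s_pos: "s > 0" and K_pos: "K > 0" and \<eta>_pos: "\<eta> > 0" and \<delta>_pos: "\<delta> > 0" and L_pos: "L > 0"
    and code: "\<And>m. m \<in> items n mmax \<Longrightarrow> length (enc m) = L \<and> dec (enc m) = m"
    and T: "\<And>e l. e \<in> all_edges n \<Longrightarrow> l < J \<Longrightarrow> idx e l < T"
begin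

text \<open>Rounding up never sends a positive weight to 0, the mark of an unposted edge.\<close>

definition mul :: "real \<Rightarrow> nat" where
  "mul w = nat \<lceil>w * K\<rceil>"

definition cand :: "wgraph \<Rightarrow> nat \<Rightarrow> state \<Rightarrow> nat set set" where
  "cand x r st = {e \<in> edges x. snd st e = 0 \<and> alive r e (fst st div s) \<and>
     heavy n \<eta> \<delta> (snd st) (2 ^ (fst st div s) * (mul (weight x e) / K)) e}"

definition msg :: "nat \<Rightarrow> wgraph \<Rightarrow> nat \<Rightarrow> state \<Rightarrow> post" where
  "msg i x r st = (if cand x r st = {} then None
     else Some (SOME e. e \<in> cand x r st, mul (weight x (SOME e. e \<in> cand x r st))))"

definition upd :: "state \<Rightarrow> post \<Rightarrow> state" where
  "upd st m = (case m of None \<Rightarrow> (Suc (fst st), snd st)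
     | Some (e, k) \<Rightarrow> (fst st, (snd st)(e := 2 ^ (fst st div s) * (k / K))))"

definition spk :: "state \<Rightarrow> nat option" where
  "spk st = (if fst st < J * s then Some (fst st mod s) else None)"

definition out :: "state \<Rightarrow> wgraph" where
  "out st = \<lparr>edges = {e. snd st e \<noteq> 0}, weight = snd st\<rparr>"

sublocale block_code L enc dec upd "(0, \<lambda>_. 0)" spk msg "\<lambda>_. pmf_of_set {..<2 ^ T}" out .

text \<open>A uniform coin below \<open>2 ^ T\<close> amounts to \<open>T\<close> independent fair
  bits; the default 0 outside the sites matches \<open>joint_coins\<close>.\<close>

definition \<Omega> :: "(nat \<Rightarrow> nat) set" where
  "\<Omega> = PiE_dflt {..<s} 0 (\<lambda>_. {..<2 ^ T})"

lemma coin_range_nonempty: "{..<(2::nat) ^ T} \<noteq> {}"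
proof -
  have "0 \<in> {..<(2::nat) ^ T}" by simp
  then show ?thesis by (metis emptyE)
qed

lemma finite_\<Omega>: "finite \<Omega>"
  unfolding \<Omega>_def by (intro finite_PiE_dflt) auto

lemma \<Omega>_nonempty: "\<Omega> \<noteq> {}"
  using coin_range_nonempty by (auto simp: \<Omega>_def)

lemma joint_coins_prot: "joint_coins s prot = pmf_of_set \<Omega>"
proof -
  have "coins prot = (\<lambda>_. pmf_of_set {..<2 ^ T})" by (simp add: prot_def)
  then show ?thesis unfolding joint_coins_def \<Omega>_def
    by (simp only:) (rule Pi_pmf_of_set, use coin_range_nonempty in auto)
qed

lemma blackboard_prot: "blackboard_protocol s prot"
  using s_pos by (auto simp: blackboard_protocol_def prot_def spk_def split: if_splits)

end

section \<open>Runs on a fixed allocated graph\<close>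

locale halving_input = halving +
  fixes G :: wgraph and \<sigma> :: "nat set \<Rightarrow> nat"
  assumes G: "weighted_graph n G" and \<sigma>: "\<And>e. e \<in> edges G \<Longrightarrow> \<sigma> e < s"
    and mmax: "\<And>e. e \<in> edges G \<Longrightarrow> mul (weight G e) \<le> mmax"
begin

lemma edges_subset: "edges G \<subseteq> all_edges n"
  using G by (auto simp: weighted_graph_def all_edges_def)

lemma finite_edges: "finite (edges G)"
  using edges_subset finite_all_edges by (rule finite_subset)

definition w :: "nat set \<Rightarrow> real" where
  "w e = (if e \<in> edges G then mul (weight G e) / K else 0)"

lemma w_pos: "e \<in> edges G \<Longrightarrow> 0 < w e"
  using G K_pos by (auto simp: w_def weighted_graph_def mul_def)

lemma w_nonneg: "0 \<le> w e"
  by (simp add: w_def)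

lemma w_le: "w e \<le> mmax / K"
  using mmax by (auto simp: w_def divide_right_mono)

abbreviation R :: "(nat \<Rightarrow> nat) \<Rightarrow> nat \<Rightarrow> state" where
  "R r t \<equiv> run (site_graph G \<sigma>) r t"

definition live :: "(nat \<Rightarrow> nat) \<Rightarrow> nat set \<Rightarrow> nat \<Rightarrow> bool" where
  "live r e j \<longleftrightarrow> (\<forall>l<j. bit (r (\<sigma> e)) (idx e l))"

definition cands :: "(nat \<Rightarrow> nat) \<Rightarrow> state \<Rightarrow> nat set set" where
  "cands r st = {e \<in> edges G. \<sigma> e = fst st mod s \<and> snd st e = 0 \<and> live r e (fst st div s) \<and>
     heavy n \<eta> \<delta> (snd st) (2 ^ (fst st div s) * w e) e}"

text \<open>Passes from the local to the global view: what the speaker computes from its own edges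
  and coin is expressed through the whole graph and all coins, as the analysis needs it.\<close>

lemma cand_site: "cand (site_graph G \<sigma> (fst st mod s)) (r (fst st mod s)) st = cands r st"
  unfolding cand_def cands_def
  by (intro Collect_cong) (auto simp: site_graph_def w_def alive_def live_def)

lemma R_0: "R r 0 = (0, \<lambda>_. 0)"
  by simp

lemma R_Suc: "R r (Suc t) = (if fst (R r t) < J * s
    then (if cands r (R r t) = {} then (Suc (fst (R r t)), snd (R r t))
       else (fst (R r t), (snd (R r t))((SOME e. e \<in> cands r (R r t)) :=
          2 ^ (fst (R r t) div s) * w (SOME e. e \<in> cands r (R r t)))))
    else R r t)"
proof (cases "fst (R r t) < J * s")
  case True
  define i where "i = fst (R r t) mod s"
  define e where "e = (SOME e. e \<in> cands r (R r t))"
  have c: "cand (site_graph G \<sigma> i) (r i) (R r t) = cands r (R r t)"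
    unfolding i_def by (rule cand_site)
  have 1: "R r (Suc t) = upd (R r t) (msg i (site_graph G \<sigma> i) (r i) (R r t))"
    using True by (simp add: spk_def i_def)
  show ?thesis
  proof (cases "cands r (R r t) = {}")
    case True
    then show ?thesis using \<open>fst (R r t) < J * s\<close> unfolding 1 by (simp add: msg_def c upd_def)
  next
    case False
    then have "e \<in> cands r (R r t)" unfolding e_def by (simp add: some_in_eq)
    then have e: "e \<in> edges G" "\<sigma> e = i" by (auto simp: cands_def i_def)
    have "msg i (site_graph G \<sigma> i) (r i) (R r t) = Some (e, mul (weight G e))"
      using False e unfolding msg_def c e_def[symmetric] by (simp add: site_graph_def)
    then show ?thesis using \<open>fst (R r t) < J * s\<close> False e(1) unfolding 1
      by (simp add: upd_def w_def e_def)
  qed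
next
  case False
  then show ?thesis by (simp add: spk_def)
qed

declare run.simps(2) [simp del]

lemma R_cases:
  obtains (stop) "fst (R r t) \<ge> J * s" "R r (Suc t) = R r t"
  | (pass) "fst (R r t) < J * s" "cands r (R r t) = {}" "R r (Suc t) = (Suc (fst (R r t)), snd (R r t))"
  | (post) e where "fst (R r t) < J * s" "e \<in> cands r (R r t)"
      "R r (Suc t) = (fst (R r t), (snd (R r t))(e := 2 ^ (fst (R r t) div s) * w e))"
proof (cases "fst (R r t) < J * s")
  case True
  show ?thesis
  proof (cases "cands r (R r t) = {}")
    case True then show ?thesis using \<open>fst (R r t) < J * s\<close> pass by (simp add: R_Suc)
  next
    case False
    then have "(SOME e. e \<in> cands r (R r t)) \<in> cands r (R r t)" by (simp add: some_in_eq)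
    then show ?thesis using \<open>fst (R r t) < J * s\<close> False by (intro post) (auto simp: R_Suc)
  qed
next
  case False then show ?thesis using stop by (simp add: R_Suc)
qed

lemma passes_le: "fst (R r t) \<le> J * s"
proof (induction t)
  case (Suc t)
  show ?case using Suc by (cases rule: R_cases[of r t]) auto
qed simp

lemma passes_mono: "fst (R r t) \<le> fst (R r (t + k))"
proof (induction k)
  case (Suc k)
  show ?case using Suc by (cases rule: R_cases[of r "t + k"]) auto
qed simp

lemma round_lt: "p < J * s \<Longrightarrow> p div s < J"
  using s_pos by (simp add: less_mult_imp_div_less)

lemma posted:
  assumes "snd (R r t) e \<noteq> 0"
  shows "e \<in> edges G \<and> 0 < snd (R r t) e \<and> snd (R r t) e \<le> 2 ^ J * (mmax / K)"
  using assms
proof (induction t)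
  case (Suc t)
  show ?case
  proof (cases rule: R_cases[of r t])
    case (post f)
    show ?thesis
    proof (cases "e = f")
      case True
      have f: "f \<in> edges G" using post by (auto simp: cands_def)
      have "(2::real) ^ (fst (R r t) div s) \<le> 2 ^ J"
        using round_lt[OF post(1)] by (intro power_increasing) auto
      then have "2 ^ (fst (R r t) div s) * w f \<le> 2 ^ J * (mmax / K)"
        using w_le[of f] w_nonneg[of f] by (intro mult_mono) auto
      then show ?thesis using True f w_pos[OF f] post by simp
    next
      case False
      then show ?thesis using Suc post by simp
    qed
  qed (use Suc in auto)
qed (simp add: R_0)

lemma posted_nonneg: "0 \<le> snd (R r t) e"
  using posted[of r t e] by (cases "snd (R r t) e = 0") auto

lemma supp_subset: "{e. snd (R r t) e \<noteq> 0} \<subseteq> edges G"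
  using posted by blast

lemma finite_supp: "finite {e. snd (R r t) e \<noteq> 0}"
  using supp_subset finite_edges by (rule finite_subset)

lemma card_supp_update:
  assumes "snd (R r t) e = 0" "c \<noteq> 0"
  shows "card {f. ((snd (R r t))(e := c)) f \<noteq> 0} = Suc (card {f. snd (R r t) f \<noteq> 0})"
proof -
  have "{f. ((snd (R r t))(e := c)) f \<noteq> 0} = insert e {f. snd (R r t) f \<noteq> 0}"
    using assms by auto
  then show ?thesis using finite_supp[of r t] assms by simp
qed

text \<open>Before the end every step either counts a pass or posts a new edge, so a bound on the
  number of posted edges bounds the running time.\<close>

lemma time_eq: "fst (R r t) < J * s \<Longrightarrow> t = fst (R r t) + card {e. snd (R r t) e \<noteq> 0}"
proof (induction t)
  case (Suc t)
  show ?case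
  proof (cases rule: R_cases[of r t])
    case (post e)
    then have "snd (R r t) e = 0" "2 ^ (fst (R r t) div s) * w e \<noteq> 0"
      using w_pos[of e] by (auto simp: cands_def)
    then show ?thesis using Suc post card_supp_update by simp
  qed (use Suc in auto)
qed simp

text \<open>The potential starts at \<delta>^n, the determinant for the empty board. The induction
  hypothesis also supplies the positive determinant that the rank-one update asks for.\<close>

lemma det_gram_ge:
  "(1 + \<eta>) ^ card {e. snd (R r t) e \<noteq> 0} * \<delta> ^ n \<le> det (fmat n (gram n \<delta> (snd (R r t))))"
proof (induction t)
  case 0
  have "fmat n (gram n \<delta> (\<lambda>_. 0)) = \<delta> \<cdot>\<^sub>m 1\<^sub>m n"
    by (intro eq_matI) (auto simp: fmat_def gram_def)
  then show ?case by (simp add: R_0)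
next
  case (Suc t)
  show ?case
  proof (cases rule: R_cases[of r t])
    case (post e)
    let ?W = "snd (R r t)" and ?c = "2 ^ (fst (R r t) div s) * w e"
    let ?b = "\<lambda>i. sqrt ?c * inc e i"
    have e: "e \<in> edges G" "?W e = 0" "heavy n \<eta> \<delta> ?W ?c e" using post by (auto simp: cands_def)
    have c0: "?c > 0" using w_pos[OF e(1)] by simp
    obtain x where x: "?c * (dot n (inc e) x)\<^sup>2 > \<eta> * (\<delta> * dot n x x + form n ?W x)"
      using e(3) by (auto simp: heavy_def)
    have "dot n ?b x = sqrt ?c * dot n (inc e) x"
      by (rule dot_scale_left)
    then have "(dot n ?b x)\<^sup>2 = ?c * (dot n (inc e) x)\<^sup>2"
      using c0 by (simp add: power_mult_distrib)
    then have hv: "(dot n ?b x)\<^sup>2 > \<eta> * bil n (gram n \<delta> ?W) x x"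
      using x by (simp add: bil_gram_self)
    have "0 < (1 + \<eta>) ^ card {e. snd (R r t) e \<noteq> 0} * \<delta> ^ n" using \<eta>_pos \<delta>_pos by simp
    then have d0: "det (fmat n (gram n \<delta> ?W)) > 0" using Suc by linarith
    have "fmat n (gram n \<delta> (?W(e := ?c))) = fmat n (\<lambda>i j. gram n \<delta> ?W i j + ?b i * ?b j)"
      using gram_update[of e n ?W ?c \<delta>] e edges_subset c0 by (intro eq_matI) (auto simp: fmat_def)
    then have "det (fmat n (gram n \<delta> (snd (R r (Suc t))))) \<ge> (1 + \<eta>) * det (fmat n (gram n \<delta> ?W))"
      using det_rank_one_update[OF pos_def_gram[OF \<delta>_pos posted_nonneg] hv \<eta>_pos d0] post by simp
    moreover have "(1 + \<eta>) * det (fmat n (gram n \<delta> ?W)) \<ge> (1 + \<eta>) * ((1 + \<eta>) ^ card {e. ?W e \<noteq> 0} * \<delta> ^ n)"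
      using Suc \<eta>_pos by (intro mult_left_mono) auto
    moreover have "card {e. snd (R r (Suc t)) e \<noteq> 0} = Suc (card {e. ?W e \<noteq> 0})"
      unfolding post(3) snd_conv using e c0 by (intro card_supp_update) auto
    ultimately show ?thesis by simp
  qed (use Suc in auto)
qed

lemma gram_abs_le: "\<bar>gram n \<delta> (snd (R r t)) i j\<bar> \<le> \<delta> + real n ^ 2 * (2 ^ J * (mmax / K))"
proof -
  have inc1: "\<bar>inc e i\<bar> \<le> 1" for e i by (simp add: inc_def)
  have b: "\<bar>snd (R r t) e * inc e i * inc e j\<bar> \<le> 2 ^ J * (mmax / K)" for e
  proof -
    have "\<bar>snd (R r t) e * inc e i * inc e j\<bar> = snd (R r t) e * (\<bar>inc e i\<bar> * \<bar>inc e j\<bar>)"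
      using posted_nonneg[of r t e] by (simp add: abs_mult)
    also have "\<dots> \<le> snd (R r t) e * (1 * 1)"
      using posted_nonneg inc1 by (intro mult_left_mono mult_mono) auto
    also have "\<dots> \<le> 2 ^ J * (mmax / K)"
      using posted[of r t e] by (cases "snd (R r t) e = 0") auto
    finally show ?thesis .
  qed
  have "\<bar>gram n \<delta> (snd (R r t)) i j\<bar> \<le> \<delta> + (\<Sum>e\<in>all_edges n. \<bar>snd (R r t) e * inc e i * inc e j\<bar>)"
    unfolding gram_def using \<delta>_pos
    by (intro order_trans[OF abs_triangle_ineq] add_mono sum_abs) auto
  also have "\<dots> \<le> \<delta> + (\<Sum>e\<in>all_edges n. 2 ^ J * (mmax / K))"
    using b by (intro add_left_mono sum_mono)
  also have "\<dots> \<le> \<delta> + real n ^ 2 * (2 ^ J * (mmax / K))"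
  proof -
    have "real (card (all_edges n)) \<le> real (n ^ 2)" using card_all_edges_le by (simp only: of_nat_le_iff)
    then have "real (card (all_edges n)) * (2 ^ J * (mmax / K)) \<le> real (n ^ 2) * (2 ^ J * (mmax / K))"
      by (rule mult_right_mono) simp
    then show ?thesis by simp
  qed
  finally show ?thesis .
qed

lemma supp_bound:
  "(1 + \<eta>) ^ card {e. snd (R r t) e \<noteq> 0} * \<delta> ^ n \<le> fact n * (\<delta> + real n ^ 2 * (2 ^ J * (mmax / K))) ^ n"
  using det_gram_ge[of r t] det_le_fact_power[of n "gram n \<delta> (snd (R r t))", OF gram_abs_le]
  by (rule order_trans)

text \<open>A run still active at this time would have made fewer than J s passes and at most
  \<open>Cnt\<close> posts, too few to fill the time. This holds for each \<open>r\<close>: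
  randomness affects only correctness, not cost.\<close>

lemma stops:
  assumes "\<And>N. (1 + \<eta>) ^ N * \<delta> ^ n \<le> fact n * (\<delta> + real n ^ 2 * (2 ^ J * (mmax / K))) ^ n \<Longrightarrow> N \<le> Cnt"
  shows "fst (R r (J * s + Cnt)) = J * s"
proof (rule ccontr)
  let ?t = "J * s + Cnt"
  assume "fst (R r ?t) \<noteq> J * s"
  then have lt: "fst (R r ?t) < J * s" using passes_le[of r ?t] by simp
  have "card {e. snd (R r ?t) e \<noteq> 0} \<le> Cnt" using assms supp_bound by blast
  then show False using time_eq[OF lt] lt by linarith
qed

lemma message_valid:
  assumes "spk (R r t) = Some i"
  shows "msg i (site_graph G \<sigma> i) (r i) (R r t) \<in> items n mmax"
proof -
  have i: "i = fst (R r t) mod s" using assms by (auto simp: spk_def split: if_splits)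
  show ?thesis
  proof (cases "cands r (R r t) = {}")
    case True
    then show ?thesis unfolding i by (simp add: msg_def cand_site items_def)
  next
    case False
    define e where "e = (SOME e. e \<in> cands r (R r t))"
    have "e \<in> cands r (R r t)" using False unfolding e_def by (simp add: some_in_eq)
    then have e: "e \<in> edges G" "\<sigma> e = fst (R r t) mod s" by (auto simp: cands_def)
    then show ?thesis using False mmax[OF e(1)] edges_subset
      unfolding i msg_def cand_site e_def[symmetric] by (auto simp: items_def site_graph_def)
  qed
qed

lemma prot_result:
  assumes "fst (R r t) = J * s"
  shows "terminates prot (site_graph G \<sigma>) r" "comm_cost prot (site_graph G \<sigma>) r \<le> t * L"
    "protocol_output prot (site_graph G \<sigma>) r = out (R r t)"
  using prot_correct[of "site_graph G \<sigma>" r t] L_pos message_valid code assms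
  by (auto simp: spk_def)

end

section \<open>Deviation of one round\<close>

context halving_input
begin

text \<open>The graph from which the protocol still samples in round \<open>j\<close>: posted edges keep their weight,
  unposted survivors have doubled \<open>j\<close> times.\<close>

definition cur :: "(nat \<Rightarrow> nat) \<Rightarrow> nat \<Rightarrow> (nat set \<Rightarrow> real) \<Rightarrow> nat set \<Rightarrow> real" where
  "cur r j W e = (if W e \<noteq> 0 then W e else if e \<in> edges G \<and> live r e j then 2 ^ j * w e else 0)"

text \<open>The premise singles out the step at which the last site ends round \<open>j\<close>;
  quantifying over \<open>t\<close> spares a name for it. The deviation is measured against the
  regularised form, as lightness is.\<close>

definition good :: "real \<Rightarrow> nat \<Rightarrow> (nat \<Rightarrow> nat) \<Rightarrow> bool" where
  "good \<beta> j r \<longleftrightarrow> (\<forall>t. Suc (fst (R r t)) = Suc j * s \<and> cands r (R r t) = {} \<longrightarrow>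
     (\<forall>x. \<bar>form n (cur r (Suc j) (snd (R r t))) x - form n (cur r j (snd (R r t))) x\<bar>
        \<le> \<beta> * (\<delta> * dot n x x + form n (cur r j (snd (R r t))) x)))"

lemma cur_nonneg: "(\<And>e. 0 \<le> W e) \<Longrightarrow> 0 \<le> cur r j W e"
  by (simp add: cur_def w_nonneg)

text \<open>Sites below \<open>fst (R r t) mod s\<close> have already passed in the current round,
  and a site passes only without heavy candidates. Later posts preserve this by
  monotonicity.\<close>

lemma light_invariant:
  assumes "e \<in> edges G" "snd (R r t) e = 0" "live r e (fst (R r t) div s)" "\<sigma> e < fst (R r t) mod s"
  shows "\<not> heavy n \<eta> \<delta> (snd (R r t)) (2 ^ (fst (R r t) div s) * w e) e"
  using assms
proof (induction t)
  case (Suc t)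
  show ?case
  proof (cases rule: R_cases[of r t])
    case stop
    then show ?thesis using Suc by simp
  next
    case pass
    \<comment> \<open>If this pass ended the round, the new remainder would be 0 and no site would
      lie below it.\<close>
    have "Suc (fst (R r t)) mod s \<noteq> 0" using Suc.prems(4) pass by auto
    then have dm: "Suc (fst (R r t)) div s = fst (R r t) div s" "Suc (fst (R r t)) mod s = Suc (fst (R r t) mod s)"
      by (simp add: div_Suc, simp add: mod_Suc split: if_splits)
    show ?thesis
    proof (cases "\<sigma> e = fst (R r t) mod s")
      case True
      then have "e \<notin> cands r (R r t)" using pass by simp
      then show ?thesis using True Suc.prems pass dm by (auto simp: cands_def)
    next
      case False
      then show ?thesis using Suc pass dm by auto
    qed
  next
    case (post f)
    let ?c = "2 ^ (fst (R r t) div s) * w f"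
    have f: "f \<in> edges G" "snd (R r t) f = 0" using post by (auto simp: cands_def)
    then have c: "?c > 0" using w_pos by simp
    note prems = Suc.prems[unfolded post(3) fst_conv snd_conv]
    have "e \<noteq> f" using prems(2) c by auto
    then have "snd (R r t) e = 0" using prems(2) by simp
    then have "\<not> heavy n \<eta> \<delta> (snd (R r t)) (2 ^ (fst (R r t) div s) * w e) e"
      using Suc.IH prems(1,3,4) by blast
    then have "\<not> heavy n \<eta> \<delta> ((snd (R r t))(f := ?c)) (2 ^ (fst (R r t) div s) * w e) e"
      by (rule not_heavy_mono) (use f c \<eta>_pos in auto)
    then show ?thesis unfolding post(3) fst_conv snd_conv .
  qed
qed simp

text \<open>An unposted survivor already carries the weight 2^j w in the sampled graph, so posting
  freezes it without changing the form. Only the end of a round changes the form.\<close>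

lemma cur_post:
  assumes "e \<in> cands r (R r t)"
  shows "cur r (fst (R r t) div s) ((snd (R r t))(e := 2 ^ (fst (R r t) div s) * w e))
    = cur r (fst (R r t) div s) (snd (R r t))"
  using assms w_pos[of e] by (intro ext) (auto simp: cur_def cands_def)

text \<open>The deviation of a round is relative to the regularised form, and halving leaves its
  \<delta> part alone. So it is this form that changes by a factor 1 \<plusminus> \<beta> per
  completed round, starting from the rounded input \<open>w\<close>.\<close>

lemma cur_bounds:
  assumes gd: "\<And>j. j < J \<Longrightarrow> good \<beta> j r" and \<beta>: "0 \<le> \<beta>" "\<beta> \<le> 1"
  defines "q \<equiv> \<lambda>V x. \<delta> * dot n x x + form n V x"
  shows "(1 - \<beta>) ^ (fst (R r t) div s) * q w x \<le> q (cur r (fst (R r t) div s) (snd (R r t))) x \<and>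
    q (cur r (fst (R r t) div s) (snd (R r t))) x \<le> (1 + \<beta>) ^ (fst (R r t) div s) * q w x"
proof (induction t)
  case 0
  have "cur r 0 (\<lambda>_. 0) = w" by (intro ext) (auto simp: cur_def live_def w_def)
  then show ?case by (simp add: R_0)
next
  case (Suc t)
  show ?case
  proof (cases rule: R_cases[of r t])
    case stop
    then show ?thesis using Suc by simp
  next
    case (post e)
    show ?thesis unfolding post(3) fst_conv snd_conv cur_post[OF post(2)] by (rule Suc)
  next
    case pass
    let ?p = "fst (R r t)" and ?W = "snd (R r t)"
    define j where "j = ?p div s"
    show ?thesis
    proof (cases "Suc ?p mod s = 0")
      case False
      then have "Suc ?p div s = ?p div s" by (simp add: div_Suc)
      then show ?thesis using Suc pass by simp
    next
      case True
      then have d: "Suc ?p div s = Suc j" by (simp add: div_Suc j_def)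
      then have e: "Suc ?p = Suc j * s" using True by (metis add.right_neutral div_mult_mod_eq)
      have "j < J" unfolding j_def using pass by (intro round_lt)
      then have "\<bar>form n (cur r (Suc j) ?W) x - form n (cur r j ?W) x\<bar> \<le> \<beta> * q (cur r j ?W) x"
        using gd[of j] e pass unfolding good_def q_def by blast
      then have up: "q (cur r (Suc j) ?W) x \<le> (1 + \<beta>) * q (cur r j ?W) x"
        and lo: "(1 - \<beta>) * q (cur r j ?W) x \<le> q (cur r (Suc j) ?W) x"
        unfolding q_def by (auto simp: abs_le_iff algebra_simps)
      have ih: "(1 - \<beta>) ^ j * q w x \<le> q (cur r j ?W) x" "q (cur r j ?W) x \<le> (1 + \<beta>) ^ j * q w x"
        using Suc by (auto simp: j_def)
      have "(1 - \<beta>) * ((1 - \<beta>) ^ j * q w x) \<le> (1 - \<beta>) * q (cur r j ?W) x"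
        "(1 + \<beta>) * q (cur r j ?W) x \<le> (1 + \<beta>) * ((1 + \<beta>) ^ j * q w x)"
        using ih \<beta> by (auto intro: mult_left_mono)
      then show ?thesis using up lo pass d by simp
    qed
  qed
qed

lemma final_bounds:
  assumes "\<And>j. j < J \<Longrightarrow> good \<beta> j r" "0 \<le> \<beta>" "\<beta> \<le> 1" "fst (R r t) = J * s"
    and dead: "\<And>e. e \<in> edges G \<Longrightarrow> \<not> live r e J"
  shows "(1 - \<beta>) ^ J * (\<delta> * dot n x x + form n w x) \<le> \<delta> * dot n x x + form n (snd (R r t)) x"
    "\<delta> * dot n x x + form n (snd (R r t)) x \<le> (1 + \<beta>) ^ J * (\<delta> * dot n x x + form n w x)"
proof -
  have "cur r J (snd (R r t)) = snd (R r t)" using dead by (intro ext) (auto simp: cur_def)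
  moreover have "fst (R r t) div s = J" using assms(4) s_pos by simp
  ultimately show "(1 - \<beta>) ^ J * (\<delta> * dot n x x + form n w x) \<le> \<delta> * dot n x x + form n (snd (R r t)) x"
    "\<delta> * dot n x x + form n (snd (R r t)) x \<le> (1 + \<beta>) ^ J * (\<delta> * dot n x x + form n w x)"
    using cur_bounds[OF assms(1-3), of t x] by auto
qed

section \<open>Conditioning on the coins of all other rounds\<close>

definition agree :: "nat \<Rightarrow> (nat \<Rightarrow> nat) \<Rightarrow> (nat \<Rightarrow> nat) \<Rightarrow> bool" where
  "agree j r r' \<longleftrightarrow> (\<forall>e\<in>edges G. \<forall>l. l \<noteq> j \<longrightarrow> bit (r (\<sigma> e)) (idx e l) = bit (r' (\<sigma> e)) (idx e l))"

lemma agree_live: "agree j r r' \<Longrightarrow> e \<in> edges G \<Longrightarrow> i \<le> j \<Longrightarrow> live r e i = live r' e i"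
  unfolding agree_def live_def by (metis less_le_not_le)

lemma agree_cands:
  assumes "agree j r r'" "fst st < Suc j * s"
  shows "cands r st = cands r' st"
proof -
  have "fst st div s \<le> j" using less_mult_imp_div_less[OF assms(2)] by simp
  then show ?thesis unfolding cands_def using agree_live[OF assms(1)] by blast
qed

text \<open>Up to the last pass of round \<open>j\<close> the run asks only which edges survived the
  rounds before \<open>j\<close>, and these bits agree. Bits that no site reads may differ:
  \<open>agree\<close> looks only at edges of \<open>G\<close> and the site that holds them.\<close>

lemma agree_R:
  assumes "agree j r r'" "fst (R r t) < Suc j * s"
  shows "R r' t = R r t"
  using assms(2)
proof (induction t)
  case (Suc t)
  have lt: "fst (R r t) < Suc j * s" using Suc.prems passes_mono[of r t 1] by simp
  then have eq: "R r' t = R r t" by (rule Suc.IH)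
  have "cands r (R r t) = cands r' (R r t)" by (rule agree_cands[OF assms(1) lt])
  then show ?case by (simp only: R_Suc eq)
qed simp

lemma agree_cur: "agree j r r' \<Longrightarrow> i \<le> j \<Longrightarrow> cur r i W = cur r' i W"
  unfolding cur_def using agree_live by (intro ext) auto

definition flp :: "nat \<Rightarrow> nat set \<Rightarrow> (nat \<Rightarrow> nat) \<Rightarrow> nat \<Rightarrow> nat" where
  "flp j e r = r(\<sigma> e := flip_bit (idx e j) (r (\<sigma> e)))"

lemma flip_bit_lt: "m < T \<Longrightarrow> a < 2 ^ T \<Longrightarrow> flip_bit m (a::nat) < 2 ^ T"
  by (metis not_le take_bit_flip_bit_eq take_bit_nat_eq_self_iff)

lemma flp_in_\<Omega>:
  assumes "e \<in> edges G" "j < J" "r \<in> \<Omega>"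
  shows "flp j e r \<in> \<Omega>"
proof -
  have "idx e j < T" using assms edges_subset by (intro T) auto
  then show ?thesis
    using assms \<sigma> flip_bit_lt by (auto simp: \<Omega>_def PiE_dflt_def flp_def)
qed

lemma flip_bit_flip_bit: "flip_bit m (flip_bit m (a::nat)) = a"
  by (rule bit_eqI) (auto simp: bit_flip_bit_iff)

lemma flp_flp: "flp j e (flp j e r) = r"
  by (simp add: flp_def flip_bit_flip_bit)

text \<open>Distinct pairs have distinct positions, so a flip touches exactly one of the bits that
  are read, even when both edges lie at the same site.\<close>

lemma bit_flp:
  assumes "e \<in> edges G" "f \<in> edges G"
  shows "bit (flp j e r (\<sigma> f)) (idx f l) = ((e = f \<and> l = j) \<noteq> bit (r (\<sigma> f)) (idx f l))"
proof -
  have fin: "finite e" "finite f"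
    using assms edges_subset by (auto simp: all_edges_def intro: finite_subset)
  show ?thesis
    using idx_eq_iff[OF fin, of j l] by (auto simp: flp_def bit_flip_bit_iff)
qed

lemma agree_flp: "e \<in> edges G \<Longrightarrow> agree j (flp j e r) r"
  unfolding agree_def by (auto simp: bit_flp)

lemma agree_sym: "agree j r r' \<Longrightarrow> agree j r' r"
  by (auto simp: agree_def)

lemma agree_trans: "agree j r r' \<Longrightarrow> agree j r' r'' \<Longrightarrow> agree j r r''"
  by (auto simp: agree_def)

text \<open>On the coins that agree outside round \<open>j\<close> the board at the end of round \<open>j\<close> is constant, so only
  the signs of round \<open>j\<close> vary there and the deviation bound applies with fixed vectors.\<close>

lemma bad_fibre:
  assumes j: "j < J" and r0: "r0 \<in> \<Omega>" and \<beta>: "\<beta> > 0" and k: "k \<ge> 1" "8 * real k * \<eta> \<le> \<beta>\<^sup>2"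
  shows "card {r \<in> {r\<in>\<Omega>. agree j r r0}. \<not> good \<beta> j r} * 2 ^ k \<le> n * card {r\<in>\<Omega>. agree j r r0}"
proof -
  let ?F = "{r\<in>\<Omega>. agree j r r0}"
  show ?thesis
  proof (cases "\<exists>t. Suc (fst (R r0 t)) = Suc j * s \<and> cands r0 (R r0 t) = {}")
    \<comment> \<open>If the run on \<open>r0\<close> never ends round \<open>j\<close>, neither
      does any run in its fibre, and \<open>good\<close> holds vacuously.\<close>
    case False
    have "good \<beta> j r" if "r \<in> ?F" for r
      unfolding good_def
    proof (intro allI impI, elim conjE)
      fix t x assume a: "Suc (fst (R r t)) = Suc j * s" "cands r (R r t) = {}"
      have ag: "agree j r r0" using that by simp
      have lt: "fst (R r t) < Suc j * s" using a(1) by linarith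
      have "R r0 t = R r t" by (rule agree_R[OF ag lt])
      then have "Suc (fst (R r0 t)) = Suc j * s \<and> cands r0 (R r0 t) = {}"
        using a agree_cands[OF ag lt] by simp
      then show "\<bar>form n (cur r (Suc j) (snd (R r t))) x - form n (cur r j (snd (R r t))) x\<bar>
        \<le> \<beta> * (\<delta> * dot n x x + form n (cur r j (snd (R r t))) x)"
        using False by blast
    qed
    then have "{r \<in> ?F. \<not> good \<beta> j r} = {}" by blast
    then show ?thesis by (simp only: card.empty)
  next
    case True
    then obtain t where t: "Suc (fst (R r0 t)) = Suc j * s" "cands r0 (R r0 t) = {}" by blast
    define W where "W = snd (R r0 t)"
    define C where "C = cur r0 j W"
    define I where "I = {e \<in> edges G. W e = 0 \<and> live r0 e j}"
    define b where "b e = (\<lambda>i. sqrt (2 ^ j * w e) * inc e i)" for e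
    define sg where "sg e r = (if bit (r (\<sigma> e)) (idx e j) then 1 else - 1 :: real)" for e and r :: "nat \<Rightarrow> nat"
    have lt0: "fst (R r0 t) < Suc j * s" using t(1) by linarith
    \<comment> \<open>The count is one short of \<open>Suc j * s\<close>, so the site about to pass
      is the last one, \<open>s - 1\<close>.\<close>
    have dj: "fst (R r0 t) div s = j" "fst (R r0 t) mod s = s - 1"
    proof -
      define q where "q = s - 1"
      have q: "fst (R r0 t) = q + j * s" "q < s" using t(1) s_pos by (auto simp: q_def)
      then show "fst (R r0 t) div s = j" by simp
      have "fst (R r0 t) mod s = q" using q by simp
      then show "fst (R r0 t) mod s = s - 1" by (simp only: q_def)
    qed
    have W0: "0 \<le> W e" for e unfolding W_def by (rule posted_nonneg)
    have C0: "0 \<le> C e" for e unfolding C_def using W0 by (rule cur_nonneg)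
    have WC: "W e \<le> C e" for e using C0[of e] by (auto simp: C_def cur_def)
    have bsq: "(dot n (b e) x)\<^sup>2 = 2 ^ j * w e * (dot n (inc e) x)\<^sup>2" for e x
      unfolding b_def dot_scale_left using w_nonneg[of e] by (simp add: power_mult_distrib)
    have Isub: "I \<subseteq> all_edges n" using edges_subset by (auto simp: I_def)
    \<comment> \<open>The last site has no candidate at this step, and the earlier sites are covered
      by the invariant. Lightness then passes from the board \<open>W\<close> to the larger form
      \<open>C\<close>.\<close>
    have light: "(dot n (b e) x)\<^sup>2 \<le> \<eta> * bil n (gram n \<delta> C) x x" if "e \<in> I" for e x
    proof -
      have e: "e \<in> edges G" "W e = 0" "live r0 e j" using that by (auto simp: I_def)
      have "\<not> heavy n \<eta> \<delta> W (2 ^ j * w e) e"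
      proof (cases "\<sigma> e = s - 1")
        case True
        have "e \<notin> cands r0 (R r0 t)" using t by simp
        then show ?thesis using e True dj by (simp add: cands_def W_def)
      next
        case False
        then have "\<sigma> e < fst (R r0 t) mod s" using \<sigma>[OF e(1)] dj by simp
        then show ?thesis using light_invariant[of e r0 t] e dj by (simp add: W_def)
      qed
      then have "\<not> heavy n \<eta> \<delta> C (2 ^ j * w e) e" by (rule not_heavy_mono) (use WC \<eta>_pos in auto)
      then show ?thesis by (auto simp: bsq bil_gram_self heavy_def not_less)
    qed
    have frame: "(\<Sum>e\<in>I. (dot n (b e) x)\<^sup>2) \<le> bil n (gram n \<delta> C) x x" for x
    proof -
      have "(\<Sum>e\<in>I. (dot n (b e) x)\<^sup>2) = (\<Sum>e\<in>I. C e * (dot n (inc e) x)\<^sup>2)"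
        unfolding bsq by (intro sum.cong) (auto simp: C_def cur_def I_def)
      also have "\<dots> \<le> form n C x"
        unfolding form_def using Isub C0 by (intro sum_mono2) auto
      also have "\<dots> \<le> bil n (gram n \<delta> C) x x"
        unfolding bil_gram_self using \<delta>_pos dot_self_nonneg[of n x] by simp
      finally show ?thesis .
    qed
    \<comment> \<open>A survivor of weight 2^j w is doubled or dropped, in both cases a change by
      2^j w, with the sign given by its bit.\<close>
    have diff: "form n (cur r (Suc j) W) x - form n (cur r j W) x = (\<Sum>e\<in>I. sg e r * (dot n (b e) x)\<^sup>2)"
      if "r \<in> ?F" for r x
    proof -
      have ag: "agree j r r0" using that by simp
      have "form n (cur r (Suc j) W) x - form n (cur r j W) x
         = (\<Sum>e\<in>all_edges n. (cur r (Suc j) W e - cur r j W e) * (dot n (inc e) x)\<^sup>2)"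
        unfolding form_def by (simp add: sum_subtractf[symmetric] algebra_simps)
      also have "\<dots> = (\<Sum>e\<in>all_edges n. if e \<in> I then sg e r * (dot n (b e) x)\<^sup>2 else 0)"
      proof (rule sum.cong[OF refl])
        fix e
        show "(cur r (Suc j) W e - cur r j W e) * (dot n (inc e) x)\<^sup>2
          = (if e \<in> I then sg e r * (dot n (b e) x)\<^sup>2 else 0)"
        proof (cases "e \<in> edges G")
          case True
          have "live r e (Suc j) \<longleftrightarrow> live r e j \<and> bit (r (\<sigma> e)) (idx e j)"
            by (auto simp: live_def less_Suc_eq)
          moreover have "live r e j = live r0 e j" using agree_live[OF ag True] by simp
          ultimately show ?thesis using True unfolding bsq
            by (auto simp: cur_def I_def sg_def algebra_simps)
        next
          case False
          then show ?thesis by (auto simp: cur_def I_def)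
        qed
      qed
      also have "\<dots> = (\<Sum>e\<in>I. sg e r * (dot n (b e) x)\<^sup>2)"
        using Isub by (simp add: sum.If_cases Int_absorb1)
      finally show ?thesis .
    qed
    have "{r \<in> ?F. \<not> good \<beta> j r}
      \<subseteq> {r \<in> ?F. \<not> (\<forall>x. \<bar>\<Sum>e\<in>I. sg e r * (dot n (b e) x)\<^sup>2\<bar> \<le> \<beta> * bil n (gram n \<delta> C) x x)}"
    proof
      fix r assume r: "r \<in> {r \<in> ?F. \<not> good \<beta> j r}"
      then have rF: "r \<in> ?F" and ag: "agree j r r0" by auto
      from r obtain t' x where t': "Suc (fst (R r t')) = Suc j * s" "cands r (R r t') = {}"
        and x: "\<not> \<bar>form n (cur r (Suc j) (snd (R r t'))) x - form n (cur r j (snd (R r t'))) x\<bar>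
            \<le> \<beta> * (\<delta> * dot n x x + form n (cur r j (snd (R r t'))) x)"
        unfolding good_def by blast
      have lt: "fst (R r t') < Suc j * s" using t'(1) by linarith
      have Rt: "R r t = R r0 t" by (rule agree_R[OF agree_sym[OF ag] lt0])
      have pt: "cands r (R r t) = {}" using agree_cands[OF ag] lt0 t(2) unfolding Rt by blast
      have "Suc j * s \<le> J * s" using j by (intro mult_le_mono1) simp
      then have J: "fst (R r t) < J * s" "fst (R r t') < J * s" using lt lt0 Rt by auto
      have inc: "Suc (fst (R r u)) \<le> fst (R r u')"
        if "u < u'" "fst (R r u) < J * s" "cands r (R r u) = {}" for u u'
        using passes_mono[of r "Suc u" "u' - Suc u"] that by (simp add: R_Suc)
      \<comment> \<open>The step \<open>t'\<close> at which \<open>good\<close> fails has to be the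
        step \<open>t\<close> of the fixed run: a pass raises the count, so two passes at the same
        count are the same step.\<close>
      have "t' = t"
      proof (rule ccontr)
        assume "t' \<noteq> t"
        then consider "t < t'" | "t' < t" by linarith
        then show False using inc[of t t'] inc[of t' t] J pt t' t(1) Rt by cases auto
      qed
      then have WW: "snd (R r t') = W" using Rt by (simp add: W_def)
      have "cur r j W = C" unfolding C_def using agree_cur[OF ag] by simp
      then have "\<not> \<bar>\<Sum>e\<in>I. sg e r * (dot n (b e) x)\<^sup>2\<bar> \<le> \<beta> * bil n (gram n \<delta> C) x x"
        using x unfolding WW diff[OF rF] bil_gram_self by simp
      then show "r \<in> {r \<in> ?F. \<not> (\<forall>x. \<bar>\<Sum>e\<in>I. sg e r * (dot n (b e) x)\<^sup>2\<bar> \<le> \<beta> * bil n (gram n \<delta> C) x x)}"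
        using rF by blast
    qed
    then have le1: "card {r \<in> ?F. \<not> good \<beta> j r}
      \<le> card {r \<in> ?F. \<not> (\<forall>x. \<bar>\<Sum>e\<in>I. sg e r * (dot n (b e) x)\<^sup>2\<bar> \<le> \<beta> * bil n (gram n \<delta> C) x x)}"
      using finite_\<Omega> by (intro card_mono) auto
    have le2: "card {r \<in> ?F. \<not> (\<forall>x. \<bar>\<Sum>e\<in>I. sg e r * (dot n (b e) x)\<^sup>2\<bar> \<le> \<beta> * bil n (gram n \<delta> C) x x)} * 2 ^ k
      \<le> n * card ?F"
    proof (rule deviation_count_form[where flip = "flp j" and \<eta> = \<eta>])
      show "pos_def n (gram n \<delta> C)" using \<delta>_pos C0 by (rule pos_def_gram)
      show "finite ?F" using finite_\<Omega> by simp
      show "finite I" using Isub finite_all_edges by (rule finite_subset)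
      show "flp j e r \<in> ?F" if "e \<in> I" "r \<in> ?F" for e r
        using that flp_in_\<Omega>[of e j r] j agree_flp[of e j r] agree_trans[of j "flp j e r" r r0] by (auto simp: I_def)
      show "flp j e (flp j e r) = r" for e r by (rule flp_flp)
      show "sg e r * sg e r = 1" for e r by (simp add: sg_def)
      show "sg e (flp j e r) = - sg e r" if "e \<in> I" for e r
        using that by (auto simp: sg_def bit_flp I_def)
      show "sg f (flp j e r) = sg f r" if "e \<in> I" "f \<in> I" "e \<noteq> f" for e f r
        using that by (auto simp: sg_def bit_flp I_def)
    qed (use light frame \<eta>_pos \<beta> k in auto)
    show ?thesis by (rule order_trans[OF mult_le_mono1[OF le1] le2])
  qed
qed

text \<open>Total probability in counting form: \<rho> lists the bits that \<open>agree\<close>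
  compares, so its level sets are the fibres, and each has the same bound on its bad
  fraction.\<close>

lemma bad_count:
  assumes j: "j < J" and \<beta>: "\<beta> > 0" and k: "k \<ge> 1" "8 * real k * \<eta> \<le> \<beta>\<^sup>2"
  shows "card {r\<in>\<Omega>. \<not> good \<beta> j r} * 2 ^ k \<le> n * card \<Omega>"
proof -
  define \<rho> where "\<rho> r = {(e, l). e \<in> edges G \<and> l \<noteq> j \<and> bit (r (\<sigma> e)) (idx e l)}" for r :: "nat \<Rightarrow> nat"
  have ag: "\<rho> r = \<rho> r' \<longleftrightarrow> agree j r r'" for r r' unfolding \<rho>_def agree_def by blast
  have split: "card A = (\<Sum>h\<in>\<rho> ` \<Omega>. card {r\<in>A. \<rho> r = h})" if "A \<subseteq> \<Omega>" for A
  proof -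
    have "(\<Sum>h\<in>\<rho> ` \<Omega>. sum (\<lambda>_. 1::nat) {r\<in>A. \<rho> r = h}) = sum (\<lambda>_. 1) A"
      by (rule sum.group) (use that finite_\<Omega> in \<open>auto intro: finite_subset\<close>)
    then show ?thesis by simp
  qed
  have "card {r\<in>\<Omega>. \<not> good \<beta> j r} * 2 ^ k = (\<Sum>h\<in>\<rho> ` \<Omega>. card {r\<in>{r\<in>\<Omega>. \<not> good \<beta> j r}. \<rho> r = h} * 2 ^ k)"
    by (subst split) (auto simp: sum_distrib_right)
  also have "\<dots> \<le> (\<Sum>h\<in>\<rho> ` \<Omega>. n * card {r\<in>\<Omega>. \<rho> r = h})"
  proof (rule sum_mono)
    fix h assume "h \<in> \<rho> ` \<Omega>"
    then obtain r0 where r0: "r0 \<in> \<Omega>" "h = \<rho> r0" by blast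
    have "{r\<in>{r\<in>\<Omega>. \<not> good \<beta> j r}. \<rho> r = h} = {r \<in> {r\<in>\<Omega>. agree j r r0}. \<not> good \<beta> j r}"
      "{r\<in>\<Omega>. \<rho> r = h} = {r\<in>\<Omega>. agree j r r0}"
      unfolding r0(2) ag by auto
    then show "card {r\<in>{r\<in>\<Omega>. \<not> good \<beta> j r}. \<rho> r = h} * 2 ^ k \<le> n * card {r\<in>\<Omega>. \<rho> r = h}"
      using bad_fibre[OF j r0(1) \<beta> k] by simp
  qed
  also have "\<dots> = n * card \<Omega>" unfolding split[OF order_refl] by (rule sum_distrib_left[symmetric])
  finally show ?thesis .
qed

text \<open>Flipping bit \<open>j\<close> of \<open>e\<close> maps the coins on which
  \<open>e\<close> survives round \<open>j\<close> injectively to coins on which it dies in that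
  round, so every round at least halves their number.\<close>

lemma live_count:
  assumes e: "e \<in> edges G" and "j \<le> J"
  shows "card {r\<in>\<Omega>. live r e j} * 2 ^ j \<le> card \<Omega>"
  using assms(2)
proof (induction j)
  case 0
  then show ?case by (simp add: live_def)
next
  case (Suc j)
  let ?A = "{r\<in>\<Omega>. live r e (Suc j)}"
  have fin: "finite ?A" using finite_\<Omega> by simp
  have inj: "inj_on (flp j e) ?A" by (rule inj_on_inverseI[of _ "flp j e"]) (rule flp_flp)
  have dis: "?A \<inter> flp j e ` ?A = {}"
    using e by (auto simp: live_def bit_flp)
  have "?A \<union> flp j e ` ?A \<subseteq> {r\<in>\<Omega>. live r e j}"
    using flp_in_\<Omega>[OF e, of j] Suc.prems by (auto simp: live_def bit_flp[OF e e])
  then have "card (?A \<union> flp j e ` ?A) \<le> card {r\<in>\<Omega>. live r e j}"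
    using finite_\<Omega> by (intro card_mono) auto
  then have "2 * card ?A \<le> card {r\<in>\<Omega>. live r e j}"
    using card_Un_disjoint[OF fin _ dis] card_image[OF inj] fin by simp
  then have "2 * card ?A * 2 ^ j \<le> card {r\<in>\<Omega>. live r e j} * 2 ^ j" by (rule mult_le_mono1)
  moreover have "card {r\<in>\<Omega>. live r e j} * 2 ^ j \<le> card \<Omega>" using Suc by simp
  ultimately have "2 * card ?A * 2 ^ j \<le> card \<Omega>" by (rule order_trans)
  then show ?case by (simp add: ac_simps)
qed

lemma failure_count:
  assumes \<beta>: "\<beta> > 0" and k: "k \<ge> 1" "8 * real k * \<eta> \<le> \<beta>\<^sup>2"
  shows "real (card {r\<in>\<Omega>. \<not> ((\<forall>j<J. good \<beta> j r) \<and> (\<forall>e\<in>edges G. \<not> live r e J))})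
    \<le> (real J * n / 2 ^ k + real n ^ 2 / 2 ^ J) * card \<Omega>"
proof -
  let ?B = "\<lambda>j. {r\<in>\<Omega>. \<not> good \<beta> j r}" and ?D = "\<lambda>e. {r\<in>\<Omega>. live r e J}"
  have "{r\<in>\<Omega>. \<not> ((\<forall>j<J. good \<beta> j r) \<and> (\<forall>e\<in>edges G. \<not> live r e J))}
      = (\<Union>j<J. ?B j) \<union> (\<Union>e\<in>edges G. ?D e)" by auto
  then have "card {r\<in>\<Omega>. \<not> ((\<forall>j<J. good \<beta> j r) \<and> (\<forall>e\<in>edges G. \<not> live r e J))}
      \<le> (\<Sum>j<J. card (?B j)) + (\<Sum>e\<in>edges G. card (?D e))"
    using card_Un_le[of "\<Union>j<J. ?B j" "\<Union>e\<in>edges G. ?D e"]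
      card_UN_le[of "{..<J}" ?B] card_UN_le[OF finite_edges, of ?D] by simp
  then have "real (card {r\<in>\<Omega>. \<not> ((\<forall>j<J. good \<beta> j r) \<and> (\<forall>e\<in>edges G. \<not> live r e J))})
      \<le> (\<Sum>j<J. real (card (?B j))) + (\<Sum>e\<in>edges G. real (card (?D e)))"
    by (simp only: of_nat_sum[symmetric] of_nat_add[symmetric] of_nat_le_iff)
  also have "\<dots> \<le> (\<Sum>j<J. n * card \<Omega> / 2 ^ k) + (\<Sum>e\<in>edges G. card \<Omega> / 2 ^ J)"
  proof (intro add_mono sum_mono)
    fix j assume "j \<in> {..<J}"
    then have "card (?B j) * 2 ^ k \<le> n * card \<Omega>" using bad_count[OF _ \<beta> k] by simp
    then have "real (card (?B j) * 2 ^ k) \<le> real (n * card \<Omega>)" by (simp only: of_nat_le_iff)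
    then show "real (card (?B j)) \<le> n * card \<Omega> / 2 ^ k" by (simp add: field_simps)
  next
    fix e assume "e \<in> edges G"
    then have "real (card (?D e) * 2 ^ J) \<le> real (card \<Omega>)" using live_count[of e J] by (simp only: of_nat_le_iff)
    then show "real (card (?D e)) \<le> card \<Omega> / 2 ^ J" by (simp add: field_simps)
  qed
  also have "\<dots> \<le> (real J * n / 2 ^ k) * card \<Omega> + (real n ^ 2 / 2 ^ J) * card \<Omega>"
  proof (rule add_mono)
    have "card (edges G) \<le> n ^ 2"
      using card_mono[OF _ edges_subset] card_all_edges_le[of n] by simp
    then have "real (card (edges G)) \<le> real (n ^ 2)" by (simp only: of_nat_le_iff)
    then have "real (card (edges G)) * (card \<Omega> / 2 ^ J) \<le> real (n ^ 2) * (card \<Omega> / 2 ^ J)"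
      by (rule mult_right_mono) simp
    then show "(\<Sum>e\<in>edges G. card \<Omega> / 2 ^ J) \<le> (real n ^ 2 / 2 ^ J) * card \<Omega>" by simp
  qed simp
  finally show ?thesis by (simp add: algebra_simps)
qed

end

section \<open>Parameters\<close>

context halving_input
begin

text \<open>Three errors combine: rounding gives a factor of at most 1 + \<epsilon>/4, the rounds a
  factor between 1 - \<epsilon>/8 and 1 + \<epsilon>/4, and the regularisation at most doubles the
  latter error. The regularised forms are evaluated at a shifted \<open>y\<close>, where the graph
  forms agree with those at \<open>x\<close> but the \<delta> term is small.\<close>

lemma out_sparsifier:
  assumes gd: "\<And>j. j < J \<Longrightarrow> good \<beta> j r" and dead: "\<And>e. e \<in> edges G \<Longrightarrow> \<not> live r e J"
    and t: "fst (R r t) = J * s" and \<epsilon>: "0 < \<epsilon>" "\<epsilon> < 1" and \<beta>: "0 \<le> \<beta>" "real J * \<beta> = \<epsilon> / 8" "\<beta> \<le> 1"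
    and a: "a > 0" "\<And>e. e \<in> edges G \<Longrightarrow> a \<le> weight G e" "\<delta> * real n ^ 5 \<le> a"
    and K: "4 \<le> \<epsilon> * a * K"
  shows "spectral_sparsifier n \<epsilon> G (out (R r t))"
proof -
  let ?W = "snd (R r t)"
  have wtH: "wt (out (R r t)) = ?W" by (intro ext) (simp add: wt_def out_def)
  have H: "weighted_graph n (out (R r t))" "edges (out (R r t)) \<subseteq> edges G"
    using posted[of r t] edges_subset by (auto simp: weighted_graph_def out_def all_edges_def)
  have w_ge: "weight G e \<le> w e" and w_up: "w e \<le> (1 + \<epsilon> / 4) * weight G e" if e: "e \<in> edges G" for e
  proof -
    have pos: "weight G e > 0" using G e by (simp add: weighted_graph_def)
    have w: "w e = of_int \<lceil>weight G e * K\<rceil> / K" using e pos K_pos by (simp add: w_def mul_def)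
    show "weight G e \<le> w e" unfolding w using K_pos by (simp add: pos_le_divide_eq)
    \<comment> \<open>Rounding adds at most 1 to the numerator, which by the choice of
      \<open>K\<close> is at most \<epsilon>/4 of the numerator before rounding.\<close>
    have "of_int \<lceil>weight G e * K\<rceil> \<le> weight G e * K + 1" by linarith
    also have "1 \<le> \<epsilon> / 4 * (a * K)" using K by simp
    also have "\<epsilon> / 4 * (a * K) \<le> \<epsilon> / 4 * (weight G e * K)"
      using a(2)[OF e] \<epsilon> by (intro mult_left_mono mult_right_mono) auto
    finally have "of_int \<lceil>weight G e * K\<rceil> \<le> (1 + \<epsilon> / 4) * weight G e * K" by (simp add: algebra_simps)
    then show "w e \<le> (1 + \<epsilon> / 4) * weight G e" unfolding w using K_pos by (simp add: pos_divide_le_eq)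
  qed
  have "(1 - \<epsilon>) * form n (wt G) x \<le> form n ?W x \<and> form n ?W x \<le> (1 + \<epsilon>) * form n (wt G) x" for x
  proof -
    obtain y where y: "\<forall>e\<in>edges G. dot n (inc e) y = dot n (inc e) x"
      and yy: "a * dot n y y \<le> real n ^ 5 * form n w x"
      using shift_on_components[where F = "edges G" and W = w and a = a and x = x and n = n]
        edges_subset w_nonneg a(1) order_trans[OF a(2) w_ge] by blast
    have fy: "form n V y = form n V x" if "\<And>e. e \<notin> edges G \<Longrightarrow> V e = 0" for V
      unfolding form_def using y that by (intro sum.cong refl) (metis mult_zero_left)
    define Q D F where "Q = form n w x" and "D = \<delta> * dot n y y" and "F = form n ?W x"
    have Q: "form n w y = Q" unfolding Q_def by (rule fy) (simp add: w_def)
    have F: "form n ?W y = F" unfolding F_def by (rule fy) (use posted[of r t] in auto)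
    have Q0: "0 \<le> Q" unfolding Q_def using w_nonneg by (rule form_nonneg)
    have D0: "0 \<le> D" unfolding D_def using \<delta>_pos dot_self_nonneg[of n y] by simp
    have DQ: "D \<le> Q"
    proof (cases "n = 0")
      case True then show ?thesis using Q0 by (simp add: D_def dot_def)
    next
      case False
      have "real n ^ 5 * D \<le> a * dot n y y"
        unfolding D_def using mult_right_mono[OF a(3) dot_self_nonneg[of n y]] by (simp add: ac_simps)
      then have "real n ^ 5 * D \<le> real n ^ 5 * Q" using yy by (simp add: Q_def)
      then show ?thesis using False by simp
    qed
    have lo: "(1 - \<beta>) ^ J * (D + Q) \<le> D + F" and up: "D + F \<le> (1 + \<beta>) ^ J * (D + Q)"
      using final_bounds[OF gd \<beta>(1,3) t dead, of y] unfolding D_def[symmetric] Q F by auto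
    have "1 - \<epsilon> / 8 \<le> (1 - \<beta>) ^ J"
      using Bernoulli_inequality[of "- \<beta>" J] \<beta> by simp
    then have lo8: "(1 - \<epsilon> / 8) * (D + Q) \<le> D + F"
      using lo mult_right_mono[of "1 - \<epsilon> / 8" "(1 - \<beta>) ^ J" "D + Q"] D0 Q0 by linarith
    have eDQ: "\<epsilon> * D \<le> \<epsilon> * Q" using DQ \<epsilon> by simp
    \<comment> \<open>\<open>D\<close> stands on both sides and cancels, so it counts only through
      \<epsilon> D / 8, which is at most \<epsilon> Q / 8.\<close>
    have lo': "(1 - \<epsilon> / 2) * Q \<le> F"
    proof -
      have eq: "(1 - \<epsilon> / 8) * (D + Q) = D + Q - \<epsilon> * D / 8 - \<epsilon> * Q / 8" "(1 - \<epsilon> / 2) * Q = Q - \<epsilon> * Q / 2"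
        by (simp_all add: algebra_simps add_divide_distrib)
      have aux: "Q - y / 2 \<le> F" if "D + Q - x / 8 - y / 8 \<le> D + F" "x \<le> y" "0 \<le> y" for x y :: real
        using that by linarith
      show ?thesis
        unfolding eq(2) by (rule aux[of "\<epsilon> * D"]) (use lo8 DQ \<epsilon> Q0 in \<open>auto simp: eq(1)[symmetric]\<close>)
    qed
    have "(1 + \<beta>) ^ J \<le> exp (\<beta>) ^ J"
      using \<beta> by (intro power_mono) (auto simp: exp_ge_add_one_self)
    also have "\<dots> = exp (\<epsilon> / 8)" using \<beta>(2) by (simp add: exp_of_nat_mult[symmetric])
    also have "\<dots> \<le> 1 + \<epsilon> / 8 + (\<epsilon> / 8)\<^sup>2" using \<epsilon> by (intro exp_bound) auto
    also have "\<dots> \<le> 1 + \<epsilon> / 4"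
    proof -
      have "\<epsilon> * \<epsilon> \<le> \<epsilon> * 1" using \<epsilon> by (intro mult_left_mono) auto
      moreover have "(\<epsilon> / 8)\<^sup>2 = \<epsilon> * \<epsilon> / 64" by (simp add: power2_eq_square)
      ultimately show ?thesis using \<epsilon> by linarith
    qed
    finally have up4: "D + F \<le> (1 + \<epsilon> / 4) * (D + Q)"
      using up mult_right_mono[of "(1 + \<beta>) ^ J" "1 + \<epsilon> / 4" "D + Q"] D0 Q0 by linarith
    have up': "F \<le> (1 + \<epsilon> / 2) * Q"
    proof -
      have eq: "(1 + \<epsilon> / 4) * (D + Q) = D + Q + \<epsilon> * D / 4 + \<epsilon> * Q / 4" "(1 + \<epsilon> / 2) * Q = Q + \<epsilon> * Q / 2"
        by (simp_all add: algebra_simps add_divide_distrib)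
      have aux: "F \<le> Q + y / 2" if "D + F \<le> D + Q + x / 4 + y / 4" "x \<le> y" for x y :: real
        using that by linarith
      show ?thesis
        unfolding eq(2) by (rule aux[of "\<epsilon> * D"]) (use up4 eDQ in \<open>simp_all only: eq(1)[symmetric]\<close>)
    qed
    define g where "g = form n (wt G) x"
    have g0: "0 \<le> g" unfolding g_def
      using G by (intro form_nonneg) (auto simp: wt_def weighted_graph_def less_imp_le)
    have gQ: "g \<le> Q" unfolding g_def Q_def
      by (intro form_mono) (use w_ge in \<open>auto simp: wt_def w_def\<close>)
    have Qg: "Q \<le> (1 + \<epsilon> / 4) * g"
    proof -
      have "Q \<le> form n (\<lambda>e. (1 + \<epsilon> / 4) * wt G e) x"
        unfolding Q_def by (intro form_mono) (use w_up in \<open>auto simp: wt_def w_def\<close>)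
      also have "\<dots> = (1 + \<epsilon> / 4) * g" by (simp add: g_def form_def sum_distrib_left mult.assoc)
      finally show ?thesis .
    qed
    have "(1 - \<epsilon>) * g \<le> (1 - \<epsilon> / 2) * Q" using \<epsilon> g0 gQ by (intro mult_mono) auto
    then have 1: "(1 - \<epsilon>) * g \<le> F" using lo' by linarith
    have "F \<le> (1 + \<epsilon> / 2) * ((1 + \<epsilon> / 4) * g)"
      using up' mult_left_mono[OF Qg, of "1 + \<epsilon> / 2"] \<epsilon> by linarith
    also have "\<dots> = ((1 + \<epsilon> / 2) * (1 + \<epsilon> / 4)) * g" by simp
    also have "\<dots> \<le> (1 + \<epsilon>) * g"
    proof (rule mult_right_mono)
      have "\<epsilon> * \<epsilon> \<le> \<epsilon> * 1" using \<epsilon> by (intro mult_left_mono) auto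
      moreover have "(1 + \<epsilon> / 2) * (1 + \<epsilon> / 4) = 1 + 3 * \<epsilon> / 4 + \<epsilon> * \<epsilon> / 8"
        by (simp add: algebra_simps)
      ultimately show "(1 + \<epsilon> / 2) * (1 + \<epsilon> / 4) \<le> 1 + \<epsilon>" using \<epsilon> by linarith
    qed (rule g0)
    finally show ?thesis using 1 by (simp add: g_def F_def)
  qed
  then show ?thesis using H by (intro spectral_sparsifierI[OF G]) (simp_all add: wtH)
qed

end

text \<open>Take logarithms: as n! \<le> n^n, the quotient of the determinant bounds is at most 2^(n
  a), while each post contributes ln(1 + \<eta>) \<ge> \<eta> / 2.\<close>

lemma posts_le:
  fixes \<eta> \<delta> B :: real and n N a :: nat
  assumes "0 < \<eta>" "\<eta> \<le> 1 / 2" "0 < \<delta>" "0 \<le> B" "real n * B / \<delta> \<le> 2 ^ a"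
    and le: "(1 + \<eta>) ^ N * \<delta> ^ n \<le> fact n * B ^ n"
  shows "N \<le> nat \<lfloor>2 * real (n * a) / \<eta>\<rfloor>"
proof -
  have "(1 + \<eta>) ^ N \<le> fact n * B ^ n / \<delta> ^ n" using le assms by (simp add: field_simps)
  also have "\<dots> \<le> real n ^ n * B ^ n / \<delta> ^ n"
    using assms fact_le_power[of n, where 'a = real] by (intro divide_right_mono mult_right_mono) auto
  also have "\<dots> = (real n * B / \<delta>) ^ n" by (simp add: power_mult_distrib power_divide)
  also have "\<dots> \<le> (2 ^ a) ^ n" using assms by (intro power_mono) auto
  also have "\<dots> = 2 ^ (n * a)" by (simp add: power_mult[symmetric] mult.commute)
  finally have "ln ((1 + \<eta>) ^ N) \<le> ln (2 ^ (n * a))" using assms by (intro ln_mono) auto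
  then have "N * ln (1 + \<eta>) \<le> real (n * a) * ln 2" using assms by (simp add: ln_realpow)
  also have "\<dots> \<le> real (n * a) * 1" using ln_2_less_1 by (intro mult_left_mono) auto
  finally have 1: "N * ln (1 + \<eta>) \<le> real (n * a)" by simp
  have "\<eta> / 2 \<le> \<eta> - \<eta>\<^sup>2"
  proof -
    have "\<eta> * \<eta> \<le> \<eta> * (1 / 2)" using assms by (intro mult_left_mono) auto
    then show ?thesis by (simp add: power2_eq_square)
  qed
  also have "\<dots> \<le> ln (1 + \<eta>)" using assms by (intro ln_one_plus_pos_lower_bound) auto
  finally have "real N * (\<eta> / 2) \<le> N * ln (1 + \<eta>)" by (intro mult_left_mono) auto
  then have "real N \<le> 2 * real (n * a) / \<eta>" using 1 assms by (simp add: field_simps)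
  then show ?thesis by linarith
qed

lemma block_code_exists:
  fixes S :: "'m set"
  assumes "finite S" "card S \<le> 2 ^ L"
  shows "\<exists>enc dec. \<forall>m\<in>S. length (enc m :: bool list) = L \<and> dec (enc m) = m"
proof -
  have fin: "finite {xs :: bool list. length xs = L}" "card {xs :: bool list. length xs = L} = 2 ^ L"
    using card_lists_length_eq[of "UNIV :: bool set" L] finite_lists_length_eq[of "UNIV :: bool set" L] by auto
  then obtain f where f: "f ` S \<subseteq> {xs :: bool list. length xs = L}" "inj_on f S"
    using card_le_inj[OF assms(1) fin(1)] assms(2) by auto
  then have "\<forall>m\<in>S. length (f m) = L \<and> inv_into S f (f m) = m" by auto
  then show ?thesis by blast
qed

text \<open>As \<open>2 ^ floorlog 2 n\<close> exceeds \<open>n\<close>, the power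
  \<open>2 ^ rounds d n\<close> is at least n^(d+3): this covers n^2 edges and the failure
  probability 1 / n^d, with a factor n to spare for the deviation events.\<close>

definition rounds :: "nat \<Rightarrow> nat \<Rightarrow> nat" where
  "rounds d n = (d + 3) * floorlog 2 n"

text \<open>There are at most n^(2c+2) (q + 2) messages, where q is 4/\<epsilon> rounded up; q + 2
  \<le> 2^(q+2) is a crude bound, but it costs only constantly many bits.\<close>

definition block_len :: "real \<Rightarrow> nat \<Rightarrow> nat \<Rightarrow> nat" where
  "block_len \<epsilon> c n = (2 * c + 2) * floorlog 2 n + (nat \<lceil>4 / \<epsilon>\<rceil> + 2)"

text \<open>This is 2 n a / \<eta>, with \<open>a\<close> the exponent in \<open>posts_le\<close>
  and 1/\<eta> = 1024 J^3 / \<epsilon>^2 for J = \<open>rounds d n\<close>.\<close>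

definition post_bound :: "real \<Rightarrow> nat \<Rightarrow> nat \<Rightarrow> nat \<Rightarrow> real" where
  "post_bound \<epsilon> c d n =
     2048 * real (n * ((2 * c + 8) * floorlog 2 n + rounds d n + 1)) * real (rounds d n) ^ 3 / \<epsilon>\<^sup>2"

lemma protocol_exists:
  fixes \<epsilon> :: real and c d n s :: nat
  assumes \<epsilon>: "0 < \<epsilon>" "\<epsilon> < 1" and n: "n \<ge> 1" and s: "s \<ge> 1"
  shows "\<exists>P :: (wgraph, wgraph) protocol. blackboard_protocol s P \<and>
    (\<forall>G \<sigma>. weighted_graph n G \<and> poly_bounded_weights c n G \<and> (\<forall>e\<in>edges G. \<sigma> e < s) \<longrightarrow>
       (\<forall>r\<in>set_pmf (joint_coins s P). terminates P (site_graph G \<sigma>) r \<and>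
          real (comm_cost P (site_graph G \<sigma>) r)
            \<le> (real (rounds d n) * s + post_bound \<epsilon> c d n) * real (block_len \<epsilon> c n)) \<and>
       measure_pmf.prob (joint_coins s P)
         {r. spectral_sparsifier n \<epsilon> G (protocol_output P (site_graph G \<sigma>) r)} \<ge> 1 - 1 / real n ^ d)"
proof -
  define l where "l = floorlog 2 n"
  define J where "J = rounds d n"
  define L where "L = block_len \<epsilon> c n"
  define q where "q = nat \<lceil>4 / \<epsilon>\<rceil>"
  \<comment> \<open>With k = 2J the factor J of the union bound is absorbed by 2^J. The total drift
    J \<beta> is \<epsilon>/8, and \<eta> is the largest threshold with 8k\<eta> \<le>
    \<beta>^2.\<close>
  define k where "k = 2 * J"
  define \<beta> where "\<beta> = \<epsilon> / (8 * J)"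
  define \<eta> where "\<eta> = \<beta>\<^sup>2 / (8 * k)"
  \<comment> \<open>Weights are at least n^(-c), so this is the largest \<delta> whose n^5-fold
    stays below them. The factor n^c in \<open>K\<close> likewise offsets the smallest weight, and
    \<open>mm\<close> is the numerator n^c K of the largest one.\<close>
  define \<delta> where "\<delta> = 1 / real n ^ (c + 5)"
  define K where "K = n ^ c * q"
  define mm where "mm = n ^ (2 * c) * q"
  \<comment> \<open>The sum is just a quick bound on all bit positions; private coins are not
    charged as communication.\<close>
  define T where "T = Suc (\<Sum>(e, l)\<in>all_edges n \<times> {..<J}. idx e l)"
  define a where "a = (2 * c + 8) * l + J + 1"
  define Cnt where "Cnt = nat \<lfloor>2 * real (n * a) / \<eta>\<rfloor>"
  have nl: "n < 2 ^ l" using floorlog_bounds[of n 2] n by (simp add: l_def)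
  then have l1: "l \<ge> 1" using n by (cases l) auto
  have nl': "real n \<le> 2 ^ l" using nl by (metis less_imp_le of_nat_le_iff of_nat_numeral of_nat_power)
  have J_eq: "J = (d + 3) * l" by (simp add: J_def rounds_def l_def)
  have J1: "J \<ge> 3" using l1 mult_le_mono[of 3 "d + 3" 1 l] by (simp add: J_eq)
  have q4: "4 / \<epsilon> \<le> real q" unfolding q_def by linarith
  then have q1: "q \<ge> 1" using \<epsilon> by (cases q) (auto simp: divide_le_0_iff)
  have \<beta>: "0 < \<beta>" "real J * \<beta> = \<epsilon> / 8" using \<epsilon> J1 by (auto simp: \<beta>_def)
  have \<beta>1: "\<beta> \<le> 1"
  proof -
    have "\<beta> * 1 \<le> \<beta> * real J" using \<beta>(1) J1 by (intro mult_left_mono) auto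
    then show ?thesis using \<beta>(2) \<epsilon> by (simp add: mult.commute)
  qed
  have k1: "k \<ge> 1" using J1 by (simp add: k_def)
  have \<eta>0: "0 < \<eta>" using \<beta> k1 by (simp add: \<eta>_def)
  have \<eta>k: "8 * real k * \<eta> \<le> \<beta>\<^sup>2" using k1 by (simp add: \<eta>_def)
  have \<eta>1: "\<eta> \<le> 1 / 2"
  proof -
    have "8 * 1 * \<eta> \<le> 8 * real k * \<eta>" using k1 \<eta>0 by (intro mult_right_mono) auto
    also have "\<dots> \<le> 1" using \<eta>k \<beta> \<beta>1 power_le_one[of \<beta> 2] by linarith
    finally show ?thesis by simp
  qed
  have inv\<eta>: "1 / \<eta> = 1024 * real J ^ 3 / \<epsilon>\<^sup>2"
    using J1 \<epsilon> by (simp add: \<eta>_def \<beta>_def k_def power2_eq_square power3_eq_cube field_simps)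
  have \<delta>0: "0 < \<delta>" using n by (simp add: \<delta>_def)
  have K0: "K > 0" using n q1 by (simp add: K_def)
  have mmK: "real mm / real K = real n ^ c"
    using n q1 by (simp add: mm_def K_def mult_2 power_add)
  have ab: "real n * (\<delta> + real n ^ 2 * (2 ^ J * (real mm / real K))) / \<delta> \<le> 2 ^ a"
  proof -
    have n1: "1 \<le> real n" using n by simp
    have "\<delta> \<le> 1 * 1" unfolding \<delta>_def using n1 by simp
    also have "\<dots> \<le> real n ^ (c + 2) * 2 ^ J" using n1 by (intro mult_mono one_le_power) auto
    finally have "\<delta> + real n ^ 2 * (2 ^ J * real n ^ c) \<le> 2 * (real n ^ (c + 2) * 2 ^ J)"
      by (simp add: power_add ac_simps power2_eq_square)
    then have "real n * (\<delta> + real n ^ 2 * (2 ^ J * real n ^ c)) \<le> real n * (2 * (real n ^ (c + 2) * 2 ^ J))"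
      by (intro mult_left_mono) auto
    then have "real n * (\<delta> + real n ^ 2 * (2 ^ J * real n ^ c)) / \<delta>
        \<le> real n * (2 * (real n ^ (c + 2) * 2 ^ J)) / \<delta>"
      using \<delta>0 by (intro divide_right_mono) auto
    also have "\<dots> = real n ^ (2 * c + 8) * 2 ^ (J + 1)"
    proof -
      have "2 * c + 8 = 1 + (c + 2) + (c + 5)" by simp
      then have "real n ^ (2 * c + 8) = real n * real n ^ (c + 2) * real n ^ (c + 5)"
        by (simp only: power_add power_one_right)
      then show ?thesis by (simp add: \<delta>_def)
    qed
    also have "\<dots> \<le> (2 ^ l) ^ (2 * c + 8) * 2 ^ (J + 1)"
      using nl' by (intro mult_right_mono power_mono) auto
    also have "\<dots> = 2 ^ (l * (2 * c + 8) + (J + 1))" by (simp only: power_add power_mult)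
    also have "l * (2 * c + 8) + (J + 1) = a" by (simp add: a_def mult.commute)
    finally show ?thesis unfolding mmK .
  qed
  have Cnt: "N \<le> Cnt" if "(1 + \<eta>) ^ N * \<delta> ^ n \<le> fact n * (\<delta> + real n ^ 2 * (2 ^ J * (real mm / real K))) ^ n" for N
    unfolding Cnt_def by (rule posts_le[OF \<eta>0 \<eta>1 \<delta>0 _ ab that]) (use \<delta>0 in auto)
  have cost: "real ((J * s + Cnt) * L) \<le> (real J * s + post_bound \<epsilon> c d n) * real L"
  proof -
    have "real Cnt \<le> 2 * real (n * a) * (1 / \<eta>)"
      unfolding Cnt_def using \<eta>0 by (simp add: of_nat_floor)
    also have "\<dots> = post_bound \<epsilon> c d n"
      unfolding inv\<eta> by (simp add: post_bound_def a_def J_def l_def)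
    finally show ?thesis by (simp add: mult_right_mono)
  qed
  have fin_items: "finite (items n mm)" by (simp add: items_def)
  have "card (items n mm) \<le> 2 ^ L"
  proof -
    have "card (items n mm) \<le> Suc (card (all_edges n) * Suc mm)"
      unfolding items_def using card_image_le[of "all_edges n \<times> {..mm}" Some]
      by (intro order_trans[OF card_insert_le_m1]) (auto simp: card_cartesian_product card_insert_if)
    also have "\<dots> \<le> Suc (n ^ 2 * Suc mm)" by (simp only: Suc_le_mono mult_le_mono1[OF card_all_edges_le])
    also have "\<dots> \<le> n ^ (2 * c + 2) * (q + 2)"
    proof -
      have "1 \<le> n ^ (2 * c + 2)" using n by (rule one_le_power)
      moreover have "n ^ 2 \<le> n ^ (2 * c + 2)" using n by (intro power_increasing) simp_all
      moreover have "n ^ 2 * mm = n ^ (2 * c + 2) * q" by (simp add: mm_def power_add power2_eq_square)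
      ultimately have "Suc (n ^ 2 + n ^ 2 * mm) \<le> n ^ (2 * c + 2) * q + (n ^ (2 * c + 2) + n ^ (2 * c + 2))"
        by linarith
      then show ?thesis by (simp only: mult_Suc_right add_mult_distrib2 mult_2_right)
    qed
    also have "\<dots> \<le> (2 ^ l) ^ (2 * c + 2) * 2 ^ (q + 2)"
      using nl less_exp[of "q + 2"] by (intro mult_le_mono power_mono) auto
    also have "\<dots> = 2 ^ (l * (2 * c + 2) + (q + 2))" by (simp only: power_add power_mult)
    also have "l * (2 * c + 2) + (q + 2) = L"
      by (simp add: L_def block_len_def q_def l_def mult.commute)
    finally show ?thesis .
  qed
  then obtain enc dec where code: "\<forall>m\<in>items n mm. length (enc m :: bool list) = L \<and> dec (enc m) = m"
    using block_code_exists[OF fin_items] by blast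
  have Tb: "idx e i < T" if "e \<in> all_edges n" "i < J" for e i
    using member_le_sum[of "(e, i)" "all_edges n \<times> {..<J}" "\<lambda>(e, l). idx e l"] that
    by (simp add: T_def less_Suc_eq_le)
  interpret halving n s J K T L mm \<eta> \<delta> enc dec
    by unfold_locales (use s K0 \<eta>0 \<delta>0 code Tb in \<open>auto simp: L_def block_len_def\<close>)
  have "blackboard_protocol s prot \<and>
    (\<forall>G \<sigma>. weighted_graph n G \<and> poly_bounded_weights c n G \<and> (\<forall>e\<in>edges G. \<sigma> e < s) \<longrightarrow>
       (\<forall>r\<in>set_pmf (joint_coins s prot). terminates prot (site_graph G \<sigma>) r \<and>
          real (comm_cost prot (site_graph G \<sigma>) r) \<le> (real J * s + post_bound \<epsilon> c d n) * real L) \<and>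
       measure_pmf.prob (joint_coins s prot)
         {r. spectral_sparsifier n \<epsilon> G (protocol_output prot (site_graph G \<sigma>) r)} \<ge> 1 - 1 / real n ^ d)"
  proof (intro conjI allI impI)
    show "blackboard_protocol s prot" by (rule blackboard_prot)
    fix G \<sigma> assume "weighted_graph n G \<and> poly_bounded_weights c n G \<and> (\<forall>e\<in>edges G. \<sigma> e < s)"
    then have G: "weighted_graph n G" and pb: "poly_bounded_weights c n G" and \<sigma>: "\<forall>e\<in>edges G. \<sigma> e < s"
      by auto
    interpret halving_input n s J K T L mm \<eta> \<delta> enc dec G \<sigma>
    proof unfold_locales
      fix e assume e: "e \<in> edges G"
      then have "weight G e \<le> real n ^ c" using pb by (simp add: poly_bounded_weights_def)
      then have "weight G e * real K \<le> real n ^ c * real K" by (intro mult_right_mono) auto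
      also have "\<dots> = real mm" by (simp add: K_def mm_def mult_2 power_add)
      finally have "\<lceil>weight G e * real K\<rceil> \<le> int mm" by (simp add: ceiling_le_iff)
      then show "mul (weight G e) \<le> mm" by (simp only: mul_def nat_le_iff)
    qed (use G \<sigma> in auto)
    let ?t = "J * s + Cnt"
    have stop: "fst (R r ?t) = J * s" for r using stops[OF Cnt] .
    show "\<forall>r\<in>set_pmf (joint_coins s prot). terminates prot (site_graph G \<sigma>) r \<and>
          real (comm_cost prot (site_graph G \<sigma>) r) \<le> (real J * s + post_bound \<epsilon> c d n) * real L"
    proof
      fix r
      have "real (comm_cost prot (site_graph G \<sigma>) r) \<le> real (?t * L)"
        using prot_result(2)[OF stop] by (simp only: of_nat_le_iff)
      then show "terminates prot (site_graph G \<sigma>) r \<and>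
          real (comm_cost prot (site_graph G \<sigma>) r) \<le> (real J * s + post_bound \<epsilon> c d n) * real L"
        using prot_result(1)[OF stop] cost by (auto intro: order_trans)
    qed
    let ?S = "{r. spectral_sparsifier n \<epsilon> G (protocol_output prot (site_graph G \<sigma>) r)}"
    show "measure_pmf.prob (joint_coins s prot) ?S \<ge> 1 - 1 / real n ^ d"
    proof (cases "n = 1")
      \<comment> \<open>For n = 1 the claimed probability is 0; the estimates of the other case use
        n \<ge> 2, for instance n + n^2 \<le> n^3.\<close>
      case True then show ?thesis by simp
    next
      case False
      then have n2: "real n \<ge> 2" using n by simp
      define Bad where "Bad = {r\<in>\<Omega>. \<not> ((\<forall>j<J. good \<beta> j r) \<and> (\<forall>e\<in>edges G. \<not> live r e J))}"
      have "\<Omega> - Bad \<subseteq> \<Omega> \<inter> ?S"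
      proof
        fix r assume "r \<in> \<Omega> - Bad"
        then have r: "r \<in> \<Omega>" "\<And>j. j < J \<Longrightarrow> good \<beta> j r" "\<And>e. e \<in> edges G \<Longrightarrow> \<not> live r e J"
          by (auto simp: Bad_def)
        have "spectral_sparsifier n \<epsilon> G (out (R r ?t))"
        proof (rule out_sparsifier[where \<beta> = \<beta> and a = "1 / real n ^ c"])
          show "\<delta> * real n ^ 5 \<le> 1 / real n ^ c" using n2 by (simp add: \<delta>_def power_add)
          have "4 \<le> \<epsilon> * real q" using q4 \<epsilon> by (simp add: field_simps)
          then show "4 \<le> \<epsilon> * (1 / real n ^ c) * real K" using n2 by (simp add: K_def)
          show "1 / real n ^ c \<le> weight G e" if "e \<in> edges G" for e
            using pb that by (simp add: poly_bounded_weights_def)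
        qed (use r stop \<beta> \<beta>1 \<epsilon> n2 in auto)
        then show "r \<in> \<Omega> \<inter> ?S" using r prot_result(3)[OF stop] by simp
      qed
      then have "card (\<Omega> - Bad) \<le> card (\<Omega> \<inter> ?S)" using finite_\<Omega> by (intro card_mono) auto
      moreover have "card (\<Omega> - Bad) = card \<Omega> - card Bad"
        using finite_\<Omega> by (intro card_Diff_subset) (auto simp: Bad_def)
      moreover have "card Bad \<le> card \<Omega>" using finite_\<Omega> by (intro card_mono) (auto simp: Bad_def)
      ultimately have ge: "real (card \<Omega>) - real (card Bad) \<le> real (card (\<Omega> \<inter> ?S))" by linarith
      have \<Omega>0: "real (card \<Omega>) > 0" using finite_\<Omega> \<Omega>_nonempty by (simp add: card_gt_0_iff)
      have bad: "real (card Bad) \<le> (real J * n / 2 ^ k + real n ^ 2 / 2 ^ J) * card \<Omega>"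
        unfolding Bad_def by (rule failure_count[OF \<beta>(1) k1 \<eta>k])
      have num: "real J * n / 2 ^ k + real n ^ 2 / 2 ^ J \<le> 1 / real n ^ d"
      proof -
        have "real n ^ (d + 3) \<le> (2 ^ l) ^ (d + 3)" using nl' by (intro power_mono) auto
        also have "\<dots> = 2 ^ J" by (simp add: J_eq power_mult[symmetric] mult.commute)
        finally have nJ: "real n ^ (d + 3) \<le> 2 ^ J" .
        have "real J \<le> real (2 ^ J)" using less_exp[of J] by (simp only: of_nat_le_iff less_imp_le)
        then have JJ: "real J \<le> 2 ^ J" by simp
        have "real J * n / 2 ^ k = (real J / 2 ^ J) * (n / 2 ^ J)" by (simp add: k_def mult_2 power_add)
        also have "\<dots> \<le> 1 * (n / 2 ^ J)" using JJ by (intro mult_right_mono) auto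
        finally have "real J * n / 2 ^ k + real n ^ 2 / 2 ^ J \<le> (real n + real n ^ 2) / 2 ^ J"
          by (simp add: add_divide_distrib)
        also have "\<dots> \<le> (real n + real n ^ 2) / real n ^ (d + 3)"
          using nJ n2 by (intro divide_left_mono) auto
        also have "\<dots> \<le> real n ^ 3 / real n ^ (d + 3)"
        proof (intro divide_right_mono)
          have "real n + real n ^ 2 \<le> 2 * real n ^ 2" using n2 by (simp add: power2_eq_square)
          also have "\<dots> \<le> real n * real n ^ 2" using n2 by (intro mult_right_mono) auto
          finally show "real n + real n ^ 2 \<le> real n ^ 3" by (simp add: power2_eq_square power3_eq_cube)
        qed simp
        also have "\<dots> = 1 / real n ^ d" using n2 by (simp add: power_add)
        finally show ?thesis .
      qed
      have "real (card Bad) \<le> 1 / real n ^ d * card \<Omega>"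
        using bad mult_right_mono[OF num, of "real (card \<Omega>)"] by linarith
      then have "(1 - 1 / real n ^ d) * card \<Omega> \<le> real (card (\<Omega> \<inter> ?S))"
        using ge by (simp add: left_diff_distrib)
      then have "1 - 1 / real n ^ d \<le> real (card (\<Omega> \<inter> ?S)) / card \<Omega>" using \<Omega>0 by (simp add: pos_le_divide_eq)
      then show ?thesis
        unfolding joint_coins_prot using measure_pmf_of_set[OF \<Omega>_nonempty finite_\<Omega>, of ?S] by simp
    qed
  qed
  then show ?thesis unfolding J_def L_def by blast
qed

text \<open>All logarithmic quantities are O(\<Lambda>) for \<Lambda> = log(2 + n + s). The exponent
  5 consists of 3 from 1/\<eta>, 1 from the determinant exponent and 1 from the message
  length.\<close>

lemma cost_soft_O:
  assumes "0 < \<epsilon>"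
  shows "(\<lambda>n s. (real (rounds d n) * s + post_bound \<epsilon> c d n) * real (block_len \<epsilon> c n))
    \<in> soft_O (\<lambda>n s. real n + real s)"
proof -
  define A where "A = 2 * real (d + 3)"
  define E where "E = 2 * real (2 * c + 8) + A + 1"
  define M where "M = 2 * real (2 * c + 2) + real (nat \<lceil>4 / \<epsilon>\<rceil> + 2)"
  define C where "C = (A + 2048 * E * A ^ 3 / \<epsilon>\<^sup>2) * M"
  have A0: "A \<ge> 0" "E \<ge> 0" "M \<ge> 0" by (auto simp: A_def E_def M_def)
  have "\<bar>(real (rounds d n) * s + post_bound \<epsilon> c d n) * real (block_len \<epsilon> c n)\<bar>
     \<le> C * \<bar>real n + real s\<bar> * log 2 (2 + \<bar>real n + real s\<bar>) ^ 5" if n: "n \<ge> 1" and s: "s \<ge> 1" for n s :: nat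
  proof -
    define f where "f = real n + real s"
    define \<Lambda> where "\<Lambda> = log 2 (2 + f)"
    have f: "0 \<le> f" "real n \<le> f" "real s \<le> f" by (auto simp: f_def)
    have \<Lambda>1: "1 \<le> \<Lambda>" unfolding \<Lambda>_def using f by simp
    have "real (floorlog 2 n) \<le> log 2 n + 1"
      using n unfolding floorlog_def by simp
    also have "log 2 n \<le> \<Lambda>" unfolding \<Lambda>_def using n f by simp
    finally have l: "real (floorlog 2 n) \<le> 2 * \<Lambda>" using \<Lambda>1 by simp
    have J: "real (rounds d n) \<le> A * \<Lambda>"
      using mult_left_mono[OF l, of "real (d + 3)"] by (simp add: rounds_def A_def algebra_simps)
    have pE: "real ((2 * c + 8) * floorlog 2 n + rounds d n + 1) \<le> E * \<Lambda>"
      using mult_left_mono[OF l, of "real (2 * c + 8)"] J \<Lambda>1 by (simp add: E_def algebra_simps)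
    have pM: "real (block_len \<epsilon> c n) \<le> M * \<Lambda>"
      using mult_left_mono[OF l, of "real (2 * c + 2)"] mult_left_mono[OF \<Lambda>1, of "real (nat \<lceil>4 / \<epsilon>\<rceil> + 2)"]
      by (simp add: block_len_def M_def algebra_simps)
    have "post_bound \<epsilon> c d n
        = 2048 * (real n * real ((2 * c + 8) * floorlog 2 n + rounds d n + 1)) * real (rounds d n) ^ 3 / \<epsilon>\<^sup>2"
      by (simp only: post_bound_def of_nat_mult)
    also have "\<dots> \<le> 2048 * (f * (E * \<Lambda>)) * (A * \<Lambda>) ^ 3 / \<epsilon>\<^sup>2"
      using J pE f A0 \<Lambda>1 by (intro divide_right_mono mult_mono power_mono order_refl) auto
    also have "\<dots> = (2048 * E * A ^ 3 / \<epsilon>\<^sup>2) * (f * \<Lambda> ^ 4)"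
      by (simp add: power_mult_distrib eval_nat_numeral ac_simps)
    finally have pb: "post_bound \<epsilon> c d n \<le> (2048 * E * A ^ 3 / \<epsilon>\<^sup>2) * (f * \<Lambda> ^ 4)" .
    have "real (rounds d n) * s \<le> (A * \<Lambda>) * f" using J f A0 \<Lambda>1 by (intro mult_mono) auto
    also have "\<dots> = A * (f * \<Lambda> ^ 1)" by simp
    also have "\<dots> \<le> A * (f * \<Lambda> ^ 4)" using A0 f \<Lambda>1 by (intro mult_left_mono power_increasing) auto
    finally have js: "real (rounds d n) * s \<le> A * (f * \<Lambda> ^ 4)" .
    have pb0: "0 \<le> post_bound \<epsilon> c d n" by (simp add: post_bound_def)
    have "(real (rounds d n) * s + post_bound \<epsilon> c d n) * real (block_len \<epsilon> c n)
        \<le> ((A + 2048 * E * A ^ 3 / \<epsilon>\<^sup>2) * (f * \<Lambda> ^ 4)) * (M * \<Lambda>)"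
      using js pb pM A0 f \<Lambda>1 by (intro mult_mono) (auto simp: distrib_right)
    also have "\<dots> = C * f * \<Lambda> ^ 5" by (simp add: C_def eval_nat_numeral ac_simps)
    finally show ?thesis using pb0 f by (simp add: f_def \<Lambda>_def abs_mult)
  qed
  then show ?thesis unfolding soft_O_def by blast
qed

theorem theorem3p7:
  fixes \<epsilon> :: real and c d :: nat
  assumes "0 < \<epsilon>" and "\<epsilon> < 1"
  shows "\<exists>(P :: nat \<Rightarrow> nat \<Rightarrow> (wgraph, wgraph) protocol) (B :: nat \<Rightarrow> nat \<Rightarrow> real).
    B \<in> soft_O (\<lambda>n s. real n + real s) \<and>
    (\<forall>n\<ge>1. \<forall>s\<ge>1.
       blackboard_protocol s (P n s) \<and>
       (\<forall>G \<sigma>. weighted_graph n G \<and> poly_bounded_weights c n G \<and> (\<forall>e\<in>edges G. \<sigma> e < s) \<longrightarrow>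
          (\<forall>r\<in>set_pmf (joint_coins s (P n s)).
             terminates (P n s) (site_graph G \<sigma>) r \<and>
             real (comm_cost (P n s) (site_graph G \<sigma>) r) \<le> B n s) \<and>
          measure_pmf.prob (joint_coins s (P n s))
            {r. spectral_sparsifier n \<epsilon> G (protocol_output (P n s) (site_graph G \<sigma>) r)}
          \<ge> 1 - 1 / real n ^ d))"
proof -
  define B where "B n s = (real (rounds d n) * real s + post_bound \<epsilon> c d n) * real (block_len \<epsilon> c n)" for n s
  define good where "good n s P \<longleftrightarrow> blackboard_protocol s P \<and>
       (\<forall>G \<sigma>. weighted_graph n G \<and> poly_bounded_weights c n G \<and> (\<forall>e\<in>edges G. \<sigma> e < s) \<longrightarrow>
          (\<forall>r\<in>set_pmf (joint_coins s P).
             terminates P (site_graph G \<sigma>) r \<and> real (comm_cost P (site_graph G \<sigma>) r) \<le> B n s) \<and>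
          measure_pmf.prob (joint_coins s P)
            {r. spectral_sparsifier n \<epsilon> G (protocol_output P (site_graph G \<sigma>) r)}
          \<ge> 1 - 1 / real n ^ d)" for n s and P :: "(wgraph, wgraph) protocol"
  have ex: "\<exists>P. good n s P" if "n \<ge> 1" "s \<ge> 1" for n s
    using protocol_exists[OF assms that, of c d] unfolding good_def B_def .
  define P where "P n s = (SOME P. good n s P)" for n s
  have P: "\<forall>n\<ge>1. \<forall>s\<ge>1. good n s (P n s)"
    unfolding P_def by (intro allI impI someI_ex[OF ex])
  have B: "B \<in> soft_O (\<lambda>n s. real n + real s)"
    unfolding B_def using cost_soft_O[OF assms(1)] .
  show ?thesis
    by (rule exI[of _ P], rule exI[of _ B], rule conjI[OF B P[unfolded good_def]])
qed

end
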